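(* There exists a complete Riemannian plane with precisely two embedded geodesic lines.
   Context: A complete Riemannian plane is a complete smooth ($C^\infty$) Riemannian manifold $M$ homeomorphic (equivalently diffeomorphic) to $\mathbb{R}^2$. Geodesics are parameterized by arclength. An embedded geodesic line in $M$ is the image $c(\mathbb{R})\subset M$ of a geodesic $c\colon\mathbb{R}\to M$ that is injective as a map on $\mathbb{R}$ and proper as a map from $\mathbb{R}$ to $M$. Embedded geodesic lines are counted as subsets of $M$; they are not required to be length-minimizing. *)

theory Defs
  imports "HOL-Analysis.Analysis"
begin

text \<open>
  A Riemannian plane is presented in a global coordinate system: the manifold is \<open>real^2\<close> with its
  standard smooth structure, and the Riemannian metric is given by its Gram matrix field.
  Pulling the metric back along a diffeomorphism with the Euclidean plane brings every smooth
  Riemannian manifold diffeomorphic to the plane into this form, up to isometry.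
  The notions below make sense for \<open>real^'n\<close>.
\<close>

text \<open>
  In finite dimension, a function is of class \<open>C^(k+1)\<close> iff it is differentiable and all its
  directional derivatives are of class \<open>C^k\<close>.
\<close>

primrec C_k :: "nat \<Rightarrow> ('a::euclidean_space \<Rightarrow> 'b::real_normed_vector) \<Rightarrow> bool" where
  "C_k 0 f \<longleftrightarrow> continuous_on UNIV f"
| "C_k (Suc k) f \<longleftrightarrow>
     (\<forall>x. f differentiable (at x)) \<and> (\<forall>v. C_k k (\<lambda>x. frechet_derivative f (at x) v))"

definition C_infinity :: "('a::euclidean_space \<Rightarrow> 'b::real_normed_vector) \<Rightarrow> bool" where
  "C_infinity f \<longleftrightarrow> (\<forall>k. C_k k f)"

definition riemannian_metric :: "(real^'n \<Rightarrow> real^'n^'n) \<Rightarrow> bool" where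
  "riemannian_metric g \<longleftrightarrow>
     (\<forall>i j. C_infinity (\<lambda>x. g x $ i $ j)) \<and>
     (\<forall>x. transpose (g x) = g x) \<and>
     (\<forall>x v. v \<noteq> 0 \<longrightarrow> v \<bullet> (g x *v v) > 0)"

definition riem_norm :: "(real^'n \<Rightarrow> real^'n^'n) \<Rightarrow> real^'n \<Rightarrow> real^'n \<Rightarrow> real" where
  "riem_norm g x v = sqrt (v \<bullet> (g x *v v))"

definition riem_speed :: "(real^'n \<Rightarrow> real^'n^'n) \<Rightarrow> (real \<Rightarrow> real^'n) \<Rightarrow> real \<Rightarrow> real" where
  "riem_speed g p t = riem_norm g (p t) (vector_derivative p (at t))"

definition riem_length :: "(real^'n \<Rightarrow> real^'n^'n) \<Rightarrow> (real \<Rightarrow> real^'n) \<Rightarrow> real" where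
  "riem_length g p = integral {0..1} (riem_speed g p)"

text \<open>
  The infimum of the lengths of the piecewise \<open>C^1\<close> paths from \<open>x\<close> to \<open>y\<close>. The derivative of a
  \<^const>\<open>valid_path\<close> may be unbounded near its finitely many exceptional parameters; the integrability
  condition excludes paths of infinite length, for which \<^const>\<open>integral\<close> would return \<open>0\<close>.
\<close>

definition riem_dist :: "(real^'n \<Rightarrow> real^'n^'n) \<Rightarrow> real^'n \<Rightarrow> real^'n \<Rightarrow> real" where
  "riem_dist g x y =
     Inf {riem_length g p | p. valid_path p \<and> riem_speed g p integrable_on {0..1} \<and>
                               pathstart p = x \<and> pathfinish p = y}"

definition complete_riemannian_metric :: "(real^'n \<Rightarrow> real^'n^'n) \<Rightarrow> bool" where
  "complete_riemannian_metric g \<longleftrightarrow>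
     riemannian_metric g \<and> Metric_space.mcomplete UNIV (riem_dist g)"

definition partial_deriv :: "'n \<Rightarrow> (real^'n \<Rightarrow> real) \<Rightarrow> real^'n \<Rightarrow> real" where
  "partial_deriv i f x = frechet_derivative f (at x) (axis i 1)"

text \<open>Christoffel symbols of the Levi-Civita connection; the upper index \<open>k\<close> comes first.\<close>

definition christoffel ::
    "(real^'n \<Rightarrow> real^'n^'n) \<Rightarrow> real^'n \<Rightarrow> 'n \<Rightarrow> 'n \<Rightarrow> 'n \<Rightarrow> real" where
  "christoffel g x k i j =
     (\<Sum>l\<in>UNIV. matrix_inv (g x) $ k $ l *
        (partial_deriv i (\<lambda>y. g y $ j $ l) x + partial_deriv j (\<lambda>y. g y $ i $ l) x
         - partial_deriv l (\<lambda>y. g y $ i $ j) x)) / 2"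

text \<open>
  Geodesics defined on the whole real line and parametrized by arclength; \<open>v\<close> is the velocity of \<open>c\<close>,
  and the second condition says that its covariant derivative along \<open>c\<close> vanishes.
\<close>

definition unit_speed_geodesic :: "(real^'n \<Rightarrow> real^'n^'n) \<Rightarrow> (real \<Rightarrow> real^'n) \<Rightarrow> bool" where
  "unit_speed_geodesic g c \<longleftrightarrow>
     (\<exists>v. \<forall>t. (c has_vector_derivative v t) (at t) \<and>
              (v has_vector_derivative
                 (\<chi> k. - (\<Sum>i\<in>UNIV. \<Sum>j\<in>UNIV. christoffel g (c t) k i j * v t $ i * v t $ j))) (at t) \<and>
              riem_norm g (c t) (v t) = 1)"

text \<open>
  The topology of the manifold is the Euclidean one, and \<^const>\<open>proper_map\<close> (closed with compact fibres)
  is here the same as compactness of the preimages of compact sets.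
\<close>

definition embedded_geodesic_lines :: "(real^'n \<Rightarrow> real^'n^'n) \<Rightarrow> (real^'n) set set" where
  "embedded_geodesic_lines g =
     {range c | c. unit_speed_geodesic g c \<and> inj c \<and> proper_map euclidean euclidean c}"

end

theory Submission
  imports Defs "HOL-Computational_Algebra.Polynomial"
begin

text \<open>
  The plane is a flat disc that is not round, with a cusp glued to it along the outward normals of
  its boundary.

  Take parallel convex curves with support functions \<open>r + h\<close>, where \<open>h = e cos 2\<phi>\<close> with a small
  \<open>e > 0\<close>. In the coordinates given by the normal angle \<open>\<phi>\<close> and by \<open>r\<close>, the Euclidean metric is
  \<open>dr\<^sup>2 + \<rho>\<^sup>2 d\<phi>\<^sup>2\<close> with \<open>\<rho> = r + h + h'' = r - 3e cos 2\<phi>\<close>, the radius of curvature. It is kept for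
  \<open>r\<^sup>2 \<le> 5\<close>; then \<open>\<rho>\<^sup>2\<close> is replaced by a function \<open>F\<close> that ends up as \<open>1/r\<^sup>2\<close>.

  For a unit speed geodesic put \<open>p = F \<phi>'\<close>. Then \<open>r'\<^sup>2 + p\<^sup>2/F = 1\<close>, and \<open>p'\<close> is a multiple of \<open>p\<close>, so
  \<open>p = 0\<close> persists as long as the geodesic stays outside the unit circle, and it means that the
  geodesic runs along a normal. In the cusp \<open>F\<close> does not depend on \<open>\<phi>\<close>, hence \<open>p\<close> is constant there, and
  \<open>p\<^sup>2 \<le> F\<close>, which tends to zero: a geodesic that escapes to infinity has \<open>p = 0\<close> at both ends. So a
  proper geodesic comes in along the normal of some direction \<open>N\<close> and crosses the disc on a straight
  line. There are two cases when it leaves the disc.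

  If \<open>p = 0\<close>, then the line is normal to the curves at both ends. The directions there are opposite, and
  comparing the moments of the line, which are \<open>h'\<close> at one end and \<open>- h'\<close> at the other while \<open>h'\<close> has
  period \<open>\<pi>\<close>, gives \<open>h' = 0\<close>. These are the double normals of the curve, its two axes of symmetry.

  If \<open>p \<noteq> 0\<close>, then \<open>|p|\<close> is small, because \<open>h'\<close> is. The geodesic therefore climbs to the height
  \<open>r = 1/(2|p|)\<close>, and since \<open>\<phi>' = p/F = p r\<^sup>2\<close> in the cusp, it turns by more than \<open>2\<pi>\<close> on the way. It meets
  the ray of direction \<open>N\<close> on which it came in, so it is not injective.

  Conversely both axes of symmetry are geodesics. The manifold is complete since \<open>sqrt (1 + |x|\<^sup>2)\<close> and
  \<open>x/(1 + |x|\<^sup>2)\<close> are Lipschitz functions for the Riemannian distance and together determine \<open>x\<close>.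

  A global chart is obtained from the potential \<open>P = |z|\<^sup>2/2 + e (x\<^sup>2 - y\<^sup>2) s(|z|\<^sup>2)\<close>, where \<open>s\<close> is smooth on
  the line and \<open>s(q) = 1/sqrt q\<close> for \<open>q \<ge> 1/2\<close>. Its gradient \<open>\<Phi>\<close> maps the point with polar coordinates
  \<open>(r, \<phi>)\<close>, \<open>r\<close> not too small, to the point with normal coordinates \<open>(r, \<phi>)\<close>, because there \<open>P\<close> differs
  from \<open>|z|\<^sup>2/2\<close> by the homogeneous function \<open>r h(\<phi>)\<close>. The flat part of the metric is the pullback
  of the Euclidean metric under \<open>\<Phi>\<close>, that is, the square of the Hessian of \<open>P\<close>.

  The main steps are \<open>complete_g\<close>, \<open>m_zero_propagates\<close>, \<open>incoming_ray\<close>, \<open>crossing_of_flat_zone\<close>,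
  \<open>excursion_meets_every_direction\<close>, \<open>range_is_axis_line\<close> and \<open>axis_line_embedded\<close>.
\<close>

section \<open>Smooth functions\<close>

lemma C_k_Suc_imp_C_k: "C_k (Suc k) f \<Longrightarrow> C_k k f"
proof (induction k arbitrary: f)
  case 0
  then show ?case
    by (auto simp: continuous_on_eq_continuous_at differentiable_imp_continuous_within)
next
  case (Suc k)
  then show ?case
    by (metis C_k.simps(2))
qed

lemma C_k_const: "C_k k (\<lambda>x. a)"
  by (induction k arbitrary: a) (auto simp: frechet_derivative_const)

lemma C_k_bounded_linear: "bounded_linear f \<Longrightarrow> C_k k f"
proof (induction k)
  case 0
  then show ?case by (simp add: linear_continuous_on)
next
  case (Suc k)
  have "frechet_derivative f (at x) = f" for x
    using Suc.prems by (metis bounded_linear_imp_has_derivative frechet_derivative_at)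
  then show ?case
    using Suc.prems by (auto simp: C_k_const bounded_linear_imp_differentiable)
qed

lemma C_k_add: "C_k k f \<Longrightarrow> C_k k g \<Longrightarrow> C_k k (\<lambda>x. f x + g x)"
proof (induction k arbitrary: f g)
  case 0
  then show ?case by (auto intro: continuous_on_add)
next
  case (Suc k)
  then have d: "f differentiable (at x)" "g differentiable (at x)" for x
    by auto
  have "frechet_derivative (\<lambda>x. f x + g x) (at x) =
      (\<lambda>v. frechet_derivative f (at x) v + frechet_derivative g (at x) v)" for x
    using d[of x] unfolding frechet_derivative_works
    by (intro frechet_derivative_at[symmetric] has_derivative_add)
  with Suc d show ?case
    by auto
qed

lemma C_k_mult:
  fixes f g :: "'a::euclidean_space \<Rightarrow> real"
  shows "C_k k f \<Longrightarrow> C_k k g \<Longrightarrow> C_k k (\<lambda>x. f x * g x)"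
proof (induction k arbitrary: f g)
  case 0
  then show ?case by (auto intro: continuous_on_mult)
next
  case (Suc k)
  have d: "f differentiable (at x)" "g differentiable (at x)" for x
    using Suc.prems by auto
  have eq: "frechet_derivative (\<lambda>x. f x * g x) (at x) v =
      f x * frechet_derivative g (at x) v + frechet_derivative f (at x) v * g x" for x v
    using frechet_derivative_at[OF has_derivative_mult[OF
        d(1)[of x, unfolded frechet_derivative_works] d(2)[of x, unfolded frechet_derivative_works]]]
    by metis
  have "C_k k (\<lambda>x. frechet_derivative (\<lambda>x. f x * g x) (at x) v)" for v
    unfolding eq
    using Suc.prems C_k_Suc_imp_C_k by (intro C_k_add Suc.IH) auto
  with d show ?case by (auto intro: differentiable_mult)
qed

lemma frechet_derivative_real_compose:
  fixes f :: "real \<Rightarrow> real"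
  assumes f: "f differentiable (at (u x))" and u: "u differentiable (at x)"
  shows "frechet_derivative (\<lambda>x. f (u x)) (at x) v =
         frechet_derivative f (at (u x)) 1 * frechet_derivative u (at x) v"
proof -
  have "frechet_derivative (\<lambda>x. f (u x)) (at x) =
      frechet_derivative f (at (u x)) \<circ> frechet_derivative u (at x)"
    using frechet_derivative_compose[of u x f] assms by (simp add: o_def)
  moreover have "frechet_derivative f (at (u x)) y = frechet_derivative f (at (u x)) 1 * y" for y
    using linear_frechet_derivative[OF f] linear_scale[of _ y 1] by (metis mult.commute mult.right_neutral real_scaleR_def)
  ultimately show ?thesis by (metis comp_apply)
qed

lemma C_k_compose_real:
  fixes f :: "real \<Rightarrow> real" and u :: "'a::euclidean_space \<Rightarrow> real"
  shows "C_k k f \<Longrightarrow> C_k k u \<Longrightarrow> C_k k (\<lambda>x. f (u x))"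
proof (induction k arbitrary: f)
  case 0
  then show ?case using continuous_on_compose2[of UNIV f UNIV u] by auto
next
  case (Suc k)
  have d: "f differentiable (at y)" "u differentiable (at x)" for x y
    using Suc.prems by auto
  have "C_k k (\<lambda>x. frechet_derivative (\<lambda>x. f (u x)) (at x) v)" for v
    unfolding frechet_derivative_real_compose[OF d]
    using Suc.prems C_k_Suc_imp_C_k
    by (intro C_k_mult Suc.IH[of "\<lambda>y. frechet_derivative f (at y) 1"]) auto
  moreover have "(\<lambda>x. f (u x)) differentiable (at x)" for x
    using differentiable_chain_at[OF d(2) d(1)] by (simp add: o_def)
  ultimately show ?case by simp
qed

text \<open>
  Differentiation leads from one real exponent to another, so the induction needs all exponents at once.
\<close>

lemma C_k_powr:
  fixes u :: "'a::euclidean_space \<Rightarrow> real"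
  assumes pos: "\<And>x. u x > 0"
  shows "C_k k u \<Longrightarrow> C_k k (\<lambda>x. u x powr a)"
proof (induction k arbitrary: a)
  case 0
  have "u x \<noteq> 0" for x using pos[of x] by simp
  with 0 show ?case
    by (simp add: continuous_on_powr)
next
  case (Suc k)
  have d: "u differentiable (at x)" for x
    using Suc.prems by auto
  have D: "((\<lambda>x. u x powr a) has_derivative
      (\<lambda>v. a * (u x powr (a - 1) * frechet_derivative u (at x) v))) (at x)" for x
  proof -
    have "((\<lambda>y. y powr a) has_real_derivative a * u x powr (a - 1)) (at (u x))"
      using pos by (rule has_real_derivative_powr)
    then have "((\<lambda>x. u x powr a) has_derivative
      (\<lambda>v. frechet_derivative u (at x) v * (a * u x powr (a - 1)))) (at x)"
      using d frechet_derivative_works by (intro DERIV_compose_FDERIV) blast+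
    then show ?thesis by (simp add: mult_ac)
  qed
  have "frechet_derivative (\<lambda>x. u x powr a) (at x) v =
      a * (u x powr (a - 1) * frechet_derivative u (at x) v)" for x v
    using frechet_derivative_at[OF D] by metis
  moreover have "C_k k (\<lambda>x. a * (u x powr (a - 1) * frechet_derivative u (at x) v))" for v
    using Suc.prems C_k_Suc_imp_C_k
    by (intro C_k_mult C_k_const Suc.IH) auto
  moreover have "\<forall>x. (\<lambda>x. u x powr a) differentiable (at x)"
    using D unfolding differentiable_def by blast
  ultimately show ?case unfolding C_k.simps by presburger
qed

lemma C_infinity_const: "C_infinity (\<lambda>x. a)"
  and C_infinity_bounded_linear: "bounded_linear l \<Longrightarrow> C_infinity l"
  and C_infinity_add: "C_infinity f \<Longrightarrow> C_infinity g \<Longrightarrow> C_infinity (\<lambda>x. f x + g x)"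
  by (simp_all add: C_infinity_def C_k_const C_k_bounded_linear C_k_add)

lemma C_infinity_mult:
  fixes f g :: "'a::euclidean_space \<Rightarrow> real"
  shows "C_infinity f \<Longrightarrow> C_infinity g \<Longrightarrow> C_infinity (\<lambda>x. f x * g x)"
  by (simp add: C_infinity_def C_k_mult)

lemma C_infinity_diff:
  fixes f g :: "'a::euclidean_space \<Rightarrow> real"
  assumes "C_infinity f" "C_infinity g"
  shows "C_infinity (\<lambda>x. f x - g x)"
  using C_infinity_add[OF assms(1) C_infinity_mult[OF C_infinity_const[of "-1"] assms(2)]] by simp

lemma C_infinity_power:
  fixes f :: "'a::euclidean_space \<Rightarrow> real"
  shows "C_infinity f \<Longrightarrow> C_infinity (\<lambda>x. f x ^ n)"
  by (induction n) (auto intro: C_infinity_mult C_infinity_const)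

lemma C_infinity_compose_real:
  fixes f :: "real \<Rightarrow> real" and u :: "'a::euclidean_space \<Rightarrow> real"
  shows "C_infinity f \<Longrightarrow> C_infinity u \<Longrightarrow> C_infinity (\<lambda>x. f (u x))"
  by (simp add: C_infinity_def C_k_compose_real)

lemma C_infinity_powr:
  fixes u :: "'a::euclidean_space \<Rightarrow> real"
  shows "C_infinity u \<Longrightarrow> (\<And>x. u x > 0) \<Longrightarrow> C_infinity (\<lambda>x. u x powr a)"
  by (simp add: C_infinity_def C_k_powr)

lemma C_infinity_vec_nth: "C_infinity (\<lambda>z::real^'n. z $ i)"
  by (rule C_infinity_bounded_linear) (rule bounded_linear_vec_nth)

lemma C_infinity_imp_differentiable: "C_infinity f \<Longrightarrow> f differentiable (at x)"
  unfolding C_infinity_def using C_k.simps(2)[of 0 f] by blast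

lemma C_infinity_imp_continuous_on: "C_infinity f \<Longrightarrow> continuous_on S f"
  unfolding C_infinity_def using C_k.simps(1)[of f] continuous_on_subset by blast

lemma C_infinity_real_deriv:
  fixes f :: "real \<Rightarrow> real"
  assumes "C_infinity f"
  shows "C_infinity (deriv f)" and "(f has_real_derivative deriv f x) (at x)"
proof -
  have d: "f differentiable (at x)" for x
    using assms by (rule C_infinity_imp_differentiable)
  show D: "(f has_real_derivative deriv f x) (at x)" for x
    using d by (simp add: real_differentiable_def DERIV_deriv_iff_real_differentiable)
  have "deriv f = (\<lambda>x. frechet_derivative f (at x) 1)"
    by (intro ext) (simp add: frechet_derivative_at[OF D[unfolded has_field_derivative_def], symmetric])
  then show "C_infinity (deriv f)"
    using assms unfolding C_infinity_def by (metis C_k.simps(2))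
qed

text \<open>
  For the constant polynomial 1 this is the standard function that is flat at 0 without being analytic.
  The polynomial factors are the ones that its derivatives produce.
\<close>

definition flat_exp_poly :: "real poly \<Rightarrow> real \<Rightarrow> real" where
  "flat_exp_poly p x = (if x > 0 then poly p (1 / x) * exp (- (1 / x)) else 0)"

lemma poly_over_exp_tendsto_0: "((\<lambda>y::real. poly p y * exp (- y)) \<longlongrightarrow> 0) at_top"
proof -
  have "((\<lambda>y. \<Sum>i\<le>degree p. coeff p i * (y ^ i / exp y)) \<longlongrightarrow> (\<Sum>i\<le>degree p. coeff p i * 0)) at_top"
    by (intro tendsto_intros tendsto_power_div_exp_0)
  then show ?thesis
    by (simp add: poly_altdef sum_distrib_right exp_minus divide_inverse mult.assoc)
qed

lemma flat_exp_poly_has_derivative: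
  "(flat_exp_poly p has_real_derivative flat_exp_poly ((p - pderiv p) * [:0, 0, 1:]) x) (at x)"
proof (cases x "0::real" rule: linorder_cases)
  case less
  have "((\<lambda>x. 0) has_real_derivative 0) (at x)" by simp
  then have "(flat_exp_poly p has_real_derivative 0) (at x)"
    by (rule has_field_derivative_transform_within_open[of _ _ _ "{..<0}"])
       (use less in \<open>auto simp: flat_exp_poly_def\<close>)
  with less show ?thesis by (simp add: flat_exp_poly_def)
next
  case equal
  have "((\<lambda>y. (flat_exp_poly p y - flat_exp_poly p 0) / (y - 0)) \<longlongrightarrow> 0) (at_left 0)"
    by (rule tendsto_eventually) (auto simp: eventually_at_filter flat_exp_poly_def)
  moreover have "((\<lambda>y. (flat_exp_poly p y - flat_exp_poly p 0) / (y - 0)) \<longlongrightarrow> 0) (at_right 0)"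
  proof -
    have "((\<lambda>y::real. poly (p * [:0, 1:]) (inverse y) * exp (- (inverse y))) \<longlongrightarrow> 0) (at_right 0)"
      by (rule filterlim_compose[OF poly_over_exp_tendsto_0 filterlim_inverse_at_top_right])
    then show ?thesis
      by (rule Lim_transform_eventually)
         (auto simp: eventually_at_filter flat_exp_poly_def divide_inverse mult_ac)
  qed
  ultimately have "(flat_exp_poly p has_real_derivative 0) (at 0)"
    unfolding has_field_derivative_iff by (rule filterlim_split_at)
  with equal show ?thesis by (simp add: flat_exp_poly_def)
next
  case greater
  have "((\<lambda>x. poly p (1 / x) * exp (- (1 / x))) has_real_derivative
      poly (pderiv p) (1 / x) * (- (1 / x\<^sup>2)) * exp (- (1 / x)) + exp (- (1 / x)) * (1 / x\<^sup>2) * poly p (1 / x)) (at x)"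
    using greater
    by (auto intro!: derivative_eq_intros poly_DERIV[THEN DERIV_chain2] simp: power2_eq_square)
  then have "(flat_exp_poly p has_real_derivative
      poly (pderiv p) (1 / x) * (- (1 / x\<^sup>2)) * exp (- (1 / x)) + exp (- (1 / x)) * (1 / x\<^sup>2) * poly p (1 / x)) (at x)"
    by (rule has_field_derivative_transform_within_open[of _ _ _ "{0<..}"])
       (use greater in \<open>auto simp: flat_exp_poly_def\<close>)
  moreover have "poly (pderiv p) (1 / x) * (- (1 / x\<^sup>2)) * exp (- (1 / x)) + exp (- (1 / x)) * (1 / x\<^sup>2) * poly p (1 / x)
     = flat_exp_poly ((p - pderiv p) * [:0, 0, 1:]) x"
    using greater by (simp add: flat_exp_poly_def field_simps power2_eq_square)
  ultimately show ?thesis by simp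
qed

lemma C_infinity_flat_exp_poly: "C_infinity (flat_exp_poly p)"
proof -
  have "C_k k (flat_exp_poly p)" for k
  proof (induction k arbitrary: p)
    case 0
    show ?case using DERIV_isCont[OF flat_exp_poly_has_derivative]
      by (simp add: continuous_on_eq_continuous_at)
  next
    case (Suc k)
    have D: "(flat_exp_poly p has_derivative
       (\<lambda>v. flat_exp_poly ((p - pderiv p) * [:0, 0, 1:]) x * v)) (at x)" for x
      using flat_exp_poly_has_derivative unfolding has_field_derivative_def .
    have "C_k k (\<lambda>x. flat_exp_poly ((p - pderiv p) * [:0, 0, 1:]) x * v)" for v
      by (intro C_k_mult C_k_const Suc)
    moreover have "frechet_derivative (flat_exp_poly p) (at x) v =
       flat_exp_poly ((p - pderiv p) * [:0, 0, 1:]) x * v" for x v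
      using frechet_derivative_at[OF D] by metis
    moreover have "\<forall>x. flat_exp_poly p differentiable (at x)"
    using D unfolding differentiable_def by blast
  ultimately show ?case unfolding C_k.simps by presburger
  qed
  then show ?thesis by (simp add: C_infinity_def)
qed

lemma smooth_step_exists:
  obtains f :: "real \<Rightarrow> real" where "C_infinity f" "\<And>x. 0 \<le> f x" "\<And>x. f x \<le> 1"
    "\<And>x. x \<le> 0 \<Longrightarrow> f x = 0" "\<And>x. x \<ge> 1 \<Longrightarrow> f x = 1"
proof -
  define b where "b = flat_exp_poly 1"
  have b: "b x = (if x > 0 then exp (- (1 / x)) else 0)" for x
    by (simp add: b_def flat_exp_poly_def)
  have pos: "b x + b (1 - x) > 0" for x
    by (auto simp: b add_pos_pos add_pos_nonneg)
  define f where "f x = b x * (b x + b (1 - x)) powr (-1)" for x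
  have f: "f x = b x / (b x + b (1 - x))" for x
    using pos[of x] by (simp add: f_def powr_minus powr_one divide_inverse)
  have smooth: "C_infinity b" "C_infinity (\<lambda>x::real. x)"
    unfolding b_def by (simp_all add: C_infinity_flat_exp_poly C_infinity_bounded_linear)
  have "C_infinity (\<lambda>x. b (1 - x))"
    by (rule C_infinity_compose_real[OF smooth(1) C_infinity_diff[OF C_infinity_const smooth(2)]])
  with smooth have "C_infinity (\<lambda>x. b x + b (1 - x))"
    by (intro C_infinity_add)
  then have "C_infinity (\<lambda>x. (b x + b (1 - x)) powr (-1))"
    using pos by (rule C_infinity_powr)
  with smooth have "C_infinity f"
    unfolding f_def by (intro C_infinity_mult)
  moreover have "0 \<le> b x" for x
    unfolding b by simp
  then have "0 \<le> f x" "f x \<le> 1" for x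
    using pos[of x] by (simp_all add: f divide_le_eq)
  moreover have "f x = 0" if "x \<le> 0" for x
  proof -
    have "b x = 0" using that unfolding b by simp
    then show ?thesis by (simp add: f)
  qed
  moreover have "f x = 1" if "x \<ge> 1" for x
  proof -
    have "b (1 - x) = 0" using that unfolding b by simp
    then show ?thesis using pos[of x] by (simp add: f)
  qed
  ultimately show ?thesis using that by blast
qed

text \<open>
  A power of a positive smooth function is smooth. The positive function is a convex combination of 1 and
  the identity that is switched over between 1/4 and 1/2, where both are positive.
\<close>

lemma smooth_inverse_sqrt_exists:
  obtains s :: "real \<Rightarrow> real" where "C_infinity s" "\<And>q. q \<ge> 1 / 2 \<Longrightarrow> s q = 1 / sqrt q"
proof -
  obtain f :: "real \<Rightarrow> real" where f: "C_infinity f" "\<And>x. 0 \<le> f x" "\<And>x. f x \<le> 1"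
    "\<And>x. x \<le> 0 \<Longrightarrow> f x = 0" "\<And>x. x \<ge> 1 \<Longrightarrow> f x = 1"
    using smooth_step_exists by blast
  define w where "w q = 1 + f (4 * q - 1) * (q - 1)" for q :: real
  have pos: "w q > 0" for q
  proof (cases "q \<le> 1 / 4")
    case False
    have "w q = (1 - f (4 * q - 1)) * 1 + f (4 * q - 1) * q"
      by (simp add: w_def algebra_simps)
    moreover have "f (4 * q - 1) = 0 \<or> f (4 * q - 1) * q > 0"
      using f(2)[of "4 * q - 1"] False by (simp add: less_le)
    ultimately show ?thesis
      using f(3)[of "4 * q - 1"] by (auto intro: add_nonneg_pos)
  qed (simp add: w_def f)
  have "C_infinity (\<lambda>q::real. q)"
    by (simp add: C_infinity_bounded_linear)
  then have id: "C_infinity (\<lambda>q::real. q - 1)" "C_infinity (\<lambda>q::real. 4 * q - 1)"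
    by (simp_all add: C_infinity_diff C_infinity_mult C_infinity_const)
  have "C_infinity (\<lambda>q. f (4 * q - 1))"
    by (rule C_infinity_compose_real[OF f(1) id(2)])
  then have "C_infinity w"
    unfolding w_def using id by (intro C_infinity_add C_infinity_mult C_infinity_const)
  then have "C_infinity (\<lambda>q. w q powr (- (1 / 2)))"
    using pos by (rule C_infinity_powr)
  moreover have "w q powr (- (1 / 2)) = 1 / sqrt q" if "q \<ge> 1 / 2" for q
  proof -
    have "w q = q"
      using that f(5)[of "4 * q - 1"] by (simp add: w_def)
    then show ?thesis
      using that by (metis divide_inverse mult_1 order_trans powr_half_sqrt powr_minus zero_le_divide_1_iff zero_le_numeral)
  qed
  ultimately show ?thesis using that by blast
qed

section \<open>The Riemannian distance and completeness\<close>

lemma quadratic_form_sum: "v \<bullet> (a *v w) = (\<Sum>i\<in>UNIV. \<Sum>j\<in>UNIV. v $ i * a $ i $ j * w $ j)"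
  for a :: "real^'n^'n"
  by (simp add: inner_vec_def matrix_vector_mult_def sum_distrib_left mult.assoc)

context
  fixes g :: "real^'n \<Rightarrow> real^'n^'n"
  assumes g: "riemannian_metric g"
begin

lemma metric_coeff_continuous: "continuous_on S (\<lambda>x. g x $ i $ j)"
  using g C_infinity_imp_continuous_on unfolding riemannian_metric_def by blast

lemma quadratic_form_nonneg: "0 \<le> v \<bullet> (g x *v v)"
  using g unfolding riemannian_metric_def by (cases "v = 0") (auto simp: less_imp_le)

lemma riem_norm_nonneg: "0 \<le> riem_norm g x v"
  by (simp add: riem_norm_def quadratic_form_nonneg)

lemma riem_norm_scaleR: "riem_norm g x (a *\<^sub>R v) = \<bar>a\<bar> * riem_norm g x v"
  by (simp add: riem_norm_def matrix_vector_mult_scaleR real_sqrt_mult mult.assoc[symmetric])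

lemma riem_speed_nonneg: "0 \<le> riem_speed g p t"
  by (simp add: riem_speed_def riem_norm_nonneg)

lemma riem_norm_le_on_cball:
  obtains M where "M \<ge> 0" "\<And>x v. x \<in> cball 0 R \<Longrightarrow> riem_norm g x v \<le> M * norm v"
proof -
  have "\<exists>B. \<forall>x \<in> cball 0 R. \<bar>g x $ i $ j\<bar> \<le> B" for i j
  proof -
    have "bounded ((\<lambda>x. g x $ i $ j) ` cball 0 R)"
      by (intro compact_imp_bounded compact_continuous_image metric_coeff_continuous compact_cball)
    then show ?thesis by (auto simp: bounded_iff)
  qed
  then obtain B where B: "\<And>i j x. x \<in> cball 0 R \<Longrightarrow> \<bar>g x $ i $ j\<bar> \<le> B i j"
    by metis
  define C where "C = (\<Sum>i\<in>UNIV. \<Sum>j\<in>UNIV. \<bar>B i j\<bar>)"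
  have "C \<ge> 0" unfolding C_def by (intro sum_nonneg) auto
  have "riem_norm g x v \<le> sqrt C * norm v" if x: "x \<in> cball 0 R" for x v
  proof -
    have "v \<bullet> (g x *v v) \<le> (\<Sum>i\<in>UNIV. \<Sum>j\<in>UNIV. \<bar>B i j\<bar> * (norm v)\<^sup>2)"
      unfolding quadratic_form_sum
    proof (intro sum_mono)
      fix i j
      have "\<bar>v $ i * g x $ i $ j * v $ j\<bar> \<le> norm v * \<bar>B i j\<bar> * norm v"
        unfolding abs_mult using B[OF x, of i j]
        by (intro mult_mono component_le_norm_cart) auto
      then show "v $ i * g x $ i $ j * v $ j \<le> \<bar>B i j\<bar> * (norm v)\<^sup>2"
        by (simp add: power2_eq_square mult_ac)
    qed
    then have "v \<bullet> (g x *v v) \<le> C * (norm v)\<^sup>2"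
      by (simp add: C_def sum_distrib_right)
    then have "sqrt (v \<bullet> (g x *v v)) \<le> sqrt (C * (norm v)\<^sup>2)"
      by (rule real_sqrt_le_mono)
    then show ?thesis by (simp add: riem_norm_def real_sqrt_mult)
  qed
  then show ?thesis using that \<open>C \<ge> 0\<close> by (metis real_sqrt_ge_zero)
qed

text \<open>
  Length and integrability in one predicate: \<open>L\<close> is the length of a path that \<^const>\<open>riem_dist\<close> ranges over.
\<close>

definition admissible :: "(real \<Rightarrow> real^'n) \<Rightarrow> real^'n \<Rightarrow> real^'n \<Rightarrow> real \<Rightarrow> bool" where
  "admissible p x y L \<longleftrightarrow> valid_path p \<and> pathstart p = x \<and> pathfinish p = y \<and>
     (riem_speed g p has_integral L) {0..1}"

lemma riem_dist_eq: "riem_dist g x y = Inf {L. \<exists>p. admissible p x y L}"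
  unfolding riem_dist_def admissible_def riem_length_def
  by (rule arg_cong[where f = Inf]) (auto simp: has_integral_integrable_integral)

lemma admissible_nonneg: "admissible p x y L \<Longrightarrow> 0 \<le> L"
  unfolding admissible_def using has_integral_nonneg riem_speed_nonneg by blast

lemma admissible_linepath:
  obtains L where "admissible (linepath x y) x y L"
    "\<And>B. (\<And>t. t \<in> {0..1} \<Longrightarrow> riem_norm g (linepath x y t) (y - x) \<le> B) \<Longrightarrow> L \<le> B"
proof -
  have s: "riem_speed g (linepath x y) = (\<lambda>t. riem_norm g (linepath x y t) (y - x))"
    by (simp add: riem_speed_def fun_eq_iff)
  have "continuous_on {0..1} (\<lambda>t. g (linepath x y t) $ i $ j)" for i j
    by (rule continuous_on_compose2[OF metric_coeff_continuous[of UNIV] continuous_on_linepath]) auto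
  then have "continuous_on {0..1} (riem_speed g (linepath x y))"
    unfolding s riem_norm_def quadratic_form_sum
    by (intro continuous_on_real_sqrt continuous_on_sum continuous_on_mult continuous_on_const)
  then have i: "riem_speed g (linepath x y) integrable_on {0..1}"
    by (rule integrable_continuous_interval)
  then obtain L where L: "(riem_speed g (linepath x y) has_integral L) {0..1}"
    by blast
  show ?thesis
  proof
    show "admissible (linepath x y) x y L" using L by (simp add: admissible_def)
    fix B assume B: "\<And>t. t \<in> {0..1} \<Longrightarrow> riem_norm g (linepath x y t) (y - x) \<le> B"
    have "((\<lambda>t. B) has_integral B) {0..1::real}"
      using has_integral_const_real[of B 0 1] by simp
    from has_integral_le[OF L this] show "L \<le> B" using B by (simp add: s)
  qed
qed

lemma riem_dist_le: "admissible p x y L \<Longrightarrow> riem_dist g x y \<le> L"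
  unfolding riem_dist_eq by (intro cInf_lower bdd_belowI[of _ 0]) (auto intro: admissible_nonneg)

lemma riem_dist_ge: "(\<And>p L. admissible p x y L \<Longrightarrow> B \<le> L) \<Longrightarrow> B \<le> riem_dist g x y"
  unfolding riem_dist_eq using admissible_linepath[of x y] by (intro cInf_greatest) blast+

lemma riem_dist_approx:
  assumes "0 < e"
  obtains p L where "admissible p x y L" "L < riem_dist g x y + e"
  using riem_dist_ge[of x y "riem_dist g x y + e"] assms by force

lemma riem_speed_affine:
  assumes D: "p differentiable (at (a * t + b))"
    and "open S" "t \<in> S" and eq: "\<And>x. x \<in> S \<Longrightarrow> p' x = p (a * x + b)"
  shows "riem_speed g p' t = \<bar>a\<bar> * riem_speed g p (a * t + b)"
proof -
  have p: "(p has_vector_derivative vector_derivative p (at (a * t + b))) (at (a * t + b))"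
    using D by (simp add: vector_derivative_works)
  have "(p \<circ> (\<lambda>t. a * t + b) has_vector_derivative a *\<^sub>R vector_derivative p (at (a * t + b))) (at t)"
  proof (rule vector_diff_chain_at)
    show "((\<lambda>t. a * t + b) has_vector_derivative a) (at t)"
      by (auto intro!: derivative_eq_intros simp: has_real_derivative_iff_has_vector_derivative[symmetric])
  qed (rule p)
  then have "(p' has_vector_derivative a *\<^sub>R vector_derivative p (at (a * t + b))) (at t)"
    by (rule has_vector_derivative_transform_within_open[OF _ assms(2,3)]) (simp add: eq)
  then have "vector_derivative p' (at t) = a *\<^sub>R vector_derivative p (at (a * t + b))"
    by (rule vector_derivative_at)
  then show ?thesis
    by (simp add: riem_speed_def eq[OF \<open>t \<in> S\<close>] riem_norm_scaleR)
qed

lemma admissible_differentiable: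
  assumes "admissible p x y L"
  obtains S where "finite S" "\<And>t. t \<in> {0..1} - S \<Longrightarrow> p differentiable (at t)"
  using assms
  by (auto simp: admissible_def valid_path_def piecewise_C1_differentiable_on_def C1_differentiable_on_eq)

lemma admissible_reversepath:
  assumes "admissible p x y L"
  shows "admissible (reversepath p) y x L"
proof -
  obtain S where S: "finite S" "\<And>t. t \<in> {0..1} - S \<Longrightarrow> p differentiable (at t)"
    using admissible_differentiable[OF assms] by blast
  have "(riem_speed g p has_integral L) {0..1}"
    using assms by (auto simp: admissible_def)
  then have "((\<lambda>t. riem_speed g p (- 1 * t + 1)) has_integral L) {0..1}"
    using has_integral_affinity01[where m = "-1" and c = 1] by fastforce
  then have "(riem_speed g (reversepath p) has_integral L) {0..1}"
  proof (rule has_integral_spike_finite[where S = "(\<lambda>t. 1 - t) ` S", rotated 2])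
    fix t assume t: "t \<in> {0..1} - (\<lambda>t. 1 - t) ` S"
    then have "- 1 * t + 1 \<in> {0..1} - S" by force
    from riem_speed_affine[OF S(2)[OF this], of UNIV "reversepath p"]
    show "riem_speed g (reversepath p) t = riem_speed g p (- 1 * t + 1)"
      by (simp add: reversepath_def)
  qed (use S in auto)
  then show ?thesis using assms
    by (auto simp: admissible_def valid_path_imp_reverse)
qed

lemma admissible_joinpaths:
  assumes "admissible p x y L" "admissible p' y z L'"
  shows "admissible (p +++ p') x z (L + L')"
proof -
  obtain S where S: "finite S" "\<And>t. t \<in> {0..1} - S \<Longrightarrow> p differentiable (at t)"
    using admissible_differentiable[OF assms(1)] by blast
  obtain S' where S': "finite S'" "\<And>t. t \<in> {0..1} - S' \<Longrightarrow> p' differentiable (at t)"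
    using admissible_differentiable[OF assms(2)] by blast
  have 1: "(riem_speed g p has_integral L) {0..1}" and 2: "(riem_speed g p' has_integral L') {0..1}"
    using assms by (auto simp: admissible_def)
  have i1: "((\<lambda>t. 2 * riem_speed g p (2 * t)) has_integral L) {0..1/2}"
    and i2: "((\<lambda>t. 2 * riem_speed g p' (2 * t - 1)) has_integral L') {1/2..1}"
    using has_integral_affinity01 [OF 1, where m= 2 and c=0, THEN has_integral_cmul [where c=2]]
          has_integral_affinity01 [OF 2, where m= 2 and c="-1", THEN has_integral_cmul [where c=2]]
    by (simp_all only: image_affinity_atLeastAtMost_div_diff) simp_all
  have "(riem_speed g (p +++ p') has_integral L) {0..1/2}"
  proof (rule has_integral_spike_finite[OF _ _ i1])
    show "finite (insert (1/2) ((*) 2 -` S))"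
      using S by (force intro: finite_vimageI inj_onI)
    fix t :: real assume t: "t \<in> {0..1/2} - insert (1/2) ((*) 2 -` S)"
    then have "2 * t + 0 \<in> {0..1} - S" by auto
    from riem_speed_affine[OF S(2)[OF this], of "{..<1/2}" "p +++ p'"] t
    show "riem_speed g (p +++ p') t = 2 * riem_speed g p (2 * t)"
      by (auto simp: joinpaths_def)
  qed
  moreover have "(riem_speed g (p +++ p') has_integral L') {1/2..1}"
  proof (rule has_integral_spike_finite[OF _ _ i2])
    show "finite (insert (1/2) ((\<lambda>x. 2 * x - 1) -` S'))"
      using S' by (force intro: finite_vimageI inj_onI)
    fix t :: real assume t: "t \<in> {1/2..1} - insert (1/2) ((\<lambda>x. 2 * x - 1) -` S')"
    then have "2 * t + - 1 \<in> {0..1} - S'" by auto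
    from riem_speed_affine[OF S'(2)[OF this], of "{1/2<..}" "p +++ p'"] t
    show "riem_speed g (p +++ p') t = 2 * riem_speed g p' (2 * t - 1)"
      by (auto simp: joinpaths_def)
  qed
  ultimately have "(riem_speed g (p +++ p') has_integral L + L') {0..1}"
    by (intro has_integral_combine[where c = "1/2"]) auto
  with assms show ?thesis
    by (auto simp: admissible_def intro: valid_path_join)
qed

lemma riem_dist_nonneg: "0 \<le> riem_dist g x y"
  by (rule riem_dist_ge) (rule admissible_nonneg)

lemma riem_dist_commute: "riem_dist g x y = riem_dist g y x"
  by (intro antisym riem_dist_ge riem_dist_le) (blast intro: admissible_reversepath)+

lemma riem_dist_triangle: "riem_dist g x z \<le> riem_dist g x y + riem_dist g y z"
proof (rule field_le_epsilon)
  fix e :: real assume "0 < e"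
  then obtain p L p' L' where
    p: "admissible p x y L" "L < riem_dist g x y + e / 2" and
    p': "admissible p' y z L'" "L' < riem_dist g y z + e / 2"
    by (meson half_gt_zero riem_dist_approx)
  from riem_dist_le[OF admissible_joinpaths[OF p(1) p'(1)]] p(2) p'(2)
  show "riem_dist g x z \<le> riem_dist g x y + riem_dist g y z + e" by simp
qed

lemma riem_dist_le_linepath:
  assumes "\<And>z. z \<in> cball 0 R \<Longrightarrow> riem_norm g z (y - x) \<le> M * norm (y - x)"
    and "x \<in> cball 0 R" "y \<in> cball 0 R"
  shows "riem_dist g x y \<le> M * norm (y - x)"
proof -
  obtain L where L: "admissible (linepath x y) x y L"
    "\<And>B. (\<And>t. t \<in> {0..1} \<Longrightarrow> riem_norm g (linepath x y t) (y - x) \<le> B) \<Longrightarrow> L \<le> B"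
    using admissible_linepath by blast
  have "linepath x y t \<in> cball 0 R" if "t \<in> {0..1}" for t
    using that assms convex_contains_segment[of "cball 0 R"] linepath_image_01[of x y] convex_cball
    by blast
  then have "L \<le> M * norm (y - x)"
    using assms(1) by (intro L(2)) blast
  with riem_dist_le[OF L(1)] show ?thesis by simp
qed

text \<open>
  The fundamental theorem of calculus along a path bounds the increment of \<open>f\<close> by \<open>C\<close> times its length.
\<close>

lemma riem_dist_Lipschitz:
  fixes f :: "real^'n \<Rightarrow> 'b::euclidean_space"
  assumes f: "\<And>x. (f has_derivative f' x) (at x)"
    and bound: "\<And>x v. norm (f' x v) \<le> C * riem_norm g x v" and "0 < C"
  shows "norm (f y - f x) \<le> C * riem_dist g x y"
proof -
  have "norm (f y - f x) / C \<le> riem_dist g x y"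
  proof (rule riem_dist_ge)
    fix p L assume p: "admissible p x y L"
    then obtain S where S: "continuous_on {0..1} p" "finite S" "p C1_differentiable_on {0..1} - S"
      by (auto simp: admissible_def valid_path_def piecewise_C1_differentiable_on_def)
    have 1: "(riem_speed g p has_integral L) {0..1}" and ends: "p 0 = x" "p 1 = y"
      using p by (auto simp: admissible_def pathstart_def pathfinish_def)
    have cf: "continuous_on UNIV f"
      using f by (metis continuous_at_imp_continuous_on has_derivative_continuous)
    have "((\<lambda>t. f' (p t) (vector_derivative p (at t))) has_integral (f (p 1) - f (p 0))) {0..1}"
    proof (rule fundamental_theorem_of_calculus_interior_strong[OF S(2), where f = "\<lambda>t. f (p t)"])
      show "continuous_on {0..1} (\<lambda>t. f (p t))"
        by (rule continuous_on_compose2[OF cf S(1)]) auto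
      fix t assume "t \<in> {0<..<1} - S"
      then have "(p has_vector_derivative vector_derivative p (at t)) (at t)"
        using S(3) by (auto simp: C1_differentiable_on_eq vector_derivative_works)
      from vector_derivative_diff_chain_within[of p _ t UNIV f "f' (p t)"] this f[of "p t"]
      show "((\<lambda>t. f (p t)) has_vector_derivative f' (p t) (vector_derivative p (at t))) (at t)"
        by (auto simp: o_def intro: has_derivative_at_withinI)
    qed auto
    then have "norm (f (p 1) - f (p 0)) \<le> C * L"
      using 1 bound integral_norm_bound_integral[of "\<lambda>t. f' (p t) (vector_derivative p (at t))" "{0..1}" "\<lambda>t. C * riem_speed g p t"]
      unfolding has_integral_iff riem_speed_def by (simp add: integrable_on_mult_right)
    then show "norm (f y - f x) / C \<le> L" using ends \<open>0 < C\<close> by (simp add: divide_le_eq mult.commute)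
  qed
  then show ?thesis using \<open>0 < C\<close> by (simp add: divide_le_eq mult.commute)
qed

end

text \<open>
  Write \<open>\<rho> = sqrt (1 + |x|\<^sup>2)\<close> and \<open>\<kappa> = x/(1 + |x|\<^sup>2)\<close>. The two bounds say that the differentials of \<open>\<rho>\<close> and \<open>\<kappa>\<close>
  are bounded, so both are Lipschitz functions. As \<open>x = \<rho>\<^sup>2 \<kappa>\<close>, they separate points, and a sequence that
  is Cauchy for the Riemannian distance converges in the Euclidean topology; near the limit the
  Riemannian distance is at most a multiple of the Euclidean one.
\<close>

lemma complete_riemannian_metricI:
  fixes g :: "real^'n \<Rightarrow> real^'n^'n"
  assumes g: "riemannian_metric g" and C: "0 < C"
    and norm_le: "\<And>x v. norm v \<le> C * (1 + (norm x)\<^sup>2) * riem_norm g x v"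
    and radial_le: "\<And>x v. \<bar>x \<bullet> v\<bar> \<le> C * sqrt (1 + (norm x)\<^sup>2) * riem_norm g x v"
  shows "complete_riemannian_metric g"
proof -
  have pos: "1 + (norm x)\<^sup>2 > 0" for x :: "real^'n"
    by (simp add: add_pos_nonneg)
  define \<rho> :: "real^'n \<Rightarrow> real" where "\<rho> x = sqrt (1 + (norm x)\<^sup>2)" for x
  define \<kappa> :: "real^'n \<Rightarrow> real^'n" where "\<kappa> x = inverse (1 + (norm x)\<^sup>2) *\<^sub>R x" for x
  have \<rho>_pos: "\<rho> x > 0" and \<rho>2: "(\<rho> x)\<^sup>2 = 1 + (norm x)\<^sup>2" for x
    using pos[of x] by (simp_all add: \<rho>_def)
  have norm_le_\<rho>: "norm x \<le> \<rho> x" for x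
    unfolding \<rho>_def by (rule real_le_rsqrt) simp
  have d2: "((\<lambda>x. 1 + (norm x)\<^sup>2) has_derivative (\<lambda>v. 2 * (x \<bullet> v))) (at x)" for x :: "real^'n"
    unfolding power2_norm_eq_inner by (auto intro!: derivative_eq_intros simp: inner_commute)
  have d\<rho>: "(\<rho> has_derivative (\<lambda>v. (x \<bullet> v) / \<rho> x)) (at x)" for x
  proof -
    have s: "(sqrt has_real_derivative inverse (sqrt (1 + (norm x)\<^sup>2)) / 2) (at (1 + (norm x)\<^sup>2))"
      using pos by (rule DERIV_real_sqrt)
    have "(\<rho> has_derivative (\<lambda>v. 2 * (x \<bullet> v) * (inverse (sqrt (1 + (norm x)\<^sup>2)) / 2))) (at x)"
      using DERIV_compose_FDERIV[where f = sqrt and g = "\<lambda>x::real^'n. 1 + (norm x)\<^sup>2", OF s d2]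
      unfolding \<rho>_def .
    moreover have "2 * (x \<bullet> v) * (inverse (sqrt (1 + (norm x)\<^sup>2)) / 2) = (x \<bullet> v) / \<rho> x" for v
      unfolding \<rho>_def inverse_eq_divide by simp
    ultimately show ?thesis by (simp only:)
  qed
  have d\<kappa>: "(\<kappa> has_derivative (\<lambda>v. inverse (1 + (norm x)\<^sup>2) *\<^sub>R v
      + (- (inverse (1 + (norm x)\<^sup>2) * (2 * (x \<bullet> v)) * inverse (1 + (norm x)\<^sup>2))) *\<^sub>R x)) (at x)" for x
  proof -
    have "1 + (norm x)\<^sup>2 \<noteq> 0" using pos[of x] by simp
    from has_derivative_scaleR[OF Deriv.has_derivative_inverse[OF this d2] has_derivative_ident]
    show ?thesis unfolding \<kappa>_def .
  qed
  have lip_\<rho>: "\<bar>\<rho> y - \<rho> x\<bar> \<le> C * riem_dist g x y" for x y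
  proof -
    have "norm ((x \<bullet> v) / \<rho> x) \<le> C * riem_norm g x v" for x v
      using radial_le[of x v] \<rho>_pos[of x] by (simp add: \<rho>_def[symmetric] divide_le_eq mult_ac)
    from riem_dist_Lipschitz[OF g d\<rho> this C] show ?thesis by simp
  qed
  have lip_\<kappa>: "norm (\<kappa> y - \<kappa> x) \<le> (3 * C) * riem_dist g x y" for x y
  proof (rule riem_dist_Lipschitz[OF g d\<kappa>])
    fix x v
    define R where "R = \<rho> x"
    have R: "R > 0" "1 + (norm x)\<^sup>2 = R\<^sup>2" "norm x \<le> R" "1 \<le> R"
      using \<rho>_pos \<rho>2 norm_le_\<rho> by (simp_all add: R_def \<rho>_def)
    have 1: "norm (inverse (R\<^sup>2) *\<^sub>R v) \<le> C * riem_norm g x v"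
      using norm_le[of v x] R by (simp add: divide_le_eq inverse_eq_divide mult_ac)
    have "norm ((- (inverse (R\<^sup>2) * (2 * (x \<bullet> v)) * inverse (R\<^sup>2))) *\<^sub>R x) =
        2 * (\<bar>x \<bullet> v\<bar> / R) * (norm x / R) * (1 / R\<^sup>2)"
      using R(1) by (simp add: abs_mult inverse_eq_divide power2_eq_square)
    also have "\<dots> \<le> 2 * (C * riem_norm g x v) * 1 * 1"
    proof (intro mult_mono)
      show "\<bar>x \<bullet> v\<bar> / R \<le> C * riem_norm g x v"
        using radial_le[of x v] R by (simp add: \<rho>_def[symmetric] R_def[symmetric] divide_le_eq mult_ac)
    qed (use R C riem_norm_nonneg[OF g, of x v] in \<open>auto simp: divide_le_eq one_le_power\<close>)
    finally have 2: "norm ((- (inverse (R\<^sup>2) * (2 * (x \<bullet> v)) * inverse (R\<^sup>2))) *\<^sub>R x)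
      \<le> 2 * (C * riem_norm g x v)" by simp
    show "norm (inverse (1 + (norm x)\<^sup>2) *\<^sub>R v
      + (- (inverse (1 + (norm x)\<^sup>2) * (2 * (x \<bullet> v)) * inverse (1 + (norm x)\<^sup>2))) *\<^sub>R x)
      \<le> 3 * C * riem_norm g x v"
      unfolding R(2) using norm_triangle_mono[OF 1 2] by simp
  qed (use C in simp)
  interpret Metric_space UNIV "riem_dist g"
  proof
    fix x y z
    show "0 \<le> riem_dist g x y" "riem_dist g x y = riem_dist g y x"
      "riem_dist g x z \<le> riem_dist g x y + riem_dist g y z"
      by (rule riem_dist_nonneg[OF g] riem_dist_commute[OF g] riem_dist_triangle[OF g])+
    show "riem_dist g x y = 0 \<longleftrightarrow> x = y"
    proof
      assume "riem_dist g x y = 0"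
      with lip_\<rho>[of y x] lip_\<kappa>[of y x] have "\<rho> x = \<rho> y" "\<kappa> x = \<kappa> y" by auto
      then have "(\<rho> x)\<^sup>2 *\<^sub>R \<kappa> x = (\<rho> y)\<^sup>2 *\<^sub>R \<kappa> y" by simp
      then show "x = y" using pos[of x] pos[of y] unfolding \<rho>2 \<kappa>_def by simp
    next
      assume "x = y"
      have "riem_dist g y y \<le> 0 * norm (y - y)"
        by (rule riem_dist_le_linepath[OF g, where R = "norm y"]) (simp_all add: riem_norm_def)
      then show "riem_dist g x y = 0"
        using riem_dist_nonneg[OF g, of y y] \<open>x = y\<close> by simp
    qed
  qed
  have mcomplete
    unfolding mcomplete_def
  proof (intro allI impI)
    fix \<sigma> assume "MCauchy \<sigma>"
    then have C\<sigma>: "\<exists>N. \<forall>n n'. N \<le> n \<longrightarrow> N \<le> n' \<longrightarrow> riem_dist g (\<sigma> n) (\<sigma> n') < e" if "e > 0" for e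
      using that unfolding MCauchy_def by blast
    have Cauchy_image: "Cauchy (\<lambda>n. f (\<sigma> n))"
      if lip: "\<And>x y. norm (f y - f x) \<le> K * riem_dist g x y" and "0 < K" for f :: "real^'n \<Rightarrow> 'c::real_normed_vector" and K
    proof (rule metric_CauchyI)
      fix e :: real assume "e > 0"
      then obtain N where N: "\<And>n n'. N \<le> n \<Longrightarrow> N \<le> n' \<Longrightarrow> riem_dist g (\<sigma> n) (\<sigma> n') < e / K"
        using C\<sigma>[of "e / K"] \<open>0 < K\<close> by auto
      have "dist (f (\<sigma> m)) (f (\<sigma> n)) < e" if "m \<ge> N" "n \<ge> N" for m n
        using lip[of "\<sigma> m" "\<sigma> n"] N[OF that(2,1)] \<open>0 < K\<close>
        by (simp add: dist_norm less_divide_eq mult.commute)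
      then show "\<exists>M. \<forall>m\<ge>M. \<forall>n\<ge>M. dist (f (\<sigma> m)) (f (\<sigma> n)) < e" by blast
    qed
    have "Cauchy (\<lambda>n. \<rho> (\<sigma> n))"
      by (rule Cauchy_image[of \<rho> C]) (use lip_\<rho> C in auto)
    then obtain r where r: "(\<lambda>n. \<rho> (\<sigma> n)) \<longlonglongrightarrow> r"
      using real_Cauchy_convergent convergent_def by blast
    have "Cauchy (\<lambda>n. \<kappa> (\<sigma> n))"
      by (rule Cauchy_image[of \<kappa> "3 * C"]) (use lip_\<kappa> C in auto)
    then obtain k where k: "(\<lambda>n. \<kappa> (\<sigma> n)) \<longlonglongrightarrow> k"
      using Cauchy_convergent convergent_def by blast
    define x where "x = r\<^sup>2 *\<^sub>R k"
    have "(\<lambda>n. (\<rho> (\<sigma> n))\<^sup>2 *\<^sub>R \<kappa> (\<sigma> n)) \<longlonglongrightarrow> x"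
      unfolding x_def by (intro tendsto_intros r k)
    moreover have "(\<rho> y)\<^sup>2 *\<^sub>R \<kappa> y = y" for y
      using pos[of y] unfolding \<rho>2 \<kappa>_def by simp
    ultimately have lim: "\<sigma> \<longlonglongrightarrow> x" by simp
    obtain M where M: "M \<ge> 0" "\<And>y v. y \<in> cball 0 (norm x + 1) \<Longrightarrow> riem_norm g y v \<le> M * norm v"
      using riem_norm_le_on_cball[OF g] by blast
    have "(\<lambda>n. M * norm (x - \<sigma> n)) \<longlonglongrightarrow> 0"
      using tendsto_intros lim by (auto intro!: tendsto_eq_intros)
    then have "(\<lambda>n. riem_dist g (\<sigma> n) x) \<longlonglongrightarrow> 0"
    proof (rule Lim_null_comparison[rotated])
      have "\<forall>\<^sub>F n in sequentially. dist (\<sigma> n) x < 1"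
        using lim by (rule tendstoD) simp
      then show "\<forall>\<^sub>F n in sequentially. norm (riem_dist g (\<sigma> n) x) \<le> M * norm (x - \<sigma> n)"
      proof (rule eventually_mono)
        fix n assume "dist (\<sigma> n) x < 1"
        then have "\<sigma> n \<in> cball 0 (norm x + 1)"
          using norm_triangle_ineq2[of "\<sigma> n" x] by (simp add: dist_norm)
        then show "norm (riem_dist g (\<sigma> n) x) \<le> M * norm (x - \<sigma> n)"
          using riem_dist_le_linepath[OF g M(2), where x = "\<sigma> n" and y = x] riem_dist_nonneg[OF g] by simp
      qed
    qed
    then have "limitin mtopology \<sigma> x sequentially"
      unfolding limitin_metric_dist_null by simp
    then show "\<exists>x. limitin mtopology \<sigma> x sequentially" ..
  qed
  with g show ?thesis by (simp add: complete_riemannian_metric_def)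
qed

section \<open>Geodesics and conserved momenta\<close>

lemma frechet_derivative_partials:
  fixes f :: "real^'n \<Rightarrow> real"
  assumes "f differentiable (at x)"
  shows "frechet_derivative f (at x) h = (\<Sum>k\<in>UNIV. partial_deriv k f x * h $ k)"
proof -
  have "frechet_derivative f (at x) h = frechet_derivative f (at x) (\<Sum>k\<in>UNIV. h $ k *\<^sub>R axis k 1)"
    using basis_expansion[of h] by (simp add: scalar_mult_eq_scaleR)
  also have "\<dots> = (\<Sum>k\<in>UNIV. h $ k *\<^sub>R frechet_derivative f (at x) (axis k 1))"
    using linear_frechet_derivative[OF assms] by (simp add: linear_sum linear_scale)
  finally show ?thesis by (simp add: partial_deriv_def mult.commute)
qed

lemma has_derivative_partials:
  fixes f :: "real^'n \<Rightarrow> real"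
  assumes "f differentiable (at x)"
  shows "(f has_derivative (\<lambda>h. \<Sum>k\<in>UNIV. partial_deriv k f x * h $ k)) (at x)"
  by (rule has_derivative_eq_rhs[OF assms[unfolded frechet_derivative_works]])
    (rule ext, rule frechet_derivative_partials[OF assms])

lemma has_real_derivative_along:
  fixes f :: "'a::real_normed_vector \<Rightarrow> real"
  assumes "(f has_derivative D) (at (c t))" "(c has_vector_derivative v) (at t)"
  shows "((\<lambda>t. f (c t)) has_real_derivative D v) (at t)"
  using vector_derivative_diff_chain_within[of c v t UNIV f D] assms
  by (simp add: o_def has_real_derivative_iff_has_vector_derivative has_derivative_at_withinI)

text \<open>
  The body of \<^const>\<open>unit_speed_geodesic\<close>, with the velocity as a parameter.
\<close>

definition geodesic_flow :: "(real^'n \<Rightarrow> real^'n^'n) \<Rightarrow> (real \<Rightarrow> real^'n) \<Rightarrow> (real \<Rightarrow> real^'n) \<Rightarrow> bool" where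
  "geodesic_flow g c v \<longleftrightarrow>
     (\<forall>t. (c has_vector_derivative v t) (at t) \<and>
          (v has_vector_derivative
             (\<chi> k. - (\<Sum>i\<in>UNIV. \<Sum>j\<in>UNIV. christoffel g (c t) k i j * v t $ i * v t $ j))) (at t) \<and>
          riem_norm g (c t) (v t) = 1)"

lemma unit_speed_geodesic_iff: "unit_speed_geodesic g c \<longleftrightarrow> (\<exists>v. geodesic_flow g c v)"
  by (simp add: unit_speed_geodesic_def geodesic_flow_def)

lemma geodesic_flow_reverse:
  assumes "geodesic_flow g c v"
  shows "geodesic_flow g (\<lambda>t. c (- t)) (\<lambda>t. - v (- t))"
  unfolding geodesic_flow_def
proof (intro allI conjI)
  fix t
  have m: "((\<lambda>t::real. - t) has_vector_derivative -1) (at t)"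
    by (auto intro!: derivative_eq_intros)
  have c: "(c has_vector_derivative v (- t)) (at (- t))"
    and v: "(v has_vector_derivative
      (\<chi> k. - (\<Sum>i\<in>UNIV. \<Sum>j\<in>UNIV. christoffel g (c (- t)) k i j * v (- t) $ i * v (- t) $ j))) (at (- t))"
    and u: "riem_norm g (c (- t)) (v (- t)) = 1"
    using assms unfolding geodesic_flow_def by blast+
  show "((\<lambda>t. c (- t)) has_vector_derivative - v (- t)) (at t)"
    using vector_diff_chain_at[OF m c] by (simp add: o_def)
  show "((\<lambda>t. - v (- t)) has_vector_derivative
      (\<chi> k. - (\<Sum>i\<in>UNIV. \<Sum>j\<in>UNIV. christoffel g (c (- t)) k i j * (- v (- t)) $ i * (- v (- t)) $ j))) (at t)"
    using has_vector_derivative_minus[OF vector_diff_chain_at[OF m v]] by (simp add: o_def)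
  show "riem_norm g (c (- t)) (- v (- t)) = 1"
    using u by (simp add: riem_norm_def quadratic_form_sum)
qed

context
  fixes g :: "real^'n \<Rightarrow> real^'n^'n"
  assumes g: "riemannian_metric g"
begin

lemma metric_coeff_differentiable: "(\<lambda>y. g y $ i $ j) differentiable (at x)"
  using g unfolding riemannian_metric_def by (simp add: C_infinity_imp_differentiable)

lemma metric_coeff_symmetric: "g x $ i $ j = g x $ j $ i"
proof -
  have "transpose (g x) $ i $ j = g x $ i $ j"
    using g unfolding riemannian_metric_def by simp
  then show ?thesis by (simp add: transpose_def)
qed

lemma metric_invertible: "invertible (g x)"
proof -
  have "g x *v v = 0 \<Longrightarrow> v = 0" for v
    using g unfolding riemannian_metric_def by (metis inner_zero_right less_irrefl)
  then show ?thesis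
    using matrix_left_invertible_ker[of "g x"] invertible_left_inverse[of "g x"] by blast
qed

text \<open>
  With lowered index the inverse matrix in the definition of the Christoffel symbols disappears.
\<close>

lemma christoffel_lowered:
  "(\<Sum>j\<in>UNIV. g x $ k $ j * christoffel g x j i l) =
     (partial_deriv i (\<lambda>y. g y $ l $ k) x + partial_deriv l (\<lambda>y. g y $ i $ k) x
       - partial_deriv k (\<lambda>y. g y $ i $ l) x) / 2"
proof -
  define T where "T m = partial_deriv i (\<lambda>y. g y $ l $ m) x + partial_deriv l (\<lambda>y. g y $ i $ m) x
       - partial_deriv m (\<lambda>y. g y $ i $ l) x" for m
  have inv: "(\<Sum>j\<in>UNIV. g x $ k $ j * matrix_inv (g x) $ j $ m) = (if k = m then 1 else 0)" for m
  proof -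
    have "(g x ** matrix_inv (g x)) $ k $ m = (mat 1 :: real^'n^'n) $ k $ m"
      using someI_ex[OF metric_invertible[of x, unfolded invertible_def]] by (simp add: matrix_inv_def)
    then show ?thesis by (simp add: matrix_matrix_mult_def mat_def)
  qed
  have "(\<Sum>j\<in>UNIV. g x $ k $ j * christoffel g x j i l) =
      (\<Sum>j\<in>UNIV. \<Sum>m\<in>UNIV. g x $ k $ j * matrix_inv (g x) $ j $ m * T m) / 2"
    by (simp add: christoffel_def T_def sum_distrib_left sum_divide_distrib mult.assoc)
  also have "\<dots> = (\<Sum>m\<in>UNIV. (\<Sum>j\<in>UNIV. g x $ k $ j * matrix_inv (g x) $ j $ m) * T m) / 2"
    by (subst sum.swap) (simp add: sum_distrib_right)
  also have "\<dots> = T k / 2"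
    by (simp add: inv if_distrib[of "\<lambda>a. a * _"] cong: if_cong)
  finally show ?thesis by (simp add: T_def)
qed

text \<open>
  The Euler-Lagrange form of the geodesic equation. The three terms of the Christoffel symbols combine
  with the derivative of the coefficients along the curve, and one half of the last term survives.
\<close>

lemma geodesic_momentum_derivative:
  assumes c: "geodesic_flow g c v"
  shows "((\<lambda>t. (g (c t) *v v t) $ k) has_real_derivative
     (\<Sum>i\<in>UNIV. \<Sum>j\<in>UNIV. partial_deriv k (\<lambda>y. g y $ i $ j) (c t) * v t $ i * v t $ j) / 2) (at t)"
proof -
  define d where "d k i j = partial_deriv k (\<lambda>y. g y $ i $ j) (c t)" for k i j
  have d_sym: "d k i j = d k j i" for k i j
    unfolding d_def by (subst metric_coeff_symmetric) simp
  define a where "a k = - (\<Sum>i\<in>UNIV. \<Sum>j\<in>UNIV. christoffel g (c t) k i j * v t $ i * v t $ j)" for k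
  have Dc: "(c has_vector_derivative v t) (at t)" and Dv: "(v has_vector_derivative (\<chi> k. a k)) (at t)"
    using c unfolding geodesic_flow_def a_def by blast+
  have "((\<lambda>t. g (c t) $ k $ j) has_real_derivative (\<Sum>l\<in>UNIV. d l k j * v t $ l)) (at t)" for j
    using has_real_derivative_along[OF has_derivative_partials[OF metric_coeff_differentiable] Dc]
    unfolding d_def .
  moreover have "((\<lambda>t. v t $ j) has_real_derivative a j) (at t)" for j
    using bounded_linear.has_vector_derivative[OF bounded_linear_vec_nth Dv, of j]
    by (simp add: has_real_derivative_iff_has_vector_derivative)
  ultimately have "((\<lambda>t. \<Sum>j\<in>UNIV. g (c t) $ k $ j * v t $ j) has_real_derivative
      (\<Sum>j\<in>UNIV. (\<Sum>l\<in>UNIV. d l k j * v t $ l) * v t $ j + a j * g (c t) $ k $ j)) (at t)"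
    by (intro DERIV_sum DERIV_mult)
  moreover have "(\<Sum>j\<in>UNIV. a j * g (c t) $ k $ j) =
      - (\<Sum>i\<in>UNIV. \<Sum>l\<in>UNIV. ((d i l k + d l i k - d k i l) / 2) * v t $ i * v t $ l)"
  proof -
    have "(\<Sum>j\<in>UNIV. a j * g (c t) $ k $ j) =
        - (\<Sum>j\<in>UNIV. \<Sum>i\<in>UNIV. \<Sum>l\<in>UNIV. g (c t) $ k $ j * christoffel g (c t) j i l * v t $ i * v t $ l)"
      by (simp add: a_def sum_distrib_left sum_negf mult_ac)
    also have "(\<Sum>j\<in>UNIV. \<Sum>i\<in>UNIV. \<Sum>l\<in>UNIV. g (c t) $ k $ j * christoffel g (c t) j i l * v t $ i * v t $ l) =
        (\<Sum>i\<in>UNIV. \<Sum>l\<in>UNIV. \<Sum>j\<in>UNIV. g (c t) $ k $ j * christoffel g (c t) j i l * v t $ i * v t $ l)"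
      by (subst sum.swap) (intro sum.cong refl sum.swap)
    also have "\<dots> = (\<Sum>i\<in>UNIV. \<Sum>l\<in>UNIV. (\<Sum>j\<in>UNIV. g (c t) $ k $ j * christoffel g (c t) j i l) * v t $ i * v t $ l)"
      by (simp add: sum_distrib_right)
    finally show ?thesis by (simp add: christoffel_lowered d_def)
  qed
  moreover have "(\<Sum>i\<in>UNIV. \<Sum>l\<in>UNIV. ((d i l k + d l i k - d k i l) / 2) * v t $ i * v t $ l) =
      (\<Sum>j\<in>UNIV. (\<Sum>l\<in>UNIV. d l k j * v t $ l) * v t $ j) -
      (\<Sum>i\<in>UNIV. \<Sum>j\<in>UNIV. d k i j * v t $ i * v t $ j) / 2"
  proof -
    have 1: "(\<Sum>i\<in>UNIV. \<Sum>l\<in>UNIV. d i l k * v t $ i * v t $ l) = (\<Sum>j\<in>UNIV. (\<Sum>l\<in>UNIV. d l k j * v t $ l) * v t $ j)"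
      by (subst sum.swap) (simp add: sum_distrib_right d_sym[of _ k])
    have 2: "(\<Sum>i\<in>UNIV. \<Sum>l\<in>UNIV. d l i k * v t $ i * v t $ l) = (\<Sum>j\<in>UNIV. (\<Sum>l\<in>UNIV. d l k j * v t $ l) * v t $ j)"
      by (simp add: sum_distrib_right sum_distrib_left d_sym[of _ k] mult_ac)
    have "(\<Sum>i\<in>UNIV. \<Sum>l\<in>UNIV. ((d i l k + d l i k - d k i l) / 2) * v t $ i * v t $ l) =
      ((\<Sum>i\<in>UNIV. \<Sum>l\<in>UNIV. d i l k * v t $ i * v t $ l) + (\<Sum>i\<in>UNIV. \<Sum>l\<in>UNIV. d l i k * v t $ i * v t $ l)
       - (\<Sum>i\<in>UNIV. \<Sum>l\<in>UNIV. d k i l * v t $ i * v t $ l)) / 2"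
      by (simp add: sum_divide_distrib sum.distrib[symmetric] sum_subtractf[symmetric] add_divide_distrib diff_divide_distrib algebra_simps)
    then show ?thesis unfolding 1 2 by simp
  qed
  ultimately show ?thesis
    unfolding d_def[symmetric] by (simp add: matrix_vector_mult_def sum.distrib)
qed

text \<open>
  Noether's identity. For a constant field it is the Euler-Lagrange equation in the direction of the
  field, for the rotation field it controls the angular momentum. Only the derivative of the energy
  \<open>v \<bullet> (g z *v v)\<close> at fixed \<open>v\<close> enters, so no Christoffel symbols have to be computed.
\<close>

lemma geodesic_momentum_along_field:
  assumes c: "geodesic_flow g c v"
    and X: "(X has_vector_derivative X') (at t)"
    and E: "((\<lambda>z. v t \<bullet> (g z *v v t)) has_derivative D) (at (c t))"
  shows "((\<lambda>t. X t \<bullet> (g (c t) *v v t)) has_real_derivative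
     D (X t) / 2 + X' \<bullet> (g (c t) *v v t)) (at t)"
proof -
  define e where "e k = (\<Sum>i\<in>UNIV. \<Sum>j\<in>UNIV. partial_deriv k (\<lambda>y. g y $ i $ j) (c t) * v t $ i * v t $ j)" for k
  have "((\<lambda>z. v t \<bullet> (g z *v v t)) has_derivative
      (\<lambda>h. \<Sum>i\<in>UNIV. \<Sum>j\<in>UNIV. v t $ i * (\<Sum>k\<in>UNIV. partial_deriv k (\<lambda>y. g y $ i $ j) (c t) * h $ k) * v t $ j)) (at (c t))"
    unfolding quadratic_form_sum
    by (intro has_derivative_sum has_derivative_mult_left has_derivative_mult_right
          has_derivative_partials metric_coeff_differentiable)
  then have D: "D = (\<lambda>h. \<Sum>i\<in>UNIV. \<Sum>j\<in>UNIV. v t $ i * (\<Sum>k\<in>UNIV. partial_deriv k (\<lambda>y. g y $ i $ j) (c t) * h $ k) * v t $ j)"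
    using E has_derivative_unique by blast
  have "D (X t) = (\<Sum>i\<in>UNIV. \<Sum>j\<in>UNIV. \<Sum>k\<in>UNIV. partial_deriv k (\<lambda>y. g y $ i $ j) (c t) * v t $ i * v t $ j * X t $ k)"
    by (simp add: D sum_distrib_left sum_distrib_right mult_ac)
  also have "\<dots> = (\<Sum>i\<in>UNIV. \<Sum>k\<in>UNIV. \<Sum>j\<in>UNIV. partial_deriv k (\<lambda>y. g y $ i $ j) (c t) * v t $ i * v t $ j * X t $ k)"
    by (intro sum.cong refl sum.swap)
  also have "\<dots> = (\<Sum>k\<in>UNIV. \<Sum>i\<in>UNIV. \<Sum>j\<in>UNIV. partial_deriv k (\<lambda>y. g y $ i $ j) (c t) * v t $ i * v t $ j * X t $ k)"
    by (rule sum.swap)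
  also have "\<dots> = (\<Sum>k\<in>UNIV. e k * X t $ k)"
    by (simp add: e_def sum_distrib_right)
  finally have DX: "D (X t) = (\<Sum>k\<in>UNIV. e k * X t $ k)" .
  have "((\<lambda>t. X t $ k) has_real_derivative X' $ k) (at t)" for k
    using bounded_linear.has_vector_derivative[OF bounded_linear_vec_nth X, of k]
    by (simp add: has_real_derivative_iff_has_vector_derivative)
  then have "((\<lambda>t. \<Sum>k\<in>UNIV. X t $ k * (g (c t) *v v t) $ k) has_real_derivative
      (\<Sum>k\<in>UNIV. X' $ k * (g (c t) *v v t) $ k + e k / 2 * X t $ k)) (at t)"
    unfolding e_def by (intro DERIV_sum DERIV_mult geodesic_momentum_derivative[OF c])
  then show ?thesis
    by (simp add: DX inner_vec_def sum.distrib sum_divide_distrib add.commute)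
qed

end

section \<open>Auxiliary facts on the line and in the plane\<close>

lemma partial_deriv_on_axis:
  fixes f :: "real^'n \<Rightarrow> real"
  assumes "f differentiable (at (x *\<^sub>R axis i 1))"
  shows "((\<lambda>x. f (x *\<^sub>R axis i 1)) has_real_derivative partial_deriv i f (x *\<^sub>R axis i 1)) (at x)"
proof -
  have "((\<lambda>x. x *\<^sub>R axis i 1 :: real^'n) has_vector_derivative axis i 1) (at x)"
    by (auto intro!: derivative_eq_intros)
  from has_real_derivative_along[OF _ this] assms[unfolded frechet_derivative_works]
  show ?thesis unfolding partial_deriv_def by blast
qed

lemma partial_deriv_eq_0_of_even:
  fixes f :: "real^'n \<Rightarrow> real"
  assumes d: "f differentiable (at z)" and even: "\<And>h. f (z + (- h) *\<^sub>R axis j 1) = f (z + h *\<^sub>R axis j 1)"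
  shows "partial_deriv j f z = 0"
proof -
  have "((\<lambda>h. z + h *\<^sub>R axis j 1) has_vector_derivative axis j 1) (at 0)"
    by (auto intro!: derivative_eq_intros)
  from has_real_derivative_along[OF _ this, of f] d[unfolded frechet_derivative_works]
  have D: "((\<lambda>h. f (z + h *\<^sub>R axis j 1)) has_real_derivative partial_deriv j f z) (at 0)"
    unfolding partial_deriv_def by simp
  then have "((\<lambda>h. f (z + (- h) *\<^sub>R axis j 1)) has_real_derivative - partial_deriv j f z) (at 0)"
    using DERIV_mirror[of "\<lambda>h. f (z + h *\<^sub>R axis j 1)" "partial_deriv j f z" 0] by simp
  with D have "partial_deriv j f z = - partial_deriv j f z"
    unfolding even by (rule DERIV_unique)
  then show ?thesis by simp
qed

lemma first_hit:
  fixes f :: "real \<Rightarrow> real"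
  assumes "continuous_on {a..b} f" "a \<le> b" "f a < y" "y \<le> f b"
  obtains d where "a < d" "d \<le> b" "f d = y" "\<And>s. a \<le> s \<Longrightarrow> s < d \<Longrightarrow> f s < y"
proof -
  define S where "S = {t \<in> {a..b}. y \<le> f t}"
  have "closed S"
    using continuous_closed_preimage[OF assms(1), of "{y..}"] by (simp add: S_def vimage_def Int_def)
  moreover have "b \<in> S" "bdd_below S" using assms by (auto simp: S_def)
  ultimately have d: "Inf S \<in> S" by (intro closed_contains_Inf) auto
  have less: "f s < y" if "a \<le> s" "s < Inf S" for s
  proof (rule ccontr)
    assume "\<not> f s < y"
    then have "s \<in> S" using that d by (auto simp: S_def)
    then have "Inf S \<le> s" using \<open>bdd_below S\<close> by (rule cInf_lower)
    with that show False by simp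
  qed
  have ab: "a \<le> Inf S" "Inf S \<le> b" "y \<le> f (Inf S)" using d by (auto simp: S_def)
  have "f (Inf S) = y"
  proof (rule ccontr)
    assume "f (Inf S) \<noteq> y"
    with ab have "y < f (Inf S)" by simp
    moreover have "continuous_on {a..Inf S} f" using assms(1) ab by (rule_tac continuous_on_subset) auto
    ultimately obtain x where "a \<le> x" "x \<le> Inf S" "f x = y"
      using IVT'[of f a y "Inf S"] assms ab by auto
    with less[of x] \<open>f (Inf S) \<noteq> y\<close> show False by (cases "x = Inf S") auto
  qed
  moreover from this have "a < Inf S" using ab assms(3) by (cases "a = Inf S") auto
  ultimately show ?thesis using that ab less by blast
qed

text \<open>
  Uniqueness for a linear equation \<open>f' = \<kappa> f\<close> with \<open>|\<kappa>| \<le> C\<close>: the functions \<open>f\<^sup>2 exp (\<plusminus>2Ct)\<close> are monotone.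
\<close>

lemma zero_of_linear_bound:
  fixes f :: "real \<Rightarrow> real"
  assumes D: "\<And>t. t \<in> {a..b} \<Longrightarrow> (f has_real_derivative f' t) (at t)"
    and bound: "\<And>t. t \<in> {a..b} \<Longrightarrow> \<bar>f' t\<bar> \<le> C * \<bar>f t\<bar>"
    and zero: "f a = 0 \<or> f b = 0" and t: "t \<in> {a..b}"
  shows "f t = 0"
proof -
  have *: "\<bar>2 * f s * f' s\<bar> \<le> 2 * C * (f s)\<^sup>2" if "s \<in> {a..b}" for s
  proof -
    have "\<bar>f s\<bar> * \<bar>f' s\<bar> \<le> \<bar>f s\<bar> * (C * \<bar>f s\<bar>)"
      using bound[OF that] by (rule mult_left_mono) simp
    then show ?thesis by (simp add: abs_mult power2_eq_square mult_ac)
  qed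
  have D2: "((\<lambda>s. (f s)\<^sup>2 * exp (k * s)) has_real_derivative (2 * f s * f' s + k * (f s)\<^sup>2) * exp (k * s)) (at s)"
    if "s \<in> {a..b}" for s k
    using D[OF that] by (auto intro!: derivative_eq_intros simp: algebra_simps power2_eq_square)
  from zero show ?thesis
  proof
    assume "f a = 0"
    have "(f t)\<^sup>2 * exp (- (2 * C) * t) \<le> (f a)\<^sup>2 * exp (- (2 * C) * a)"
    proof (rule DERIV_nonpos_imp_nonincreasing[of a t "\<lambda>s. (f s)\<^sup>2 * exp (- (2 * C) * s)"])
      fix s assume "a \<le> s" "s \<le> t"
      then have s: "s \<in> {a..b}" using t by auto
      have "2 * f s * f' s + - (2 * C) * (f s)\<^sup>2 \<le> 0" using *[OF s] by (simp add: abs_le_iff)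
      then have "(2 * f s * f' s + - (2 * C) * (f s)\<^sup>2) * exp (- (2 * C) * s) \<le> 0"
        by (intro mult_nonpos_nonneg) auto
      then show "\<exists>y. ((\<lambda>s. (f s)\<^sup>2 * exp (- (2 * C) * s)) has_real_derivative y) (at s) \<and> y \<le> 0"
        using D2[OF s, of "- (2 * C)"] by blast
    qed (use t in auto)
    then show ?thesis using \<open>f a = 0\<close> by (simp add: mult_le_0_iff not_le[symmetric])
  next
    assume "f b = 0"
    have "(f t)\<^sup>2 * exp (2 * C * t) \<le> (f b)\<^sup>2 * exp (2 * C * b)"
    proof (rule DERIV_nonneg_imp_nondecreasing[of t b "\<lambda>s. (f s)\<^sup>2 * exp (2 * C * s)"])
      fix s assume "t \<le> s" "s \<le> b"
      then have s: "s \<in> {a..b}" using t by auto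
      have "2 * f s * f' s + 2 * C * (f s)\<^sup>2 \<ge> 0" using *[OF s] by (simp add: abs_le_iff)
      then have "(2 * f s * f' s + 2 * C * (f s)\<^sup>2) * exp (2 * C * s) \<ge> 0"
        by (intro mult_nonneg_nonneg) auto
      then show "\<exists>y. ((\<lambda>s. (f s)\<^sup>2 * exp (2 * C * s)) has_real_derivative y) (at s) \<and> y \<ge> 0"
        using D2[OF s, of "2 * C"] by blast
    qed (use t in auto)
    then show ?thesis using \<open>f b = 0\<close> by (simp add: mult_le_0_iff not_le[symmetric])
  qed
qed

definition rot90 :: "real^2 \<Rightarrow> real^2" where "rot90 z = vector [- (z $ 2), z $ 1]"

definition cross2 :: "real^2 \<Rightarrow> real^2 \<Rightarrow> real" where "cross2 z v = z $ 1 * v $ 2 - z $ 2 * v $ 1"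

lemma rot90_nth [simp]: "rot90 z $ 1 = - (z $ 2)" "rot90 z $ 2 = z $ 1"
  by (simp_all add: rot90_def)

lemma inner_real2: "z \<bullet> v = z $ 1 * v $ 1 + z $ 2 * v $ 2" for z v :: "real^2"
  by (simp add: inner_vec_def sum_2)

lemma bounded_linear_rot90: "bounded_linear rot90"
  by (rule linear_conv_bounded_linear[THEN iffD1], rule linearI) (simp_all add: vec_eq_iff forall_2)

lemma norm_decomposition: "(z \<bullet> v)\<^sup>2 + (cross2 z v)\<^sup>2 = (z \<bullet> z) * (v \<bullet> v)" for z v :: "real^2"
  unfolding inner_real2 cross2_def by algebra

lemma polar_decomposition: "(z \<bullet> z) *\<^sub>R v = (z \<bullet> v) *\<^sub>R z + cross2 z v *\<^sub>R rot90 z" for z v :: "real^2"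
  by (simp add: vec_eq_iff forall_2 inner_real2 cross2_def algebra_simps)

section \<open>The metric\<close>

text \<open>
  The parameters are those of the opening text: \<open>s1\<close>, \<open>s2\<close>, \<open>s3\<close> are the derivatives of \<open>s\<close>, and \<open>\<psi>\<close> switches
  from the flat metric to the cusp while the square \<open>q\<close> of the radius runs from 5 to 9. The bounds on the
  unit disc keep the Hessian of the potential close to the identity.
\<close>

locale two_line_metric =
  fixes s s1 s2 s3 \<psi> :: "real \<Rightarrow> real" and e :: real
  assumes smooth: "C_infinity s" "C_infinity s1" "C_infinity s2" "C_infinity \<psi>"
    and deriv_s: "\<And>q. (s has_real_derivative s1 q) (at q)"
    and deriv_s1: "\<And>q. (s1 has_real_derivative s2 q) (at q)"
    and deriv_s2: "\<And>q. (s2 has_real_derivative s3 q) (at q)"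
    and s_eq: "\<And>q. q \<ge> 1 / 2 \<Longrightarrow> s q = 1 / sqrt q"
    and \<psi>_bounds: "\<And>q. 0 \<le> \<psi> q" "\<And>q. \<psi> q \<le> 1"
    and \<psi>_0: "\<And>q. q \<le> 5 \<Longrightarrow> \<psi> q = 0" and \<psi>_1: "\<And>q. q \<ge> 9 \<Longrightarrow> \<psi> q = 1"
    and e: "0 < e" "e \<le> 1 / 100000"
    and small: "\<And>q. 0 \<le> q \<Longrightarrow> q \<le> 1 \<Longrightarrow> e * \<bar>s q\<bar> \<le> 1 / 1000"
      "\<And>q. 0 \<le> q \<Longrightarrow> q \<le> 1 \<Longrightarrow> e * \<bar>s1 q\<bar> \<le> 1 / 1000"
      "\<And>q. 0 \<le> q \<Longrightarrow> q \<le> 1 \<Longrightarrow> e * \<bar>s2 q\<bar> \<le> 1 / 1000"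
begin

definition q :: "real^2 \<Rightarrow> real" where "q z = (z $ 1)\<^sup>2 + (z $ 2)\<^sup>2"
text \<open>
  Outside the unit disc \<open>u/q = cos 2\<phi>\<close>.
\<close>

definition u :: "real^2 \<Rightarrow> real" where "u z = (z $ 1)\<^sup>2 - (z $ 2)\<^sup>2"

text \<open>
  The gradient of \<open>P = q/2 + e u s(q)\<close>; below, \<open>a11\<close>, \<open>a12\<close>, \<open>a22\<close> are the second derivatives of \<open>P\<close>.
\<close>

definition \<Phi> :: "real^2 \<Rightarrow> real^2" where
  "\<Phi> z = vector [z $ 1 + e * (2 * z $ 1 * s (q z) + 2 * z $ 1 * u z * s1 (q z)),
                  z $ 2 + e * (- 2 * z $ 2 * s (q z) + 2 * z $ 2 * u z * s1 (q z))]"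

definition a11 :: "real^2 \<Rightarrow> real" where
  "a11 z = 1 + e * (2 * s (q z) + (10 * (z $ 1)\<^sup>2 - 2 * (z $ 2)\<^sup>2) * s1 (q z) + 4 * (z $ 1)\<^sup>2 * u z * s2 (q z))"
definition a12 :: "real^2 \<Rightarrow> real" where
  "a12 z = 4 * e * z $ 1 * z $ 2 * u z * s2 (q z)"
definition a22 :: "real^2 \<Rightarrow> real" where
  "a22 z = 1 + e * (- 2 * s (q z) + (2 * (z $ 1)\<^sup>2 - 10 * (z $ 2)\<^sup>2) * s1 (q z) + 4 * (z $ 2)\<^sup>2 * u z * s2 (q z))"

definition D\<Phi> :: "real^2 \<Rightarrow> real^2 \<Rightarrow> real^2" where
  "D\<Phi> z v = vector [a11 z * v $ 1 + a12 z * v $ 2, a12 z * v $ 1 + a22 z * v $ 2]"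

text \<open>
  The coefficients of \<open>(1 - \<psi>) A\<^sup>2 + \<psi> (s\<^sup>2 z z\<^sup>T + s\<^sup>6 Jz (Jz)\<^sup>T)\<close>, where \<open>A\<close> is the Hessian of \<open>P\<close> and \<open>J\<close> the
  rotation by a right angle. Where \<open>\<psi> \<noteq> 0\<close>, the second metric is \<open>dr\<^sup>2 + d\<phi>\<^sup>2/r\<^sup>2\<close>.
\<close>

definition G11 :: "real^2 \<Rightarrow> real" where
  "G11 z = (1 - \<psi> (q z)) * ((a11 z)\<^sup>2 + (a12 z)\<^sup>2) + \<psi> (q z) * ((s (q z))\<^sup>2 * (z $ 1)\<^sup>2 + s (q z) ^ 6 * (z $ 2)\<^sup>2)"
definition G12 :: "real^2 \<Rightarrow> real" where
  "G12 z = (1 - \<psi> (q z)) * (a11 z * a12 z + a12 z * a22 z)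
     + \<psi> (q z) * ((s (q z))\<^sup>2 * (z $ 1 * z $ 2) - s (q z) ^ 6 * (z $ 1 * z $ 2))"
definition G22 :: "real^2 \<Rightarrow> real" where
  "G22 z = (1 - \<psi> (q z)) * ((a12 z)\<^sup>2 + (a22 z)\<^sup>2) + \<psi> (q z) * ((s (q z))\<^sup>2 * (z $ 2)\<^sup>2 + s (q z) ^ 6 * (z $ 1)\<^sup>2)"

definition g :: "real^2 \<Rightarrow> real^2^2" where
  "g z = vector [vector [G11 z, G12 z], vector [G12 z, G22 z]]"

lemma D\<Phi>_nth [simp]: "D\<Phi> z v $ 1 = a11 z * v $ 1 + a12 z * v $ 2"
  "D\<Phi> z v $ 2 = a12 z * v $ 1 + a22 z * v $ 2"
  by (simp_all add: D\<Phi>_def)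

lemma \<Phi>_nth: "\<Phi> z $ 1 = z $ 1 + e * (2 * z $ 1 * s (q z) + 2 * z $ 1 * u z * s1 (q z))"
  "\<Phi> z $ 2 = z $ 2 + e * (- 2 * z $ 2 * s (q z) + 2 * z $ 2 * u z * s1 (q z))"
  by (simp_all add: \<Phi>_def)

lemma g_nth: "g z $ 1 $ 1 = G11 z" "g z $ 1 $ 2 = G12 z" "g z $ 2 $ 1 = G12 z" "g z $ 2 $ 2 = G22 z"
  by (simp_all add: g_def)

lemma q_inner: "q z = z \<bullet> z"
  by (simp add: q_def inner_real2 power2_eq_square)

lemma q_norm: "q z = (norm z)\<^sup>2"
  by (simp add: q_inner power2_norm_eq_inner)

lemma q_nonneg: "0 \<le> q z"
  by (simp add: q_def)

lemma abs_u_le: "\<bar>u z\<bar> \<le> q z"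
  by (simp add: u_def q_def abs_le_iff)

lemma inner_g: "w \<bullet> (g z *v v) = (1 - \<psi> (q z)) * (D\<Phi> z w \<bullet> D\<Phi> z v)
    + \<psi> (q z) * ((s (q z))\<^sup>2 * ((z \<bullet> w) * (z \<bullet> v)) + s (q z) ^ 6 * (cross2 z w * cross2 z v))"
proof -
  have "w \<bullet> (g z *v v) = G11 z * (w $ 1 * v $ 1) + G12 z * (w $ 1 * v $ 2 + w $ 2 * v $ 1) + G22 z * (w $ 2 * v $ 2)"
    by (simp add: quadratic_form_sum sum_2 g_nth algebra_simps)
  then show ?thesis
    unfolding inner_real2 cross2_def G11_def G12_def G22_def D\<Phi>_nth by algebra
qed

lemma C_infinity_q: "C_infinity q" and C_infinity_u: "C_infinity u"
proof -
  have *: "C_infinity (\<lambda>z::real^2. (z $ 1)\<^sup>2)" "C_infinity (\<lambda>z::real^2. (z $ 2)\<^sup>2)"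
    by (intro C_infinity_power C_infinity_vec_nth)+
  have "q = (\<lambda>z. (z $ 1)\<^sup>2 + (z $ 2)\<^sup>2)" "u = (\<lambda>z. (z $ 1)\<^sup>2 - (z $ 2)\<^sup>2)"
    by (auto simp: q_def u_def)
  with C_infinity_add[OF *] C_infinity_diff[OF *] show "C_infinity q" "C_infinity u"
    by metis+
qed

lemma C_infinity_coeffs: "C_infinity (\<lambda>z. s (q z))" "C_infinity (\<lambda>z. s1 (q z))"
  "C_infinity (\<lambda>z. s2 (q z))" "C_infinity (\<lambda>z. \<psi> (q z))" "C_infinity (\<lambda>z. u z)"
  by (rule C_infinity_compose_real[OF _ C_infinity_q] smooth C_infinity_u)+

lemma C_infinity_a: "C_infinity (\<lambda>z. a11 z)" "C_infinity (\<lambda>z. a12 z)" "C_infinity (\<lambda>z. a22 z)"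
  unfolding a11_def a12_def a22_def
  by (intro C_infinity_add C_infinity_diff C_infinity_mult C_infinity_power C_infinity_const C_infinity_vec_nth C_infinity_coeffs)+

lemma C_infinity_G: "C_infinity (\<lambda>z. G11 z)" "C_infinity (\<lambda>z. G12 z)" "C_infinity (\<lambda>z. G22 z)"
  unfolding G11_def G12_def G22_def
  by (intro C_infinity_add C_infinity_diff C_infinity_mult C_infinity_power C_infinity_const C_infinity_vec_nth C_infinity_coeffs C_infinity_a)+

lemma s_outer:
  assumes "1 / 2 < t"
  shows "s t = 1 / sqrt t" "s1 t = - (1 / (2 * sqrt t ^ 3))" "s2 t = 3 / (4 * sqrt t ^ 5)"
proof -
  have s: "s x = 1 / sqrt x" if "1 / 2 < x" for x using that s_eq by simp
  show "s t = 1 / sqrt t" using assms by (rule s)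
  have d: "((\<lambda>x. 1 / sqrt x ^ n) has_real_derivative - (real n / (2 * sqrt x ^ (n + 2)))) (at x)" if "1 / 2 < x" for x n
  proof -
    have pos: "sqrt x > 0" and x: "x = sqrt x ^ 2" using that by auto
    have "((\<lambda>x. inverse (sqrt x ^ n)) has_real_derivative
      - (inverse (sqrt x ^ n) * (real n * (sqrt x ^ (n - Suc 0) * (inverse (sqrt x) / 2))) * inverse (sqrt x ^ n))) (at x)"
      using that pos
      by (intro DERIV_inverse'[OF DERIV_power[OF DERIV_real_sqrt, THEN DERIV_cong]]) auto
    moreover have "- (inverse (sqrt x ^ n) * (real n * (sqrt x ^ (n - Suc 0) * (inverse (sqrt x) / 2))) * inverse (sqrt x ^ n))
       = - (real n / (2 * sqrt x ^ (n + 2)))"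
      using pos by (cases n) (simp_all add: field_simps power_add power2_eq_square)
    ultimately show ?thesis by (simp add: inverse_eq_divide)
  qed
  have s1: "s1 x = - (1 / (2 * sqrt x ^ 3))" if "1 / 2 < x" for x
  proof -
    have "(s has_real_derivative - (1 / (2 * sqrt x ^ 3))) (at x)"
      by (rule has_field_derivative_transform_within_open[of "\<lambda>x. 1 / sqrt x ^ 1" _ _ "{1/2<..}"])
        (use d[OF that, of 1] that s in \<open>simp_all add: numeral_3_eq_3\<close>)
    then show ?thesis using deriv_s DERIV_unique by blast
  qed
  show "s1 t = - (1 / (2 * sqrt t ^ 3))" using assms by (rule s1)
  have "(s1 has_real_derivative - (1 / 2) * - (real 3 / (2 * sqrt t ^ (3 + 2)))) (at t)"
    using DERIV_cmult[OF d[OF assms, of 3], of "- (1 / 2)"] assms s1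
    by (elim has_field_derivative_transform_within_open[of _ _ _ "{1/2<..}"]) auto
  then have "s2 t = - (1 / 2) * - (real 3 / (2 * sqrt t ^ (3 + 2)))"
    using deriv_s1 DERIV_unique by blast
  then show "s2 t = 3 / (4 * sqrt t ^ 5)" by simp
qed

text \<open>
  Homogeneity makes the Hessian fix the radial direction. Its other eigenvalue is \<open>1 - \<beta> q = \<rho>/r\<close>.
\<close>

definition \<beta> :: "real^2 \<Rightarrow> real" where "\<beta> z = 3 * e * u z / sqrt (q z) ^ 5"

lemma a_outer:
  assumes "1 / 2 < q z"
  shows "a11 z = 1 - \<beta> z * (z $ 2)\<^sup>2" "a12 z = \<beta> z * (z $ 1 * z $ 2)" "a22 z = 1 - \<beta> z * (z $ 1)\<^sup>2"
proof -
  define r where "r = sqrt (q z)"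
  have r: "r > 0" "r\<^sup>2 = (z $ 1)\<^sup>2 + (z $ 2)\<^sup>2"
    using assms by (simp_all add: r_def q_def)
  have f: "2 / r = 2 * (r\<^sup>2)\<^sup>2 / r ^ 5" "1 / r ^ 3 = r\<^sup>2 / r ^ 5"
    using r(1) by (simp_all add: field_simps power_numeral_reduce)
  have S: "s (q z) = 1 / r" "s1 (q z) = - (1 / (2 * r ^ 3))" "s2 (q z) = 3 / (4 * r ^ 5)"
    unfolding r_def by (rule s_outer[OF assms])+
  have "2 * (1 / r) + (10 * (z $ 1)\<^sup>2 - 2 * (z $ 2)\<^sup>2) * - (1 / (2 * r ^ 3)) + 4 * (z $ 1)\<^sup>2 * u z * (3 / (4 * r ^ 5))
      = 2 / r - (5 * (z $ 1)\<^sup>2 - (z $ 2)\<^sup>2) * (1 / r ^ 3) + 3 * (z $ 1)\<^sup>2 * u z / r ^ 5"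
    using r(1) by (simp add: field_simps)
  also have "\<dots> = (2 * (r\<^sup>2)\<^sup>2 - (5 * (z $ 1)\<^sup>2 - (z $ 2)\<^sup>2) * r\<^sup>2 + 3 * (z $ 1)\<^sup>2 * u z) / r ^ 5"
    unfolding f by (simp add: add_divide_distrib diff_divide_distrib)
  also have "2 * (r\<^sup>2)\<^sup>2 - (5 * (z $ 1)\<^sup>2 - (z $ 2)\<^sup>2) * r\<^sup>2 + 3 * (z $ 1)\<^sup>2 * u z = - 3 * u z * (z $ 2)\<^sup>2"
    unfolding r(2) u_def by algebra
  finally show "a11 z = 1 - \<beta> z * (z $ 2)\<^sup>2"
    unfolding a11_def S \<beta>_def r_def[symmetric] by (simp add: mult_ac)
  show "a12 z = \<beta> z * (z $ 1 * z $ 2)"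
    unfolding a12_def S \<beta>_def r_def[symmetric] by simp
  have "- 2 * (1 / r) + (2 * (z $ 1)\<^sup>2 - 10 * (z $ 2)\<^sup>2) * - (1 / (2 * r ^ 3)) + 4 * (z $ 2)\<^sup>2 * u z * (3 / (4 * r ^ 5))
      = - (2 / r) - ((z $ 1)\<^sup>2 - 5 * (z $ 2)\<^sup>2) * (1 / r ^ 3) + 3 * (z $ 2)\<^sup>2 * u z / r ^ 5"
    using r(1) by (simp add: field_simps)
  also have "\<dots> = (- 2 * (r\<^sup>2)\<^sup>2 - ((z $ 1)\<^sup>2 - 5 * (z $ 2)\<^sup>2) * r\<^sup>2 + 3 * (z $ 2)\<^sup>2 * u z) / r ^ 5"
    unfolding f by (simp add: add_divide_distrib diff_divide_distrib)
  also have "- 2 * (r\<^sup>2)\<^sup>2 - ((z $ 1)\<^sup>2 - 5 * (z $ 2)\<^sup>2) * r\<^sup>2 + 3 * (z $ 2)\<^sup>2 * u z = - 3 * u z * (z $ 1)\<^sup>2"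
    unfolding r(2) u_def by algebra
  finally show "a22 z = 1 - \<beta> z * (z $ 1)\<^sup>2"
    unfolding a22_def S \<beta>_def r_def[symmetric] by (simp add: mult_ac)
qed

lemma D\<Phi>_outer:
  assumes "1 / 2 < q z"
  shows "D\<Phi> z v = v - (\<beta> z * cross2 z v) *\<^sub>R rot90 z"
  unfolding vec_eq_iff forall_2 D\<Phi>_nth a_outer[OF assms]
  by (simp add: cross2_def algebra_simps power2_eq_square)

text \<open>
  The radius of curvature \<open>r - 3e cos 2\<phi>\<close> of the parallel curves.
\<close>

definition \<rho> :: "real^2 \<Rightarrow> real" where "\<rho> z = sqrt (q z) - 3 * e * u z / q z"
definition F :: "real^2 \<Rightarrow> real" where "F z = (1 - \<psi> (q z)) * (\<rho> z)\<^sup>2 + \<psi> (q z) / q z"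

lemma \<rho>_\<beta>: "1 / 2 < q z \<Longrightarrow> \<rho> z = sqrt (q z) * (1 - \<beta> z * q z)"
proof -
  assume *: "1 / 2 < q z"
  define r where "r = sqrt (q z)"
  have "r > 0" "q z = r ^ 2" using * by (simp_all add: r_def)
  then show ?thesis
    unfolding \<rho>_def \<beta>_def r_def[symmetric] by (simp add: field_simps power_numeral_reduce)
qed

text \<open>
  This is \<open>dr\<^sup>2 + F d\<phi>\<^sup>2\<close>, since \<open>r dr = z \<bullet> dz\<close> and \<open>r\<^sup>2 d\<phi> = cross2 z dz\<close>.
\<close>

lemma inner_g_outer:
  assumes "1 / 2 < q z"
  shows "w \<bullet> (g z *v v) = (z \<bullet> w) * (z \<bullet> v) / q z + F z * (cross2 z w * cross2 z v) / (q z)\<^sup>2"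
proof -
  have q: "q z > 0" "q z = z $ 1 * z $ 1 + z $ 2 * z $ 2"
    using assms by (simp_all add: q_def power2_eq_square)
  have wv: "q z * (w \<bullet> v) = (z \<bullet> w) * (z \<bullet> v) + cross2 z w * cross2 z v"
    unfolding q(2) inner_real2 cross2_def by algebra
  have "D\<Phi> z w \<bullet> D\<Phi> z v = w \<bullet> v - 2 * \<beta> z * (cross2 z w * cross2 z v) + (\<beta> z)\<^sup>2 * q z * (cross2 z w * cross2 z v)"
    unfolding D\<Phi>_outer[OF assms] q(2)
    by (simp add: inner_real2 cross2_def) algebra
  moreover have "w \<bullet> v = ((z \<bullet> w) * (z \<bullet> v) + cross2 z w * cross2 z v) / q z"
    using wv q(1) by (simp add: field_simps)
  moreover have "(1 / q z - 2 * \<beta> z + (\<beta> z)\<^sup>2 * q z) = (\<rho> z)\<^sup>2 / (q z)\<^sup>2"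
  proof -
    have \<rho>2: "(\<rho> z)\<^sup>2 = q z * (1 - \<beta> z * q z)\<^sup>2"
      using q(1) unfolding \<rho>_\<beta>[OF assms] power_mult_distrib by simp
    show ?thesis unfolding \<rho>2 using q(1) by (simp add: field_simps power2_eq_square)
  qed
  moreover have "(P + C) / q z - 2 * \<beta> z * C + (\<beta> z)\<^sup>2 * q z * C = P / q z + (1 / q z - 2 * \<beta> z + (\<beta> z)\<^sup>2 * q z) * C" for P C
    by (simp add: add_divide_distrib algebra_simps)
  ultimately have 1: "D\<Phi> z w \<bullet> D\<Phi> z v = (z \<bullet> w) * (z \<bullet> v) / q z + (\<rho> z)\<^sup>2 / (q z)\<^sup>2 * (cross2 z w * cross2 z v)"
    by metis
  have "sqrt (q z) ^ 6 = (sqrt (q z) ^ 2) ^ 3" by (simp flip: power_mult)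
  then have 2: "s (q z) ^ 2 = 1 / q z" "s (q z) ^ 6 = 1 / q z ^ 3"
    using q(1) s_outer(1)[OF assms] by (simp_all add: power_divide)
  show ?thesis
    unfolding inner_g 1 2 F_def using q(1)
    by (simp add: field_simps power_numeral_reduce)
qed

lemma has_derivative_nth: "((\<lambda>z::real^'n. z $ i) has_derivative (\<lambda>h. h $ i)) (at z)"
  by (rule bounded_linear_imp_has_derivative) (rule bounded_linear_vec_nth)

lemma has_derivative_q: "(q has_derivative (\<lambda>h. 2 * (z \<bullet> h))) (at z)"
proof -
  have "((\<lambda>z. z \<bullet> z) has_derivative (\<lambda>h. z \<bullet> h + h \<bullet> z)) (at z)"
    by (intro has_derivative_inner has_derivative_ident)
  then show ?thesis unfolding q_inner[abs_def] by (simp add: inner_commute)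
qed

lemma has_derivative_compose_q:
  assumes "(f has_real_derivative f') (at (q z))"
  shows "((\<lambda>z. f (q z)) has_derivative (\<lambda>h. f' * (2 * (z $ 1 * h $ 1 + z $ 2 * h $ 2)))) (at z)"
  using DERIV_compose_FDERIV[OF assms has_derivative_q] by (simp add: inner_real2 mult_ac)

lemmas has_derivative_s =
  has_derivative_compose_q[OF deriv_s] has_derivative_compose_q[OF deriv_s1] has_derivative_compose_q[OF deriv_s2]

text \<open>
  The third derivatives of \<open>P\<close>. That four functions suffice for the derivatives of \<open>a11\<close>, \<open>a12\<close>, \<open>a22\<close>
  is the symmetry that makes \<open>\<Phi>\<close> straighten geodesics.
\<close>

definition b111 :: "real^2 \<Rightarrow> real" where
  "b111 z = e * (24 * z $ 1 * s1 (q z) + (36 * (z $ 1) ^ 3 - 12 * z $ 1 * (z $ 2)\<^sup>2) * s2 (q z) + 8 * (z $ 1) ^ 3 * u z * s3 (q z))"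
definition b112 :: "real^2 \<Rightarrow> real" where
  "b112 z = e * ((12 * (z $ 1)\<^sup>2 * z $ 2 - 4 * (z $ 2) ^ 3) * s2 (q z) + 8 * (z $ 1)\<^sup>2 * z $ 2 * u z * s3 (q z))"
definition b122 :: "real^2 \<Rightarrow> real" where
  "b122 z = e * ((4 * (z $ 1) ^ 3 - 12 * z $ 1 * (z $ 2)\<^sup>2) * s2 (q z) + 8 * z $ 1 * (z $ 2)\<^sup>2 * u z * s3 (q z))"
definition b222 :: "real^2 \<Rightarrow> real" where
  "b222 z = e * (- 24 * z $ 2 * s1 (q z) + (12 * (z $ 1)\<^sup>2 * z $ 2 - 36 * (z $ 2) ^ 3) * s2 (q z) + 8 * (z $ 2) ^ 3 * u z * s3 (q z))"

lemma has_derivative_a: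
  "(a11 has_derivative (\<lambda>h. b111 z * h $ 1 + b112 z * h $ 2)) (at z)"
  "(a12 has_derivative (\<lambda>h. b112 z * h $ 1 + b122 z * h $ 2)) (at z)"
  "(a22 has_derivative (\<lambda>h. b122 z * h $ 1 + b222 z * h $ 2)) (at z)"
proof -
  show "(a11 has_derivative (\<lambda>h. b111 z * h $ 1 + b112 z * h $ 2)) (at z)"
    unfolding a11_def[abs_def] u_def[abs_def]
    apply (rule has_derivative_eq_rhs)
     apply (rule has_derivative_nth has_derivative_s derivative_intros)+
    apply (rule ext)
    unfolding b111_def b112_def u_def
    by simp algebra
  show "(a12 has_derivative (\<lambda>h. b112 z * h $ 1 + b122 z * h $ 2)) (at z)"
    unfolding a12_def[abs_def] u_def[abs_def]
    apply (rule has_derivative_eq_rhs)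
     apply (rule has_derivative_nth has_derivative_s derivative_intros)+
    apply (rule ext)
    unfolding b112_def b122_def u_def
    by simp algebra
  show "(a22 has_derivative (\<lambda>h. b122 z * h $ 1 + b222 z * h $ 2)) (at z)"
    unfolding a22_def[abs_def] u_def[abs_def]
    apply (rule has_derivative_eq_rhs)
     apply (rule has_derivative_nth has_derivative_s derivative_intros)+
    apply (rule ext)
    unfolding b122_def b222_def u_def
    by simp algebra
qed

lemma has_derivative_\<Phi>: "(\<Phi> has_derivative D\<Phi> z) (at z)"
proof -
  have 1: "((\<lambda>z. \<Phi> z $ 1) has_derivative (\<lambda>h. D\<Phi> z h $ 1)) (at z)"
    unfolding \<Phi>_nth u_def[abs_def]
    apply (rule has_derivative_eq_rhs)
     apply (rule has_derivative_nth has_derivative_s derivative_intros)+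
    apply (rule ext)
    unfolding D\<Phi>_nth a11_def a12_def u_def
    by simp algebra
  have 2: "((\<lambda>z. \<Phi> z $ 2) has_derivative (\<lambda>h. D\<Phi> z h $ 2)) (at z)"
    unfolding \<Phi>_nth u_def[abs_def]
    apply (rule has_derivative_eq_rhs)
     apply (rule has_derivative_nth has_derivative_s derivative_intros)+
    apply (rule ext)
    unfolding D\<Phi>_nth a22_def a12_def u_def
    by simp algebra
  have "((\<lambda>z. \<Phi> z $ i) has_derivative (\<lambda>h. D\<Phi> z h $ i)) (at z)" for i
    using 1 2 exhaust_2[of i] by metis
  then show ?thesis
    by (subst has_derivative_componentwise_within)
       (auto simp: Basis_vec_def inner_axis)
qed

lemma abs_\<beta>: "1 / 2 < q z \<Longrightarrow> \<bar>\<beta> z\<bar> * q z \<le> 3 * e / sqrt (q z)"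
proof -
  assume *: "1 / 2 < q z"
  define r where "r = sqrt (q z)"
  have r: "r > 0" "q z = r ^ 2" using * by (simp_all add: r_def)
  have "\<bar>\<beta> z\<bar> * q z = 3 * e * \<bar>u z\<bar> / r ^ 3"
    unfolding \<beta>_def r_def[symmetric] r(2) using r(1) e by (simp add: abs_mult field_simps power_numeral_reduce)
  also have "\<dots> \<le> 3 * e * r ^ 2 / r ^ 3"
    using abs_u_le[of z] r e by (intro divide_right_mono mult_left_mono) auto
  also have "\<dots> = 3 * e / r" using r(1) by (simp add: field_simps power_numeral_reduce)
  finally show ?thesis by (simp add: r_def)
qed

text \<open>
  In the unit disc the Hessian differs from the identity by the small quantities that the locale
  bounds, and outside by \<open>\<beta> q\<close>, which is at most \<open>3e\<close>.
\<close>

lemma D\<Phi>_coercive: "v \<bullet> D\<Phi> z v \<ge> 1 / 2 * (v \<bullet> v)"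
proof (cases "q z \<le> 1")
  case True
  define x y where "x = (z $ 1)\<^sup>2" and "y = (z $ 2)\<^sup>2"
  have xy: "0 \<le> x" "0 \<le> y" "x \<le> 1" "y \<le> 1" "x + y \<le> 1"
    using True unfolding x_def y_def q_def by (auto simp: add_increasing add_increasing2 intro: order_trans[rotated])
  have u1: "\<bar>u z\<bar> \<le> 1" using abs_u_le[of z] True by simp
  have S: "\<bar>e * s (q z)\<bar> \<le> 1 / 1000" "\<bar>e * s1 (q z)\<bar> \<le> 1 / 1000" "\<bar>e * s2 (q z)\<bar> \<le> 1 / 1000"
    using small[OF q_nonneg True] e by (simp_all add: abs_mult)
  have B: "\<bar>a * b\<bar> \<le> K * (1 / 1000)" if "\<bar>a\<bar> \<le> K" "\<bar>b\<bar> \<le> 1 / 1000" for a b K :: real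
    unfolding abs_mult using that by (intro mult_mono) auto
  have xyp: "\<bar>z $ 1 * z $ 2\<bar> \<le> 1"
  proof -
    have "2 * \<bar>z $ 1 * z $ 2\<bar> \<le> x + y"
      unfolding x_def y_def using sum_squares_bound[of "\<bar>z $ 1\<bar>" "\<bar>z $ 2\<bar>"] by (simp add: abs_mult)
    then show ?thesis using xy by simp
  qed
  have xu: "\<bar>x * u z\<bar> \<le> 1" "\<bar>y * u z\<bar> \<le> 1" "\<bar>z $ 1 * z $ 2 * u z\<bar> \<le> 1"
    unfolding abs_mult[of _ "u z"] using u1 xy xyp by (auto intro!: mult_le_one)
  have 11: "\<bar>a11 z - 1\<bar> \<le> 1 / 50"
  proof -
    have "a11 z - 1 = 2 * (e * s (q z)) + (10 * x - 2 * y) * (e * s1 (q z)) + 4 * ((x * u z) * (e * s2 (q z)))"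
      by (simp add: a11_def x_def y_def algebra_simps)
    moreover have "\<bar>(10 * x - 2 * y) * (e * s1 (q z))\<bar> \<le> 10 * (1 / 1000)"
      using xy by (intro B S) auto
    moreover have "\<bar>(x * u z) * (e * s2 (q z))\<bar> \<le> 1 * (1 / 1000)" by (intro B S xu)
    ultimately show ?thesis using S(1) unfolding abs_le_iff by linarith
  qed
  have 22: "\<bar>a22 z - 1\<bar> \<le> 1 / 50"
  proof -
    have "a22 z - 1 = - 2 * (e * s (q z)) + (2 * x - 10 * y) * (e * s1 (q z)) + 4 * ((y * u z) * (e * s2 (q z)))"
      by (simp add: a22_def x_def y_def algebra_simps)
    moreover have "\<bar>(2 * x - 10 * y) * (e * s1 (q z))\<bar> \<le> 10 * (1 / 1000)"
      using xy by (intro B S) auto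
    moreover have "\<bar>(y * u z) * (e * s2 (q z))\<bar> \<le> 1 * (1 / 1000)" by (intro B S xu)
    ultimately show ?thesis using S(1) unfolding abs_le_iff by linarith
  qed
  have 12: "\<bar>a12 z\<bar> \<le> 1 / 50"
  proof -
    have "a12 z = 4 * ((z $ 1 * z $ 2 * u z) * (e * s2 (q z)))"
      by (simp add: a12_def algebra_simps)
    moreover have "\<bar>(z $ 1 * z $ 2 * u z) * (e * s2 (q z))\<bar> \<le> 1 * (1 / 1000)" by (intro B S xu)
    ultimately show ?thesis unfolding abs_le_iff by linarith
  qed
  have "v \<bullet> D\<Phi> z v = a11 z * (v $ 1)\<^sup>2 + a22 z * (v $ 2)\<^sup>2 + a12 z * (2 * v $ 1 * v $ 2)"
    by (simp add: inner_real2 power2_eq_square algebra_simps)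
  moreover have "a11 z * (v $ 1)\<^sup>2 \<ge> 49 / 50 * (v $ 1)\<^sup>2" "a22 z * (v $ 2)\<^sup>2 \<ge> 49 / 50 * (v $ 2)\<^sup>2"
  proof -
    have "49 / 50 \<le> a11 z" "49 / 50 \<le> a22 z"
      using 11 22 unfolding abs_le_iff by linarith+
    then show "a11 z * (v $ 1)\<^sup>2 \<ge> 49 / 50 * (v $ 1)\<^sup>2" "a22 z * (v $ 2)\<^sup>2 \<ge> 49 / 50 * (v $ 2)\<^sup>2"
      by (intro mult_right_mono; simp)+
  qed
  moreover have "\<bar>a12 z * (2 * v $ 1 * v $ 2)\<bar> \<le> 1 / 50 * ((v $ 1)\<^sup>2 + (v $ 2)\<^sup>2)"
    unfolding abs_mult[of "a12 z"]
    using 12 sum_squares_bound[of "v $ 1" "v $ 2"] sum_squares_bound[of "v $ 1" "- (v $ 2)"]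
    by (intro mult_mono) (auto simp: abs_le_iff)
  ultimately show ?thesis
    unfolding inner_real2 power2_eq_square abs_le_iff by (simp add: algebra_simps)
next
  case False
  then have q: "1 < q z" "1 / 2 < q z" by auto
  have "3 * e / sqrt (q z) \<le> 3 * e"
    using q e by (simp add: divide_le_eq mult_le_cancel_left)
  with abs_\<beta>[OF q(2)] e have "\<bar>\<beta> z\<bar> * q z \<le> 1 / 2" by linarith
  then have "\<bar>\<beta> z\<bar> * q z * (v \<bullet> v) \<le> 1 / 2 * (v \<bullet> v)"
    by (rule mult_right_mono) simp
  moreover have "(cross2 z v)\<^sup>2 \<le> q z * (v \<bullet> v)"
    unfolding q_inner norm_decomposition[symmetric] by simp
  then have "\<bar>\<beta> z\<bar> * (cross2 z v)\<^sup>2 \<le> \<bar>\<beta> z\<bar> * (q z * (v \<bullet> v))"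
    by (rule mult_left_mono) simp
  moreover have "v \<bullet> D\<Phi> z v = v \<bullet> v - \<beta> z * (cross2 z v)\<^sup>2"
    unfolding D\<Phi>_outer[OF q(2)] by (simp add: inner_diff_right) (simp add: inner_real2 cross2_def power2_eq_square algebra_simps)
  moreover have "\<beta> z * (cross2 z v)\<^sup>2 \<le> \<bar>\<beta> z\<bar> * (cross2 z v)\<^sup>2"
    by (intro mult_right_mono) auto
  ultimately show ?thesis by (simp add: mult.assoc)
qed

lemma D\<Phi>_norm_ge: "norm (D\<Phi> z v) \<ge> norm v / 2"
proof -
  have "1 / 2 * (norm v)\<^sup>2 \<le> norm v * norm (D\<Phi> z v)"
    using D\<Phi>_coercive[of v z] norm_cauchy_schwarz[of v "D\<Phi> z v"] by (simp add: power2_norm_eq_inner)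
  then show ?thesis
    by (cases "norm v = 0") (auto simp: power2_eq_square)
qed

text \<open>
  The gradient of a strictly convex function is strictly monotone along every segment.
\<close>

lemma \<Phi>_inj: "\<Phi> x = \<Phi> y \<Longrightarrow> x = y"
proof (rule ccontr)
  assume eq: "\<Phi> x = \<Phi> y" and "x \<noteq> y"
  define h where "h = y - x"
  define f where "f t = \<Phi> (x + t *\<^sub>R h) \<bullet> h" for t
  have "(f has_real_derivative D\<Phi> (x + t *\<^sub>R h) h \<bullet> h) (at t)" for t
  proof -
    have "((\<lambda>t. x + t *\<^sub>R h) has_vector_derivative h) (at t)"
      by (auto intro!: derivative_eq_intros)
    from has_real_derivative_along[OF has_derivative_inner_left[OF has_derivative_\<Phi>] this, of h]
    show ?thesis unfolding f_def[abs_def] .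
  qed
  moreover have "D\<Phi> (x + t *\<^sub>R h) h \<bullet> h > 0" for t
  proof -
    have "h \<bullet> h > 0" using \<open>x \<noteq> y\<close> by (simp add: h_def)
    moreover have "1 / 2 * (h \<bullet> h) \<le> h \<bullet> D\<Phi> (x + t *\<^sub>R h) h"
      by (rule D\<Phi>_coercive)
    moreover have "h \<bullet> D\<Phi> (x + t *\<^sub>R h) h = D\<Phi> (x + t *\<^sub>R h) h \<bullet> h"
      by (rule inner_commute)
    ultimately show ?thesis by linarith
  qed
  ultimately have "f 0 < f 1"
    by (intro DERIV_pos_imp_increasing[of 0 1 f]) (simp, blast)
  then show False using eq by (simp add: f_def h_def)
qed

lemma \<rho>_bounds:
  assumes "1 \<le> q z"
  shows "\<bar>\<rho> z - sqrt (q z)\<bar> \<le> 3 * e"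
proof -
  have "\<rho> z - sqrt (q z) = - (3 * e * (u z / q z))"
    by (simp add: \<rho>_def)
  moreover have "\<bar>u z / q z\<bar> \<le> 1"
    using abs_u_le[of z] assms by (simp add: divide_le_eq)
  then have "3 * e * \<bar>u z / q z\<bar> \<le> 3 * e * 1"
    using e by (intro mult_left_mono) auto
  ultimately show ?thesis
    using e by (simp only: abs_minus_cancel abs_mult)
qed

text \<open>
  A bound that fits both parts of the convex combination: the flat part is at least 1/4, the cusp is \<open>1/q\<close>.
\<close>

lemma F_ge:
  assumes "1 \<le> q z"
  shows "F z \<ge> 1 / (4 * q z)"
proof -
  have "sqrt (q z) \<ge> 1" using assms by simp
  then have "1 / 2 \<le> \<rho> z" using \<rho>_bounds[OF assms] e unfolding abs_le_iff by linarith
  then have "(1 / 2)\<^sup>2 \<le> (\<rho> z)\<^sup>2" by (rule power_mono) simp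
  moreover have "1 / (4 * q z) \<le> (1 / 2)\<^sup>2" using assms by (simp add: field_simps)
  ultimately have "(1 - \<psi> (q z)) * (1 / (4 * q z)) \<le> (1 - \<psi> (q z)) * (\<rho> z)\<^sup>2"
    using \<psi>_bounds[of "q z"] by (intro mult_left_mono) auto
  moreover have "\<psi> (q z) * (1 / (4 * q z)) \<le> \<psi> (q z) / q z"
    using \<psi>_bounds[of "q z"] assms by (simp add: field_simps)
  ultimately have "(1 - \<psi> (q z)) * (1 / (4 * q z)) + \<psi> (q z) * (1 / (4 * q z)) \<le> F z"
    unfolding F_def by (rule add_mono)
  then show ?thesis
    unfolding distrib_right[symmetric] by simp
qed

lemma F_pos: "1 \<le> q z \<Longrightarrow> F z > 0"
  using F_ge[of z] by (smt (verit) divide_pos_pos)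

lemma g_lower_bounds:
  "norm v \<le> 3 * (1 + (norm z)\<^sup>2) * riem_norm g z v"
  "\<bar>z \<bullet> v\<bar> \<le> 3 * sqrt (1 + (norm z)\<^sup>2) * riem_norm g z v"
proof -
  define N where "N = riem_norm g z v"
  have "norm v \<le> 3 * (1 + q z) * N \<and> \<bar>z \<bullet> v\<bar> \<le> 3 * sqrt (1 + q z) * N"
  proof (cases "q z \<le> 1")
    case True
    then have "\<psi> (q z) = 0" using \<psi>_0 by simp
    then have N: "N = norm (D\<Phi> z v)"
      by (simp add: N_def riem_norm_def inner_g norm_eq_sqrt_inner)
    with D\<Phi>_norm_ge[of v z] have 1: "norm v \<le> 2 * N" "N \<ge> 0" by auto
    have "norm z \<le> 1" using True by (simp add: q_norm power_le_one_iff)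
    with Cauchy_Schwarz_ineq2[of z v] have "\<bar>z \<bullet> v\<bar> \<le> 1 * norm v"
      by (meson mult_right_mono norm_ge_zero order_trans)
    moreover have "2 * N \<le> 3 * (1 + q z) * N" "2 * N \<le> 3 * sqrt (1 + q z) * N"
    proof -
      have "1 \<le> sqrt (1 + q z)" using q_nonneg[of z] by simp
      then have "2 \<le> 3 * sqrt (1 + q z)" by linarith
      then show "2 * N \<le> 3 * sqrt (1 + q z) * N" using 1(2) by (rule mult_right_mono)
      show "2 * N \<le> 3 * (1 + q z) * N" using 1(2) q_nonneg[of z] by (intro mult_right_mono) auto
    qed
    ultimately show ?thesis using 1 by auto
  next
    case False
    then have q: "1 \<le> q z" "1 / 2 < q z" "0 < q z" by auto
    define a b where "a = (z \<bullet> v)\<^sup>2 / q z" and "b = F z * (cross2 z v)\<^sup>2 / (q z)\<^sup>2"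
    have ab: "0 \<le> a" "0 \<le> b"
      using q F_pos[OF q(1)] by (auto simp: a_def b_def)
    have N: "N = sqrt (a + b)"
      by (simp add: N_def riem_norm_def inner_g_outer[OF q(2)] a_def b_def power2_eq_square)
    have "(z \<bullet> v)\<^sup>2 = q z * a" using q by (simp add: a_def)
    then have "\<bar>z \<bullet> v\<bar> = sqrt (q z) * sqrt a" by (metis real_sqrt_abs real_sqrt_mult)
    also have "\<dots> \<le> (3 * sqrt (1 + q z)) * N"
    proof (rule mult_mono)
      have "sqrt (q z) \<le> sqrt (1 + q z)" "0 \<le> sqrt (1 + q z)" using q by auto
      then show "sqrt (q z) \<le> 3 * sqrt (1 + q z)" by linarith
    qed (use ab q in \<open>auto simp: N\<close>)
    finally have 1: "\<bar>z \<bullet> v\<bar> \<le> 3 * sqrt (1 + q z) * N" .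
    have "(cross2 z v)\<^sup>2 / (4 * q z * (q z)\<^sup>2) \<le> b"
    proof -
      have "1 / (4 * q z) * ((cross2 z v)\<^sup>2 / (q z)\<^sup>2) \<le> F z * ((cross2 z v)\<^sup>2 / (q z)\<^sup>2)"
        using F_ge[OF q(1)] by (rule mult_right_mono) simp
      then show ?thesis by (simp add: b_def)
    qed
    then have "(cross2 z v)\<^sup>2 / q z \<le> 4 * (q z)\<^sup>2 * b"
      using q by (simp add: field_simps)
    moreover have "(norm v)\<^sup>2 = a + (cross2 z v)\<^sup>2 / q z"
      using norm_decomposition[of z v] q unfolding a_def power2_norm_eq_inner q_inner[symmetric]
      by (simp add: field_simps)
    ultimately have "(norm v)\<^sup>2 \<le> a + 4 * (q z)\<^sup>2 * b" by simp
    also have "\<dots> \<le> 4 * (q z)\<^sup>2 * a + 4 * (q z)\<^sup>2 * b"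
    proof -
      have "1 \<le> (q z)\<^sup>2" using q(1) by (rule one_le_power)
      then have "1 * a \<le> 4 * (q z)\<^sup>2 * a" using ab by (intro mult_right_mono) auto
      then show ?thesis by simp
    qed
    also have "\<dots> = (2 * q z * N)\<^sup>2"
      using ab unfolding N by (simp add: power_mult_distrib algebra_simps)
    finally have "norm v \<le> 2 * q z * N"
      by (rule power2_le_imp_le) (use q ab in \<open>auto simp: N\<close>)
    also have "\<dots> \<le> 3 * (1 + q z) * N"
      using q ab by (intro mult_right_mono) (auto simp: N)
    finally show ?thesis using 1 by simp
  qed
  then show "norm v \<le> 3 * (1 + (norm z)\<^sup>2) * riem_norm g z v"
    "\<bar>z \<bullet> v\<bar> \<le> 3 * sqrt (1 + (norm z)\<^sup>2) * riem_norm g z v"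
    unfolding N_def q_norm by auto
qed

lemma riemannian_g: "riemannian_metric g"
  unfolding riemannian_metric_def
proof (intro conjI allI impI)
  fix i j :: 2
  show "C_infinity (\<lambda>x. g x $ i $ j)"
    using exhaust_2[of i] exhaust_2[of j] by (auto simp: g_nth C_infinity_G)
next
  fix z
  show "transpose (g z) = g z"
    by (simp add: vec_eq_iff forall_2 transpose_def g_nth)
next
  fix z v :: "real^2" assume "v \<noteq> 0"
  have "0 < norm v" using \<open>v \<noteq> 0\<close> by simp
  also have "\<dots> \<le> 3 * (1 + (norm z)\<^sup>2) * riem_norm g z v" by (rule g_lower_bounds)
  finally have "riem_norm g z v > 0"
    by (smt (verit) zero_less_mult_pos zero_le_power2)
  then show "v \<bullet> (g z *v v) > 0" by (simp add: riem_norm_def)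
qed

lemma complete_g: "complete_riemannian_metric g"
  by (rule complete_riemannian_metricI[of _ 3]) (use riemannian_g g_lower_bounds in auto)

lemma F_far: "9 \<le> q z \<Longrightarrow> F z = 1 / q z"
  by (simp add: F_def \<psi>_1)

lemma F_flat: "q z \<le> 5 \<Longrightarrow> F z = (\<rho> z)\<^sup>2"
  by (simp add: F_def \<psi>_0)

lemma F_bounds:
  assumes "4 \<le> q z"
  shows "1 / q z \<le> F z" "F z \<le> 144 / q z"
proof -
  have r: "2 \<le> sqrt (q z)" using assms real_sqrt_le_mono[of 4 "q z"] by simp
  have \<rho>: "\<rho> z \<ge> 1" "\<rho> z \<le> sqrt (q z) + 1"
    using \<rho>_bounds[of z] assms r e unfolding abs_le_iff by linarith+
  have "1 \<le> (\<rho> z)\<^sup>2" using \<rho>(1) by (simp add: one_le_power)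
  moreover have "1 / q z \<le> 1" using assms by simp
  ultimately have "1 / q z \<le> (\<rho> z)\<^sup>2" by linarith
  then have "(1 - \<psi> (q z)) * (1 / q z) \<le> (1 - \<psi> (q z)) * (\<rho> z)\<^sup>2"
    using \<psi>_bounds[of "q z"] by (intro mult_left_mono) auto
  then show "1 / q z \<le> F z" unfolding F_def by (simp add: algebra_simps diff_divide_distrib)
  show "F z \<le> 144 / q z"
  proof (cases "q z \<le> 9")
    case True
    have "sqrt (q z) \<le> 3" using True real_sqrt_le_mono[of "q z" 9] by simp
    then have "(\<rho> z)\<^sup>2 \<le> 4\<^sup>2" using \<rho> by (intro power_mono) auto
    moreover have "16 \<le> 144 / q z" using True assms by (simp add: field_simps)
    ultimately have "(\<rho> z)\<^sup>2 \<le> 144 / q z" by simp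
    then have "(1 - \<psi> (q z)) * (\<rho> z)\<^sup>2 \<le> (1 - \<psi> (q z)) * (144 / q z)"
      using \<psi>_bounds[of "q z"] by (intro mult_left_mono) auto
    moreover have "\<psi> (q z) / q z \<le> \<psi> (q z) * (144 / q z)"
      using \<psi>_bounds[of "q z"] assms by (simp add: field_simps)
    ultimately have "F z \<le> (1 - \<psi> (q z)) * (144 / q z) + \<psi> (q z) * (144 / q z)"
      unfolding F_def by (rule add_mono)
    then show ?thesis unfolding distrib_right[symmetric] by simp
  next
    case False
    then show ?thesis using assms by (simp add: F_far divide_right_mono)
  qed
qed

text \<open>
  The derivative of \<open>F\<close> by the angle.
\<close>

definition F\<phi> :: "real^2 \<Rightarrow> real" where
  "F\<phi> z = (1 - \<psi> (q z)) * (2 * \<rho> z * (12 * e * (z $ 1 * z $ 2) / q z))"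

lemma has_derivative_F:
  assumes "0 < q z"
  obtains D where "(F has_derivative D) (at z)" "D (rot90 z) = F\<phi> z"
proof -
  define k where "k z h = 2 * (z $ 1 * h $ 1 + z $ 2 * h $ 2)" for z h :: "real^2"
  have k0: "k z (rot90 z) = 0" by (simp add: k_def)
  have \<psi>': "((\<lambda>z. \<psi> (q z)) has_derivative (\<lambda>h. deriv \<psi> (q z) * k z h)) (at z)"
    unfolding k_def by (rule has_derivative_compose_q[OF C_infinity_real_deriv(2)[OF smooth(4)]])
  have q': "((\<lambda>z. q z) has_derivative (\<lambda>h. k z h)) (at z)"
    using has_derivative_q[of z] by (simp add: k_def inner_real2)
  have s': "((\<lambda>z. sqrt (q z)) has_derivative (\<lambda>h. inverse (sqrt (q z)) / 2 * k z h)) (at z)"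
    unfolding k_def by (rule has_derivative_compose_q[OF DERIV_real_sqrt[OF assms]])
  have i': "((\<lambda>z. inverse (q z)) has_derivative (\<lambda>h. - (inverse (q z) * k z h * inverse (q z)))) (at z)"
    using assms by (intro Deriv.has_derivative_inverse q') auto
  have u': "((\<lambda>z. u z) has_derivative (\<lambda>h. 2 * (z $ 1 * h $ 1 - z $ 2 * h $ 2))) (at z)"
    unfolding u_def
    apply (rule has_derivative_eq_rhs)
     apply (rule has_derivative_nth derivative_intros)+
    by (simp add: fun_eq_iff algebra_simps)
  let ?P = "\<lambda>z. sqrt (q z) - 3 * e * (u z * inverse (q z))"
  let ?dI = "\<lambda>h. - (inverse (q z) * k z h * inverse (q z))"
  let ?dP = "\<lambda>h. inverse (sqrt (q z)) / 2 * k z h - 3 * e * (u z * ?dI h + 2 * (z $ 1 * h $ 1 - z $ 2 * h $ 2) * inverse (q z))"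
  have A: "((\<lambda>z. (1 - \<psi> (q z)) * (?P z * ?P z) + \<psi> (q z) * inverse (q z)) has_derivative
    (\<lambda>h. (1 - \<psi> (q z)) * (?P z * ?dP h + ?dP h * ?P z) + (0 - deriv \<psi> (q z) * k z h) * (?P z * ?P z)
      + (\<psi> (q z) * ?dI h + deriv \<psi> (q z) * k z h * inverse (q z)))) (at z)" (is "(_ has_derivative ?D) _")
    by (intro has_derivative_add has_derivative_mult has_derivative_diff has_derivative_const \<psi>' s' i' u' has_derivative_mult_right)
  have eqF: "(\<lambda>z. (1 - \<psi> (q z)) * (?P z * ?P z) + \<psi> (q z) * inverse (q z)) = F"
    by (simp add: F_def \<rho>_def power2_eq_square divide_inverse fun_eq_iff mult.assoc)
  have "?D (rot90 z) = F\<phi> z"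
  proof -
    have gen: "(1 - a) * (P * (R * 0 - 3 * e * (U * - (I * 0 * I) + 2 * (x * - y - y * x) * I))
        + (R * 0 - 3 * e * (U * - (I * 0 * I) + 2 * (x * - y - y * x) * I)) * P)
        + (0 - b * 0) * (P * P) + (a * - (I * 0 * I) + b * 0 * I)
        = (1 - a) * (2 * P * (12 * e * (x * y) * I))" for a b P R U I x y :: real
      by (simp add: algebra_simps)
    have "\<rho> z = ?P z"
      by (simp add: \<rho>_def divide_inverse mult.assoc)
    then have F\<phi>: "F\<phi> z = (1 - \<psi> (q z)) * (2 * ?P z * (12 * e * (z $ 1 * z $ 2) * inverse (q z)))"
      unfolding F\<phi>_def divide_inverse by simp
    show ?thesis unfolding k0 F\<phi> rot90_nth by (rule gen)
  qed
  with A[unfolded eqF] show ?thesis by (rule that)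
qed

lemma F\<phi>_far: "9 \<le> q z \<Longrightarrow> F\<phi> z = 0"
  by (simp add: F\<phi>_def \<psi>_1)

lemma F\<phi>_near:
  assumes "1 \<le> q z" "q z \<le> 9"
  shows "\<bar>F\<phi> z\<bar> \<le> 96 * e"
proof -
  have r: "1 \<le> sqrt (q z)" "sqrt (q z) \<le> 3"
    using assms real_sqrt_le_mono[of "q z" 9] by auto
  have \<rho>: "\<bar>\<rho> z\<bar> \<le> 4"
    using \<rho>_bounds[of z] assms r e unfolding abs_le_iff by linarith
  have "2 * \<bar>z $ 1 * z $ 2\<bar> \<le> q z"
    unfolding q_def using sum_squares_bound[of "\<bar>z $ 1\<bar>" "\<bar>z $ 2\<bar>"] by (simp add: abs_mult)
  then have w: "\<bar>z $ 1 * z $ 2 / q z\<bar> \<le> 1"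
    using assms by (simp add: divide_le_eq)
  have "F\<phi> z = (1 - \<psi> (q z)) * (24 * e * (\<rho> z * (z $ 1 * z $ 2 / q z)))"
    by (simp add: F\<phi>_def)
  then have "\<bar>F\<phi> z\<bar> = (1 - \<psi> (q z)) * (24 * e * (\<bar>\<rho> z\<bar> * \<bar>z $ 1 * z $ 2 / q z\<bar>))"
    using \<psi>_bounds[of "q z"] e by (simp only: abs_mult)
  also have "\<dots> \<le> 1 * (24 * e * (4 * 1))"
    using \<psi>_bounds[of "q z"] e \<rho> w by (intro mult_mono mult_nonneg_nonneg) auto
  finally show ?thesis by simp
qed

lemma F\<phi>_le_1: "1 \<le> q z \<Longrightarrow> \<bar>F\<phi> z\<bar> \<le> 1"
  using F\<phi>_near[of z] F\<phi>_far[of z] e by linarith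

text \<open>
  Along a geodesic \<open>(1/p)' = - F\<phi>/(2F\<^sup>2)\<close>; the lemma bounds this by \<open>1/r\<^sup>2\<close>, which is integrable along outgoing
  rays.
\<close>

lemma F\<phi>_bound:
  assumes "4 \<le> q z"
  shows "\<bar>F\<phi> z\<bar> \<le> 2 * (F z)\<^sup>2 / q z"
proof (cases "q z \<le> 9")
  case True
  have "\<bar>F\<phi> z\<bar> \<le> 96 * e" using F\<phi>_near[of z] True assms by simp
  also have "\<dots> \<le> 2 * (1 / 9)\<^sup>2 / 9"
    using e by (simp add: field_simps power2_eq_square)
  also have "\<dots> \<le> 2 * (F z)\<^sup>2 / q z"
  proof -
    have "1 / 9 \<le> 1 / q z" using True assms by (simp add: field_simps)
    with F_bounds(1)[OF assms] have "1 / 9 \<le> F z" by linarith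
    then have "(1 / 9)\<^sup>2 \<le> (F z)\<^sup>2" by (rule power_mono) simp
    then show ?thesis using True assms by (intro frac_le mult_left_mono) auto
  qed
  finally show ?thesis .
qed (use assms F\<phi>_far in simp)

text \<open>
  The functions \<open>h = e cos 2\<phi>\<close> and \<open>h' = - 2e sin 2\<phi>\<close>.
\<close>

definition support :: "real^2 \<Rightarrow> real" where "support z = e * u z / q z"
definition support' :: "real^2 \<Rightarrow> real" where "support' z = - (4 * e * (z $ 1 * z $ 2)) / q z"

lemma abs_support: "1 \<le> q z \<Longrightarrow> \<bar>support z\<bar> \<le> e" and abs_support': "1 \<le> q z \<Longrightarrow> \<bar>support' z\<bar> \<le> 2 * e"
proof -
  assume q: "1 \<le> q z"
  have "\<bar>u z / q z\<bar> \<le> 1" using abs_u_le[of z] q by (simp add: divide_le_eq)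
  then have "e * \<bar>u z / q z\<bar> \<le> e * 1" using e by (intro mult_left_mono) auto
  then show "\<bar>support z\<bar> \<le> e" using e by (simp add: support_def abs_mult)
  have "2 * \<bar>z $ 1 * z $ 2\<bar> \<le> q z"
    unfolding q_def using sum_squares_bound[of "\<bar>z $ 1\<bar>" "\<bar>z $ 2\<bar>"] by (simp add: abs_mult)
  then have "2 * e * (2 * \<bar>z $ 1 * z $ 2\<bar>) \<le> 2 * e * q z"
    using e by (intro mult_left_mono) auto
  then show "\<bar>support' z\<bar> \<le> 2 * e" using e q by (simp add: support'_def abs_mult divide_le_eq)
qed

lemma \<Phi>_outer:
  assumes "1 / 2 < q z"
  shows "\<Phi> z = (1 + support z / sqrt (q z)) *\<^sub>R z + (support' z / sqrt (q z)) *\<^sub>R rot90 z"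
proof -
  define r where "r = sqrt (q z)"
  have r: "r > 0" "r\<^sup>2 = (z $ 1)\<^sup>2 + (z $ 2)\<^sup>2" and qr: "q z = r\<^sup>2"
    using assms by (simp_all add: r_def q_def)
  have S: "s (q z) = r\<^sup>2 / r ^ 3" "s1 (q z) = - (1 / (2 * r ^ 3))"
    unfolding r_def using s_outer[OF assms] r by (simp_all add: power_numeral_reduce r_def)
  have h: "support z / r = e * u z / r ^ 3" "support' z / r = - (4 * e * (z $ 1 * z $ 2)) / r ^ 3"
    unfolding support_def support'_def qr by (simp_all add: power_numeral_reduce)
  have "\<Phi> z $ 1 = z $ 1 + e * (z $ 1) * (2 * r\<^sup>2 - u z) / r ^ 3"
    "\<Phi> z $ 2 = z $ 2 + e * (z $ 2) * (- 2 * r\<^sup>2 - u z) / r ^ 3"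
    unfolding \<Phi>_nth S using r(1) by (simp_all add: field_simps)
  moreover have "z $ 1 + e * (z $ 1) * (2 * r\<^sup>2 - u z) / r ^ 3 = z $ 1 + (e * u z / r ^ 3 * z $ 1 + - (4 * e * (z $ 1 * z $ 2)) / r ^ 3 * - z $ 2)"
    "z $ 2 + e * (z $ 2) * (- 2 * r\<^sup>2 - u z) / r ^ 3 = z $ 2 + (e * u z / r ^ 3 * z $ 2 + - (4 * e * (z $ 1 * z $ 2)) / r ^ 3 * z $ 1)"
    unfolding r(2) u_def using r(1) by (simp_all add: field_simps power2_eq_square)
  ultimately show ?thesis
    unfolding vec_eq_iff forall_2 r_def[symmetric] h by (simp add: algebra_simps)
qed

text \<open>
  The moment about the origin of the line through \<open>\<Phi> z\<close> in the direction \<open>D\<Phi> z w\<close>. The first factor is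
  \<open>1 + h/r\<close>; for a radial \<open>w\<close> only the term with \<open>h'\<close> remains.
\<close>

lemma moment_outer:
  assumes "1 / 2 < q z"
  shows "cross2 (\<Phi> z) (D\<Phi> z w) =
    (1 + support z / sqrt (q z)) * (\<rho> z * cross2 z w / sqrt (q z)) - support' z / sqrt (q z) * (z \<bullet> w)"
proof -
  have gen: "cross2 (A *\<^sub>R z + B *\<^sub>R rot90 z) (w - (\<beta> z * cross2 z w) *\<^sub>R rot90 z)
      = A * ((1 - \<beta> z * q z) * cross2 z w) - B * (z \<bullet> w)" for A B
    unfolding q_def by (simp add: cross2_def inner_real2 algebra_simps power2_eq_square)
  have "\<rho> z / sqrt (q z) = 1 - \<beta> z * q z"
    using assms unfolding \<rho>_\<beta>[OF assms] by simp
  then show ?thesis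
    unfolding \<Phi>_outer[OF assms] D\<Phi>_outer[OF assms] gen by (metis times_divide_eq_left)
qed

end

section \<open>Geodesics of the metric\<close>

locale two_line_geodesic = two_line_metric +
  fixes c v :: "real \<Rightarrow> real^2"
  assumes flow: "geodesic_flow g c v"
begin

lemma deriv_c: "(c has_vector_derivative v t) (at t)"
  and unit_speed: "riem_norm g (c t) (v t) = 1"
  using flow unfolding geodesic_flow_def by blast+

lemma deriv_v: obtains a where "(v has_vector_derivative a) (at t)"
  using flow unfolding geodesic_flow_def by blast

lemma continuous_c: "continuous_on S c" and continuous_v: "continuous_on S v"
proof -
  have "isCont c t" "isCont v t" for t
    using has_vector_derivative_continuous[OF deriv_c] apply blast
    using deriv_v has_vector_derivative_continuous by metis
  then show "continuous_on S c" "continuous_on S v"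
    by (auto intro: continuous_at_imp_continuous_on)
qed

lemma unit_speed_square: "v t \<bullet> (g (c t) *v v t) = 1"
  using unit_speed[of t] unfolding riem_norm_def by simp

lemma deriv_along: "(f has_derivative D) (at (c t)) \<Longrightarrow> ((\<lambda>t. f (c t)) has_real_derivative D (v t)) (at t)"
  by (rule has_real_derivative_along[OF _ deriv_c])

text \<open>
  In the flat zone the momentum of \<open>v\<close> in the direction \<open>h\<close> is \<open>D\<Phi> h \<bullet> D\<Phi> v\<close>. By the symmetry of the third
  derivatives its derivative and the right-hand side of Noether's identity differ by \<open>D\<Phi> h\<close> times the
  derivative of \<open>D\<Phi> v\<close>, for every \<open>h\<close>.
\<close>

lemma flat_velocity_constant:
  assumes "q (c t) < 5"
  shows "((\<lambda>t. D\<Phi> (c t) (v t)) has_vector_derivative 0) (at t)"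
proof -
  define z w where "z = c t" and "w = v t"
  obtain a where a: "(v has_vector_derivative a) (at t)" using deriv_v .
  have v': "((\<lambda>t. v t $ i) has_real_derivative a $ i) (at t)" for i
    using bounded_linear.has_vector_derivative[OF bounded_linear_vec_nth a, of i]
    by (simp add: has_real_derivative_iff_has_vector_derivative)
  have a': "((\<lambda>t. a11 (c t)) has_real_derivative b111 z * w $ 1 + b112 z * w $ 2) (at t)"
    "((\<lambda>t. a12 (c t)) has_real_derivative b112 z * w $ 1 + b122 z * w $ 2) (at t)"
    "((\<lambda>t. a22 (c t)) has_real_derivative b122 z * w $ 1 + b222 z * w $ 2) (at t)"
    unfolding z_def w_def by (rule deriv_along[OF has_derivative_a(1)] deriv_along[OF has_derivative_a(2)] deriv_along[OF has_derivative_a(3)])+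
  define W1 W2 where "W1 t = D\<Phi> (c t) (v t) $ 1" and "W2 t = D\<Phi> (c t) (v t) $ 2" for t
  obtain o1 where o1: "(W1 has_real_derivative o1) (at t)"
    unfolding W1_def[abs_def] D\<Phi>_nth using DERIV_add[OF DERIV_mult[OF a'(1) v'] DERIV_mult[OF a'(2) v']] by blast
  obtain o2 where o2: "(W2 has_real_derivative o2) (at t)"
    unfolding W2_def[abs_def] D\<Phi>_nth using DERIV_add[OF DERIV_mult[OF a'(2) v'] DERIV_mult[OF a'(3) v']] by blast
  have op: "open {z. q z < 5}"
    by (rule open_Collect_less[OF C_infinity_imp_continuous_on[OF C_infinity_q] continuous_on_const])
  have opt: "open {t. q (c t) < 5}"
    using continuous_on_compose2[OF C_infinity_imp_continuous_on[OF C_infinity_q, of UNIV] continuous_c[of UNIV]]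
    by (auto intro: open_Collect_less)
  have inner_flat: "x \<bullet> (g z *v y) = D\<Phi> z x \<bullet> D\<Phi> z y" if "q z < 5" for x y z
    using that by (simp add: inner_g \<psi>_0)
  have eqE: "(a11 x * w $ 1 + a12 x * w $ 2)\<^sup>2 + (a12 x * w $ 1 + a22 x * w $ 2)\<^sup>2 = w \<bullet> (g x *v w)"
    if "q x < 5" for x
    by (subst inner_flat[OF that]) (simp add: inner_real2 power2_eq_square)
  let ?dE = "\<lambda>h::real^2. W1 t * ((b111 z * h $ 1 + b112 z * h $ 2) * w $ 1 + (b112 z * h $ 1 + b122 z * h $ 2) * w $ 2)
    + W2 t * ((b112 z * h $ 1 + b122 z * h $ 2) * w $ 1 + (b122 z * h $ 1 + b222 z * h $ 2) * w $ 2)"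
  have E: "((\<lambda>z. w \<bullet> (g z *v w)) has_derivative (\<lambda>h. 2 * ?dE h)) (at z)"
  proof (rule has_derivative_transform_within_open[OF _ op])
    show "((\<lambda>z. (a11 z * w $ 1 + a12 z * w $ 2)\<^sup>2 + (a12 z * w $ 1 + a22 z * w $ 2)\<^sup>2)
        has_derivative (\<lambda>h. 2 * ?dE h)) (at z)"
      unfolding W1_def W2_def D\<Phi>_nth z_def[symmetric] w_def[symmetric]
      apply (rule has_derivative_eq_rhs)
       apply (rule has_derivative_a derivative_intros)+
      by (simp add: fun_eq_iff algebra_simps)
  qed (use assms eqE in \<open>auto simp: z_def\<close>)
  have P: "((\<lambda>t. D\<Phi> (c t) h \<bullet> D\<Phi> (c t) (v t)) has_real_derivative ?dE h) (at t)" for h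
  proof (rule has_field_derivative_transform_within_open[OF _ opt])
    have "((\<lambda>t. h) has_vector_derivative 0) (at t)" by simp
    from geodesic_momentum_along_field[OF riemannian_g flow this E[unfolded z_def w_def]]
    show "((\<lambda>t. h \<bullet> (g (c t) *v v t)) has_real_derivative ?dE h) (at t)"
      by (simp add: z_def w_def add_divide_distrib)
  qed (use assms in \<open>auto simp: inner_flat\<close>)
  have Q: "((\<lambda>t. (a11 (c t) * h1 + a12 (c t) * h2) * W1 t + (a12 (c t) * h1 + a22 (c t) * h2) * W2 t) has_real_derivative
     ((b111 z * w $ 1 + b112 z * w $ 2) * h1 + (b112 z * w $ 1 + b122 z * w $ 2) * h2) * W1 t + o1 * (a11 z * h1 + a12 z * h2)
     + (((b112 z * w $ 1 + b122 z * w $ 2) * h1 + (b122 z * w $ 1 + b222 z * w $ 2) * h2) * W2 t + o2 * (a12 z * h1 + a22 z * h2))) (at t)" for h1 h2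
    unfolding z_def by (intro DERIV_add DERIV_mult DERIV_cmult_right a'[unfolded z_def] o1 o2)
  have "D\<Phi> z h \<bullet> vector [o1, o2] = 0" for h
  proof -
    have "((\<lambda>t. D\<Phi> (c t) h \<bullet> D\<Phi> (c t) (v t)) has_real_derivative
     ((b111 z * w $ 1 + b112 z * w $ 2) * h $ 1 + (b112 z * w $ 1 + b122 z * w $ 2) * h $ 2) * W1 t + o1 * (a11 z * h $ 1 + a12 z * h $ 2)
     + (((b112 z * w $ 1 + b122 z * w $ 2) * h $ 1 + (b122 z * w $ 1 + b222 z * w $ 2) * h $ 2) * W2 t + o2 * (a12 z * h $ 1 + a22 z * h $ 2))) (at t)"
      using Q[of "h $ 1" "h $ 2"] unfolding W1_def W2_def inner_real2 D\<Phi>_nth .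
    from DERIV_unique[OF this P]
    have "o1 * (a11 z * h $ 1 + a12 z * h $ 2) + o2 * (a12 z * h $ 1 + a22 z * h $ 2) = 0"
      by (simp add: algebra_simps)
    then show ?thesis by (simp add: inner_real2 mult.commute)
  qed
  from this[of "vector [o1, o2]"] have "vector [o1, o2] = (0 :: real^2)"
    using D\<Phi>_coercive[of "vector [o1, o2]" z]
    by (metis half_gt_zero_iff inner_commute inner_gt_zero_iff linorder_not_le mult.commute mult_1 times_divide_eq_right)
  then have "o1 = 0" "o2 = 0" by (simp_all add: vec_eq_iff forall_2)
  with o1 o2 have "((\<lambda>t. D\<Phi> (c t) (v t) $ i) has_real_derivative 0) (at t)" for i
    using exhaust_2[of i] unfolding W1_def[abs_def] W2_def[abs_def] by auto
  moreover have "(*) 0 = (\<lambda>x::real. 0::real)" by auto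
  ultimately show ?thesis
    unfolding has_vector_derivative_def has_field_derivative_def
    by (subst has_derivative_componentwise_within) (auto simp: Basis_vec_def inner_axis)
qed

text \<open>
  Euclidean and Riemannian angular momentum. Outside the unit circle \<open>m = r\<^sup>2 \<phi>'\<close> and \<open>p = F \<phi>'\<close>.
\<close>

definition m :: "real \<Rightarrow> real" where "m t = cross2 (c t) (v t)"
definition p :: "real \<Rightarrow> real" where "p t = rot90 (c t) \<bullet> (g (c t) *v v t)"

lemma p_outer:
  assumes "1 / 2 < q (c t)"
  shows "p t = F (c t) * m t / q (c t)"
proof -
  have "c t \<bullet> rot90 (c t) = 0" "cross2 (c t) (rot90 (c t)) = q (c t)"
    by (simp_all add: inner_real2 cross2_def q_def power2_eq_square)
  with assms show ?thesis
    unfolding p_def m_def inner_g_outer[OF assms] by (simp add: power2_eq_square)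
qed

text \<open>
  Noether's identity for the rotation field. Of the metric \<open>dr\<^sup>2 + F d\<phi>\<^sup>2\<close> only \<open>F\<close> depends on the angle.
\<close>

lemma deriv_p:
  assumes "1 / 2 < q (c t)"
  shows "(p has_real_derivative F\<phi> (c t) * (m t)\<^sup>2 / (2 * (q (c t))\<^sup>2)) (at t)"
proof -
  define z w where "z = c t" and "w = v t"
  have q: "q z > 0" "1 / 2 < q z" using assms by (simp_all add: z_def)
  have op: "open {z. 1 / 2 < q z}"
    by (rule open_Collect_less[OF continuous_on_const C_infinity_imp_continuous_on[OF C_infinity_q]])
  obtain DF where DF: "(F has_derivative DF) (at z)" "DF (rot90 z) = F\<phi> z"
    using has_derivative_F[OF q(1)] .
  have i': "((\<lambda>z. inverse (q z)) has_derivative (\<lambda>h. - (inverse (q z) * (2 * (z \<bullet> h)) * inverse (q z)))) (at z)"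
    using q by (intro Deriv.has_derivative_inverse has_derivative_q) auto
  have c': "((\<lambda>z. cross2 z w) has_derivative (\<lambda>h. cross2 h w)) (at z)"
    unfolding cross2_def
    by (intro has_derivative_diff has_derivative_mult_left has_derivative_nth)
  have n': "((\<lambda>z. z \<bullet> w) has_derivative (\<lambda>h. h \<bullet> w)) (at z)"
    by (intro has_derivative_inner_left has_derivative_ident)
  define D where "D h = (z \<bullet> w) * (z \<bullet> w) * - (inverse (q z) * (2 * (z \<bullet> h)) * inverse (q z)) + ((z \<bullet> w) * (h \<bullet> w) + (h \<bullet> w) * (z \<bullet> w)) * inverse (q z)
    + (F z * (cross2 z w * cross2 z w) * (inverse (q z) * - (inverse (q z) * (2 * (z \<bullet> h)) * inverse (q z)) + - (inverse (q z) * (2 * (z \<bullet> h)) * inverse (q z)) * inverse (q z))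
      + (F z * (cross2 z w * cross2 h w + cross2 h w * cross2 z w) + DF h * (cross2 z w * cross2 z w)) * (inverse (q z) * inverse (q z)))" for h
  have eqE: "(x \<bullet> w) * (x \<bullet> w) * inverse (q x) + F x * (cross2 x w * cross2 x w) * (inverse (q x) * inverse (q x))
      = w \<bullet> (g x *v w)" if "1 / 2 < q x" for x
    unfolding inner_g_outer[OF that] divide_inverse power2_eq_square inverse_mult_distrib ..
  have E: "((\<lambda>z. w \<bullet> (g z *v w)) has_derivative D) (at z)"
  proof (rule has_derivative_transform_within_open[OF _ op])
    show "((\<lambda>z. (z \<bullet> w) * (z \<bullet> w) * inverse (q z) + F z * (cross2 z w * cross2 z w) * (inverse (q z) * inverse (q z))) has_derivative D) (at z)"
      unfolding D_def by (intro has_derivative_add has_derivative_mult i' c' n' DF)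
  qed (use q eqE in auto)
  have X: "((\<lambda>t. rot90 (c t)) has_vector_derivative rot90 w) (at t)"
    unfolding w_def by (rule bounded_linear.has_vector_derivative[OF bounded_linear_rot90 deriv_c])
  have P: "(p has_real_derivative D (rot90 z) / 2 + rot90 w \<bullet> (g z *v w)) (at t)"
    using geodesic_momentum_along_field[OF riemannian_g flow X E[unfolded z_def w_def]]
    unfolding p_def[abs_def] z_def w_def .
  have r: "z \<bullet> rot90 z = 0" "rot90 z \<bullet> w = cross2 z w" "cross2 (rot90 z) w = - (z \<bullet> w)"
     "z \<bullet> rot90 w = - cross2 z w" "cross2 z (rot90 w) = z \<bullet> w"
    by (simp_all add: inner_real2 cross2_def)
  have "D (rot90 z) / 2 + rot90 w \<bullet> (g z *v w) = F\<phi> z * (cross2 z w)\<^sup>2 / (2 * (q z)\<^sup>2)"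
  proof -
    have gen: "(A * A * - (I * (2 * 0) * I) + (A * M + M * A) * I
      + (F' * (M * M) * (I * - (I * (2 * 0) * I) + - (I * (2 * 0) * I) * I)
        + (F' * (M * - A + - A * M) + f * (M * M)) * (I * I))) / 2
      + (- M * A * I + F' * (A * M) * (I * I)) = f * (M * M) * (I * I) / 2" for A I M F' f :: real
      by (simp add: field_simps)
    have 1: "rot90 w \<bullet> (g z *v w) = - cross2 z w * (z \<bullet> w) * inverse (q z)
        + F z * ((z \<bullet> w) * cross2 z w) * (inverse (q z) * inverse (q z))"
      unfolding inner_g_outer[OF q(2)] r divide_inverse power2_eq_square inverse_mult_distrib ..
    have 2: "F\<phi> z * (cross2 z w)\<^sup>2 / (2 * (q z)\<^sup>2) = F\<phi> z * (cross2 z w * cross2 z w) * (inverse (q z) * inverse (q z)) / 2"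
      using q(1) by (simp add: power2_eq_square field_simps)
    show ?thesis
      unfolding 1 2 D_def r DF(2) by (rule gen)
  qed
  with P show ?thesis by (simp add: m_def z_def w_def)
qed

text \<open>
  The quotient \<open>n/r\<close> is the radial velocity \<open>r'\<close>.
\<close>

definition n :: "real \<Rightarrow> real" where "n t = c t \<bullet> v t"
definition r :: "real \<Rightarrow> real" where "r t = sqrt (q (c t))"

lemma r_square: "(r t)\<^sup>2 = q (c t)"
  by (simp add: r_def q_nonneg)

lemma r_nonneg: "0 \<le> r t"
  by (simp add: r_def q_nonneg)

lemma q_ge_iff: "0 \<le> a \<Longrightarrow> a\<^sup>2 \<le> q (c t) \<longleftrightarrow> a \<le> r t"
  unfolding r_square[symmetric] using r_nonneg[of t] by (simp add: abs_le_square_iff[symmetric])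

lemma energy:
  assumes "1 \<le> q (c t)"
  shows "(n t)\<^sup>2 / q (c t) + F (c t) * (m t)\<^sup>2 / (q (c t))\<^sup>2 = 1"
proof -
  have "1 / 2 < q (c t)" using assms by simp
  from unit_speed_square[of t] show ?thesis
    unfolding inner_g_outer[OF \<open>1 / 2 < q (c t)\<close>] n_def m_def by (simp add: power2_eq_square)
qed

lemma deriv_q: "((\<lambda>t. q (c t)) has_real_derivative 2 * n t) (at t)"
  using deriv_along[OF has_derivative_q] by (simp add: n_def)

lemma deriv_r: "1 \<le> q (c t) \<Longrightarrow> (r has_real_derivative n t / r t) (at t)"
  unfolding r_def by (rule DERIV_cong[OF DERIV_chain2[OF DERIV_real_sqrt deriv_q]]) (auto simp: field_simps)

lemma continuous_q: "continuous_on S (\<lambda>t. q (c t))"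
  using deriv_q by (intro continuous_at_imp_continuous_on) (blast intro: DERIV_isCont)

lemma continuous_r: "continuous_on S r"
  unfolding r_def by (intro continuous_on_real_sqrt continuous_q)

lemma continuous_n: "continuous_on S n"
  unfolding n_def by (intro continuous_on_inner continuous_c continuous_v)

lemma continuous_m: "continuous_on S m"
  unfolding m_def cross2_def
  by (intro continuous_on_diff continuous_on_mult continuous_on_component continuous_c continuous_v)

lemma F_m_le: "1 \<le> q (c t) \<Longrightarrow> F (c t) * (m t)\<^sup>2 / (q (c t))\<^sup>2 \<le> 1"
proof -
  assume *: "1 \<le> q (c t)"
  have "0 \<le> (n t)\<^sup>2 / q (c t)" using * by simp
  with energy[OF *] show ?thesis by linarith
qed

text \<open>
  By \<open>deriv_p\<close> the equation \<open>p' = \<kappa> p\<close> holds with \<open>\<kappa> = F\<phi> m/(2 F q)\<close>. This vanishes for \<open>q \<ge> 9\<close>. For \<open>1 \<le> q \<le> 9\<close>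
  the estimates \<open>4 q F \<ge> 1\<close> and \<open>F m\<^sup>2 \<le> q\<^sup>2\<close> give \<open>m\<^sup>2 \<le> 4 q\<^sup>3 \<le> 54\<^sup>2\<close>, whence \<open>|\<kappa>| \<le> 108\<close>.
\<close>

lemma m_zero_propagates:
  assumes ge: "\<And>t. t \<in> {a..b} \<Longrightarrow> 1 \<le> q (c t)" and zero: "m a = 0 \<or> m b = 0" and t: "t \<in> {a..b}"
  shows "m t = 0"
proof -
  have pm: "p s = F (c s) * m s / q (c s)" if "s \<in> {a..b}" for s
    using ge[OF that] by (intro p_outer) simp
  have "p t = 0"
  proof (rule zero_of_linear_bound[of a b p _ 108])
    fix s assume s: "s \<in> {a..b}"
    note q = ge[OF s]
    show "(p has_real_derivative F\<phi> (c s) * (m s)\<^sup>2 / (2 * (q (c s))\<^sup>2)) (at s)"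
      using q by (intro deriv_p) simp
    show "\<bar>F\<phi> (c s) * (m s)\<^sup>2 / (2 * (q (c s))\<^sup>2)\<bar> \<le> 108 * \<bar>p s\<bar>"
    proof (cases "q (c s) \<le> 9")
      case True
      have F: "1 \<le> 4 * q (c s) * F (c s)"
        using F_ge[OF q] q by (simp add: field_simps)
      have "(m s)\<^sup>2 \<le> 54\<^sup>2"
      proof -
        have "F (c s) * (m s)\<^sup>2 \<le> (q (c s))\<^sup>2"
          using F_m_le[OF q] q by (simp add: divide_le_eq)
        then have "4 * q (c s) * (F (c s) * (m s)\<^sup>2) \<le> 4 * q (c s) * (q (c s))\<^sup>2"
          using q by (intro mult_left_mono) auto
        moreover have "1 * (m s)\<^sup>2 \<le> 4 * q (c s) * F (c s) * (m s)\<^sup>2"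
          using F by (rule mult_right_mono) simp
        moreover have "4 * q (c s) * (q (c s))\<^sup>2 \<le> 4 * 9 * 9\<^sup>2"
          using True q by (intro mult_mono power_mono) auto
        ultimately show ?thesis by (simp add: mult.assoc)
      qed
      then have m: "\<bar>m s\<bar> \<le> 54" using abs_le_square_iff[of "m s" 54] by simp
      have "\<bar>F\<phi> (c s)\<bar> * \<bar>m s\<bar> \<le> 1 * 54"
        using F\<phi>_le_1[OF q] m by (intro mult_mono) auto
      also have "\<dots> \<le> 54 * (4 * q (c s) * F (c s))" using F by simp
      finally have "(\<bar>F\<phi> (c s)\<bar> * \<bar>m s\<bar>) * (\<bar>m s\<bar> / (2 * (q (c s))\<^sup>2)) \<le> 54 * (4 * q (c s) * F (c s)) * (\<bar>m s\<bar> / (2 * (q (c s))\<^sup>2))"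
        by (rule mult_right_mono) (use q in simp)
      also have "\<dots> = 108 * \<bar>p s\<bar>"
        using q F_pos[OF q] unfolding pm[OF s] by (simp add: abs_mult field_simps power2_eq_square)
      finally show ?thesis
        by (simp add: abs_mult power2_eq_square)
    next
      case False
      then show ?thesis by (simp add: F\<phi>_far)
    qed
  qed (use t zero pm[of a] pm[of b] in auto)
  then show ?thesis
    using pm[OF t] ge[OF t] F_pos[of "c t"] by auto
qed

lemma radial_velocity:
  assumes "1 \<le> q (c t)" "m t = 0"
  shows "(n t)\<^sup>2 = q (c t)" "v t = (n t / q (c t)) *\<^sub>R c t"
proof -
  show "(n t)\<^sup>2 = q (c t)"
    using energy[OF assms(1)] assms by (simp add: divide_eq_1_iff)
  have "q (c t) *\<^sub>R v t = n t *\<^sub>R c t"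
    using polar_decomposition[of "c t" "v t"] assms(2) unfolding q_inner n_def m_def by simp
  then have "(1 / q (c t)) *\<^sub>R (q (c t) *\<^sub>R v t) = (1 / q (c t)) *\<^sub>R (n t *\<^sub>R c t)" by simp
  then show "v t = (n t / q (c t)) *\<^sub>R c t"
    using assms(1) by simp
qed

text \<open>
  Here \<open>\<kappa>\<close> is the sign of the radial velocity: its square is 1 while \<open>m = 0\<close>, so it cannot change.
\<close>

lemma radial_ray_closed:
  assumes \<kappa>: "\<kappa> = 1 \<or> \<kappa> = -1" and ge: "\<And>t. t \<in> {a..b} \<Longrightarrow> 1 \<le> q (c t)"
    and start: "m a = 0" "n a = \<kappa> * r a" and t: "t \<in> {a..b}"
  shows "c t = ((r a + \<kappa> * (t - a)) / r a) *\<^sub>R c a" "v t = (\<kappa> / r a) *\<^sub>R c a"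
    "r t = r a + \<kappa> * (t - a)"
proof -
  have m0: "m s = 0" if "s \<in> {a..b}" for s
    using m_zero_propagates[OF ge _ that] start by blast
  have r1: "1 \<le> r s" if "s \<in> {a..b}" for s
    using ge[OF that] by (simp add: r_def)
  define f where "f s = \<kappa> * (n s / r s)" for s
  have f2: "(f s)\<^sup>2 = 1" if "s \<in> {a..b}" for s
    using radial_velocity(1)[OF ge[OF that] m0[OF that]] r_square[of s] r1[OF that] \<kappa>
    unfolding f_def power_mult_distrib power_divide by auto
  have fa: "f a = 1" using start \<kappa> r1[of a] t by (auto simp: f_def)
  have f1: "f s = 1" if s: "s \<in> {a..b}" for s
  proof (rule ccontr)
    assume "f s \<noteq> 1"
    with f2[OF s] have "f s = -1" by (auto simp: power2_eq_1_iff)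
    have "continuous_on {a..s} f"
      unfolding f_def using r1 s by (intro continuous_intros continuous_n continuous_r) fastforce
    then obtain x where "a \<le> x" "x \<le> s" "f x = 0"
      using IVT2'[of f s 0 a] fa \<open>f s = -1\<close> s by auto
    with f2[of x] s show False by auto
  qed
  have nr: "n s / r s = \<kappa>" if "s \<in> {a..b}" for s
    using f1[OF that] \<kappa> by (auto simp: f_def)
  have r: "r s = r a + \<kappa> * (s - a)" if s: "s \<in> {a..b}" for s
  proof -
    have D: "((\<lambda>s. r s - \<kappa> * (s - a)) has_vector_derivative 0) (at x within {a..b})" if "x \<in> {a..b}" for x
    proof -
      have "((\<lambda>s. r s - \<kappa> * (s - a)) has_real_derivative n x / r x - \<kappa> * (1 - 0)) (at x)"
        by (intro DERIV_diff DERIV_cmult deriv_r[OF ge[OF that]] DERIV_ident DERIV_const)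
      then show ?thesis
        using nr[OF that] by (simp add: has_real_derivative_iff_has_vector_derivative has_vector_derivative_at_within)
    qed
    obtain k where "\<And>s. s \<in> {a..b} \<Longrightarrow> r s - \<kappa> * (s - a) = k"
      using has_vector_derivative_zero_constant[OF _ D] by (metis convex_real_interval(5))
    from this[OF s] this[of a] s have "r s - \<kappa> * (s - a) = r a - \<kappa> * (a - a)" by simp
    then show ?thesis by simp
  qed
  show "r t = r a + \<kappa> * (t - a)" by (rule r[OF t])
  have vs: "v s = (\<kappa> / r s) *\<^sub>R c s" if "s \<in> {a..b}" for s
  proof -
    have "n s / q (c s) = \<kappa> / r s"
      using nr[OF that] r1[OF that] by (simp add: r_square[symmetric] power2_eq_square field_simps)
    then show ?thesis using radial_velocity(2)[OF ge[OF that] m0[OF that]] by simp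
  qed
  have D: "((\<lambda>s. (1 / r s) *\<^sub>R c s) has_vector_derivative 0) (at s within {a..b})" if s: "s \<in> {a..b}" for s
  proof -
    have "((\<lambda>s. 1 / r s) has_real_derivative - (\<kappa> / (r s)\<^sup>2)) (at s)"
      using DERIV_inverse'[OF deriv_r[OF ge[OF s]]] r1[OF s] nr[OF s]
      by (simp add: power2_eq_square inverse_eq_divide)
    then have "((\<lambda>s. (1 / r s) *\<^sub>R c s) has_vector_derivative (1 / r s) *\<^sub>R v s + (- (\<kappa> / (r s)\<^sup>2)) *\<^sub>R c s) (at s)"
      by (intro has_vector_derivative_scaleR deriv_c)
    then show ?thesis unfolding vs[OF s] using has_vector_derivative_at_within
      by (fastforce simp: power2_eq_square)
  qed
  obtain k where k: "\<And>s. s \<in> {a..b} \<Longrightarrow> (1 / r s) *\<^sub>R c s = k"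
    using has_vector_derivative_zero_constant[OF _ D] by (metis convex_real_interval(5))
  have a: "a \<in> {a..b}" using t by simp
  have cs: "c s = r s *\<^sub>R k" if "s \<in> {a..b}" for s
    using k[OF that, symmetric] r1[OF that] by simp
  have ka: "k = (1 / r a) *\<^sub>R c a" using k[OF a] by simp
  show "c t = ((r a + \<kappa> * (t - a)) / r a) *\<^sub>R c a"
    unfolding cs[OF t] r[OF t] ka by simp
  show "v t = (\<kappa> / r a) *\<^sub>R c a"
    unfolding vs[OF t] cs[OF t] ka using r1[OF t] by simp
qed

text \<open>
  That the curve stays outside the unit circle follows by continuity, as the formula for \<open>r\<close> excludes
  a first time at which \<open>r = 1\<close>.
\<close>

lemma radial_ray:
  assumes \<kappa>: "\<kappa> = 1 \<or> \<kappa> = -1" and "1 < r a" "m a = 0" "n a = \<kappa> * r a"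
    and t: "a \<le> t" "1 < r a + \<kappa> * (t - a)"
  shows "c t = ((r a + \<kappa> * (t - a)) / r a) *\<^sub>R c a" "v t = (\<kappa> / r a) *\<^sub>R c a"
    "r t = r a + \<kappa> * (t - a)"
proof -
  have ge: "1 < r s" if s: "s \<in> {a..t}" for s
  proof (rule ccontr)
    assume "\<not> 1 < r s"
    then obtain d where d: "a < d" "d \<le> s" "- r d = -1" "\<And>x. a \<le> x \<Longrightarrow> x < d \<Longrightarrow> - r x < -1"
      using first_hit[of a s "\<lambda>t. - r t" "-1"] assms s continuous_r by (auto intro: continuous_on_minus)
    have "1 \<le> q (c x)" if "x \<in> {a..d}" for x
      using d(3) d(4)[of x] that q_ge_iff[of 1 x] by (cases "x = d") auto
    from radial_ray_closed(3)[OF \<kappa> this assms(3,4), of d d] d(1,3) have "1 = r a + \<kappa> * (d - a)" by simp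
    moreover have "d - a \<le> t - a" "0 \<le> d - a" using d s by auto
    ultimately show False using \<kappa> t assms(2) by auto
  qed
  then have "1 \<le> q (c s)" if "s \<in> {a..t}" for s
    using q_ge_iff[of 1 s] that by fastforce
  from radial_ray_closed[OF \<kappa> this assms(3,4), of t t] t(1) show "c t = ((r a + \<kappa> * (t - a)) / r a) *\<^sub>R c a" "v t = (\<kappa> / r a) *\<^sub>R c a"
    "r t = r a + \<kappa> * (t - a)" by auto
qed

end

section \<open>Escaping geodesics\<close>

locale escaping_geodesic = two_line_geodesic +
  assumes escape: "\<exists>T. \<forall>t. T \<le> \<bar>t\<bar> \<longrightarrow> R \<le> r t"
begin

lemma q_ge_of_r: "1 \<le> r t \<Longrightarrow> 1 \<le> q (c t)" "2 \<le> r t \<Longrightarrow> 4 \<le> q (c t)" "3 \<le> r t \<Longrightarrow> 9 \<le> q (c t)"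
  using q_ge_iff[of 1 t] q_ge_iff[of 2 t] q_ge_iff[of 3 t] by auto

lemma p_square_le:
  assumes "1 \<le> q (c t)"
  shows "(p t)\<^sup>2 \<le> F (c t)"
proof -
  have "(p t)\<^sup>2 = F (c t) * (F (c t) * (m t)\<^sup>2 / (q (c t))\<^sup>2)"
    using assms by (subst p_outer) (auto simp: power2_eq_square)
  also have "\<dots> \<le> F (c t) * 1"
    using F_m_le[OF assms] F_pos[OF assms] by (intro mult_left_mono) auto
  finally show ?thesis by simp
qed

text \<open>
  In the cusp \<open>p\<close> is constant and \<open>p\<^sup>2 \<le> F = 1/q\<close> tends to zero along the geodesic.
\<close>

lemma incoming_end_radial: "\<exists>T. \<forall>t \<le> T. 3 \<le> r t \<and> m t = 0"
proof -
  obtain T where T: "\<And>t. T \<le> \<bar>t\<bar> \<Longrightarrow> 3 \<le> r t"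
    using escape[of 3] by blast
  define T1 where "T1 = - \<bar>T\<bar>"
  have r3: "3 \<le> r t" if "t \<le> T1" for t
    using T[of t] that by (auto simp: T1_def)
  note q9 = q_ge_of_r(3)[OF r3]
  have "(p has_vector_derivative 0) (at t within {..T1})" if "t \<in> {..T1}" for t
    using deriv_p[of t] q9[of t] that
    by (simp add: F\<phi>_far has_real_derivative_iff_has_vector_derivative has_vector_derivative_at_within)
  then obtain k where k: "\<And>t. t \<in> {..T1} \<Longrightarrow> p t = k"
    using has_vector_derivative_zero_constant[of "{..T1}" p] by auto
  have "k = 0"
  proof (rule ccontr)
    assume "k \<noteq> 0"
    obtain T2 where T2: "\<And>t. T2 \<le> \<bar>t\<bar> \<Longrightarrow> 2 / \<bar>k\<bar> \<le> r t"
      using escape[of "2 / \<bar>k\<bar>"] by blast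
    define t where "t = min T1 (- \<bar>T2\<bar>)"
    have t: "t \<le> T1" "2 / \<bar>k\<bar> \<le> r t" "9 \<le> q (c t)" "p t = k"
      using T2[of t] q9[of t] k[of t] by (auto simp: t_def)
    have "k\<^sup>2 \<le> 1 / q (c t)"
      using p_square_le[of t] t by (simp add: F_far)
    moreover have "(2 / \<bar>k\<bar>)\<^sup>2 \<le> q (c t)"
      using t(2) q_ge_iff[of "2 / \<bar>k\<bar>" t] by simp
    then have "4 \<le> k\<^sup>2 * q (c t)" using \<open>k \<noteq> 0\<close> by (simp add: power_divide divide_le_eq mult.commute)
    ultimately show False using t(3) by (simp add: le_divide_eq)
  qed
  have "m t = 0" if "t \<le> T1" for t
    using k[of t] that \<open>k = 0\<close> q9[OF that] F_pos[of "c t"] p_outer[of t] by auto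
  with r3 show ?thesis by blast
qed

text \<open>
  Going back in time, \<open>r\<close> has to grow, so the radial velocity is negative at some time of the radial end.
  From there \<open>radial_ray\<close> describes the future, and for the reversed geodesic the past. The radius 3/2,
  at which the description stops, lies in the flat zone and outside the unit circle.
\<close>

lemma incoming_ray:
  obtains N T where "N \<bullet> N = 1" "\<And>t. t \<le> T - 3 / 2 \<Longrightarrow> c t = (T - t) *\<^sub>R N \<and> v t = - N"
proof -
  obtain T1 where T1: "\<And>t. t \<le> T1 \<Longrightarrow> 3 \<le> r t" "\<And>t. t \<le> T1 \<Longrightarrow> m t = 0"
    using incoming_end_radial by blast
  obtain T2 where T2: "\<And>t. T2 \<le> \<bar>t\<bar> \<Longrightarrow> r T1 + 1 \<le> r t"
    using escape[of "r T1 + 1"] by blast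
  define t0 where "t0 = min (T1 - 1) (- \<bar>T2\<bar>)"
  have "t0 \<le> T1 - 1" "t0 \<le> - \<bar>T2\<bar>" by (simp_all add: t0_def)
  then have "t0 < T1" "T2 \<le> \<bar>t0\<bar>" by linarith+
  with T2[of t0] have t0: "t0 < T1" "r T1 < r t0" by auto
  have "(r has_real_derivative n x / r x) (at x)" if "x \<le> T1" for x
    using T1(1)[OF that] q_ge_of_r(1)[of x] by (intro deriv_r) auto
  then obtain \<xi> where \<xi>: "t0 < \<xi>" "\<xi> < T1" "r T1 - r t0 = (T1 - t0) * (n \<xi> / r \<xi>)"
    using MVT2[of t0 T1 r "\<lambda>x. n x / r x"] t0 by auto
  have r\<xi>: "3 \<le> r \<xi>" and m\<xi>: "m \<xi> = 0" using T1 \<xi> by auto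
  have "n \<xi> < 0"
  proof (rule ccontr)
    assume "\<not> n \<xi> < 0"
    then have "0 \<le> (T1 - t0) * (n \<xi> / r \<xi>)"
      using r\<xi> t0 by (intro mult_nonneg_nonneg divide_nonneg_nonneg) auto
    then show False using \<xi>(3) t0(2) by linarith
  qed
  moreover have "(n \<xi>)\<^sup>2 = (r \<xi>)\<^sup>2"
    using radial_velocity(1)[OF q_ge_of_r(1) m\<xi>] r\<xi> by (simp add: r_square)
  ultimately have n\<xi>: "n \<xi> = - r \<xi>"
    using r\<xi> by (auto simp: power2_eq_iff)
  interpret rev: two_line_geodesic s s1 s2 s3 \<psi> e "\<lambda>t. c (- t)" "\<lambda>t. - v (- t)"
    by unfold_locales (rule geodesic_flow_reverse[OF flow])
  have rv: "rev.r t = r (- t)" "rev.n t = - n (- t)" "rev.m t = - m (- t)" for t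
    by (simp_all add: rev.r_def r_def rev.n_def n_def rev.m_def m_def cross2_def)
  define N where "N = (1 / r \<xi>) *\<^sub>R c \<xi>"
  have "c \<xi> \<bullet> c \<xi> = r \<xi> * r \<xi>" using r_square[of \<xi>] by (simp add: q_inner power2_eq_square)
  then have "N \<bullet> N = 1"
    using r\<xi> by (simp add: N_def)
  moreover have "c t = ((\<xi> + r \<xi>) - t) *\<^sub>R N \<and> v t = - N" if t: "t \<le> (\<xi> + r \<xi>) - 3 / 2" for t
  proof (cases "t \<le> \<xi>")
    case True
    have "c (- (- t)) = ((rev.r (- \<xi>) + 1 * (- t - - \<xi>)) / rev.r (- \<xi>)) *\<^sub>R c (- (- \<xi>))"
      "- v (- (- t)) = (1 / rev.r (- \<xi>)) *\<^sub>R c (- (- \<xi>))"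
      by (rule rev.radial_ray; use True r\<xi> m\<xi> n\<xi> rv in auto)+
    then have "c t = ((r \<xi> + 1 * (- t - - \<xi>)) / r \<xi>) *\<^sub>R c \<xi>" "- v t = (1 / r \<xi>) *\<^sub>R c \<xi>"
      unfolding rv by simp_all
    moreover have "r \<xi> + 1 * (- t - - \<xi>) = \<xi> + r \<xi> - t" by simp
    ultimately show ?thesis unfolding N_def by (metis add.inverse_inverse scaleR_scaleR mult_1_right times_divide_eq_right)
  next
    case False
    have "c t = ((r \<xi> + - 1 * (t - \<xi>)) / r \<xi>) *\<^sub>R c \<xi>" "v t = (- 1 / r \<xi>) *\<^sub>R c \<xi>"
      by (rule radial_ray; use False t r\<xi> m\<xi> n\<xi> in auto)+
    moreover have "r \<xi> + - 1 * (t - \<xi>) = \<xi> + r \<xi> - t" by simp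
    ultimately show ?thesis unfolding N_def by (simp del: diff_add_eq)
  qed
  ultimately show ?thesis using that[of N "\<xi> + r \<xi>"] by simp
qed

text \<open>
  As long as \<open>r' \<ge> 1/2\<close> and \<open>r \<le> 1/(2|p a|)\<close>, even \<open>r' > 1/2\<close>: the bound on \<open>(1/p)'\<close> by \<open>1/r\<^sup>2 \<le> 2r'/r\<^sup>2\<close> shows
  that \<open>1/p \<plusminus> 2/r\<close> are monotone, so that \<open>1/p\<close> changes by at most 1; hence \<open>p\<close> remains small, and
  \<open>r'\<^sup>2 = 1 - p\<^sup>2/F \<ge> 1 - p\<^sup>2 r\<^sup>2\<close>.
\<close>

lemma excursion_bounds:
  assumes start: "r a = 2" "p a \<noteq> 0" and Q: "Q = 1 / \<bar>p a\<bar>" "1000 \<le> Q"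
    and out: "\<And>t. a \<le> t \<Longrightarrow> t \<le> d \<Longrightarrow> r t / 2 \<le> n t \<and> r t \<le> Q / 2"
    and t: "a \<le> t" "t \<le> d"
  shows "2 \<le> r t" "p t \<noteq> 0" "\<bar>1 / p t - 1 / p a\<bar> \<le> 1" "r t / 2 < n t"
proof -
  have q4: "4 \<le> q (c s)" if s: "a \<le> s" "s \<le> d" for s
  proof -
    have "q (c a) \<le> q (c s)"
    proof (rule DERIV_nonneg_imp_nondecreasing[OF s(1)])
      fix x assume x: "a \<le> x" "x \<le> s"
      have "0 \<le> 2 * n x" using out[of x] x s r_nonneg[of x] by auto
      then show "\<exists>y. ((\<lambda>s. q (c s)) has_real_derivative y) (at x) \<and> 0 \<le> y"
        using deriv_q by blast
    qed
    then show ?thesis using start(1) r_square[of a] by simp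
  qed
  then have r2: "2 \<le> r s" if "a \<le> s" "s \<le> d" for s
    using q_ge_iff[of 2 s] that by simp
  show "2 \<le> r t" by (rule r2[OF t])
  have p0: "p s \<noteq> 0" if s: "a \<le> s" "s \<le> d" for s
  proof
    assume "p s = 0"
    then have "m s = 0"
      using p_outer[of s] q4[OF s] F_pos[of "c s"] by auto
    then have "m a = 0"
      using m_zero_propagates[of a s a] q4 s by force
    then show False using p_outer[of a] start q4[of a] s by auto
  qed
  show "p t \<noteq> 0" by (rule p0[OF t])
  define h' where "h' s = - (F\<phi> (c s) / (2 * (F (c s))\<^sup>2))" for s
  have Dh: "((\<lambda>s. 1 / p s) has_real_derivative h' s) (at s)" if s: "a \<le> s" "s \<le> d" for s
  proof -
    have "((\<lambda>s. inverse (p s)) has_real_derivative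
       - (inverse (p s) * (F\<phi> (c s) * (m s)\<^sup>2 / (2 * (q (c s))\<^sup>2)) * inverse (p s))) (at s)"
      using q4[OF s] p0[OF s] by (intro DERIV_inverse' deriv_p) auto
    moreover have "- (inverse (p s) * (F\<phi> (c s) * (m s)\<^sup>2 / (2 * (q (c s))\<^sup>2)) * inverse (p s)) = h' s"
    proof -
      have m0: "m s \<noteq> 0" "F (c s) > 0" "q (c s) > 0"
        using p_outer[of s] q4[OF s] p0[OF s] F_pos[of "c s"] by auto
      have ps: "p s = F (c s) * m s / q (c s)" using q4[OF s] by (intro p_outer) simp
      show ?thesis using m0 unfolding h'_def ps by (simp add: field_simps power2_eq_square)
    qed
    ultimately show ?thesis by (simp add: inverse_eq_divide)
  qed
  have Dr: "((\<lambda>s. 2 / r s) has_real_derivative - (2 * (n s / r s) / (r s)\<^sup>2)) (at s)" if s: "a \<le> s" "s \<le> d" for s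
  proof -
    have "((\<lambda>s. 2 * inverse (r s)) has_real_derivative 2 * - (inverse (r s) * (n s / r s) * inverse (r s))) (at s)"
      using q4[OF s] r2[OF s] by (intro DERIV_cmult DERIV_inverse' deriv_r) auto
    moreover have "2 * - (inverse (r s) * (n s / r s) * inverse (r s)) = - (2 * (n s / r s) / (r s)\<^sup>2)"
      using r2[OF s] by (simp add: field_simps power2_eq_square)
    moreover have "(\<lambda>s. 2 * inverse (r s)) = (\<lambda>s. 2 / r s)" by (simp add: field_simps)
    ultimately show ?thesis by simp
  qed
  have bound: "\<bar>h' s\<bar> \<le> 2 * (n s / r s) / (r s)\<^sup>2" if s: "a \<le> s" "s \<le> d" for s
  proof -
    have F: "F (c s) > 0" using F_pos[of "c s"] q4[OF s] by simp
    have "\<bar>h' s\<bar> = \<bar>F\<phi> (c s)\<bar> / (2 * (F (c s))\<^sup>2)" by (simp add: h'_def)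
    also have "\<dots> \<le> (2 * (F (c s))\<^sup>2 / q (c s)) / (2 * (F (c s))\<^sup>2)"
      using F\<phi>_bound[OF q4[OF s]] by (rule divide_right_mono) simp
    also have "\<dots> = 1 / (r s)\<^sup>2" using F by (simp add: r_square)
    also have "\<dots> \<le> 2 * (n s / r s) / (r s)\<^sup>2"
      using out[OF s] r2[OF s] by (intro divide_right_mono) (auto simp: field_simps)
    finally show ?thesis .
  qed
  have "1 / p t + 2 / r t \<le> 1 / p a + 2 / r a"
  proof (rule DERIV_nonpos_imp_nonincreasing[OF t(1)])
    fix x assume x: "a \<le> x" "x \<le> t"
    then have x': "a \<le> x" "x \<le> d" using t by auto
    have "h' x + - (2 * (n x / r x) / (r x)\<^sup>2) \<le> 0" using bound[OF x'] by linarith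
    then show "\<exists>y. ((\<lambda>s. 1 / p s + 2 / r s) has_real_derivative y) (at x) \<and> y \<le> 0"
      using DERIV_add[OF Dh[OF x'] Dr[OF x']] by blast
  qed
  moreover have "1 / p a - 2 / r a \<le> 1 / p t - 2 / r t"
  proof (rule DERIV_nonneg_imp_nondecreasing[OF t(1)])
    fix x assume x: "a \<le> x" "x \<le> t"
    then have x': "a \<le> x" "x \<le> d" using t by auto
    have "0 \<le> h' x - - (2 * (n x / r x) / (r x)\<^sup>2)" using bound[OF x'] by linarith
    then show "\<exists>y. ((\<lambda>s. 1 / p s - 2 / r s) has_real_derivative y) (at x) \<and> 0 \<le> y"
      using DERIV_diff[OF Dh[OF x'] Dr[OF x']] by blast
  qed
  moreover have "0 \<le> 2 / r t" using r_nonneg[of t] by simp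
  moreover have "2 / r a = 1" using start(1) by simp
  ultimately show diff: "\<bar>1 / p t - 1 / p a\<bar> \<le> 1" unfolding abs_le_iff by linarith
  have "\<bar>1 / p a\<bar> = Q" using Q(1) by simp
  then have "Q - 1 \<le> \<bar>1 / p t\<bar>" using diff by linarith
  then have "\<bar>p t\<bar> * (Q - 1) \<le> \<bar>p t\<bar> * \<bar>1 / p t\<bar>" by (rule mult_left_mono) simp
  then have pQ: "\<bar>p t\<bar> * (Q - 1) \<le> 1" using p0[OF t] by (simp add: abs_mult[symmetric])
  have "\<bar>p t\<bar> * r t \<le> \<bar>p t\<bar> * ((Q - 1) * (3 / 4))"
    using out[OF t] Q(2) by (intro mult_left_mono) auto
  also have "\<dots> = (\<bar>p t\<bar> * (Q - 1)) * (3 / 4)" by simp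
  also have "\<dots> \<le> 1 * (3 / 4)" using pQ by (rule mult_right_mono) simp
  also have "\<dots> = 3 / 4" by simp
  finally have "(\<bar>p t\<bar> * r t)\<^sup>2 \<le> (3 / 4)\<^sup>2"
    by (rule power_mono) (simp add: r_nonneg)
  then have pq: "(p t)\<^sup>2 * q (c t) \<le> 9 / 16"
    by (simp add: power_mult_distrib r_square power_divide)
  have qt: "1 \<le> q (c t)" "0 < F (c t)" using q4[OF t] F_pos[of "c t"] by auto
  have "F (c t) * (m t)\<^sup>2 / (q (c t))\<^sup>2 = (p t)\<^sup>2 / F (c t)"
    using qt by (subst p_outer) (auto simp: field_simps power2_eq_square)
  also have "\<dots> \<le> (p t)\<^sup>2 / (1 / q (c t))"
    using F_bounds(1)[OF q4[OF t]] qt by (intro divide_left_mono mult_pos_pos) auto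
  also have "\<dots> = (p t)\<^sup>2 * q (c t)" by simp
  finally have "F (c t) * (m t)\<^sup>2 / (q (c t))\<^sup>2 \<le> 9 / 16" using pq by (rule order_trans)
  with energy[OF qt(1)] have "7 / 16 \<le> (n t)\<^sup>2 / q (c t)" by linarith
  then have "7 / 16 * (r t)\<^sup>2 \<le> (n t)\<^sup>2" using qt by (simp add: r_square le_divide_eq)
  moreover have "(r t / 2)\<^sup>2 < 7 / 16 * (r t)\<^sup>2"
  proof -
    have "0 < r t * r t" using r2[OF t] by simp
    then show ?thesis by (simp add: power2_eq_square)
  qed
  ultimately have "(r t / 2)\<^sup>2 < (n t)\<^sup>2" by linarith
  then show "r t / 2 < n t"
  proof (rule power_less_imp_less_base)
    show "0 \<le> n t" using out[OF t] r_nonneg[of t] by linarith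
  qed
qed

lemma n_le_r: "1 \<le> q (c t) \<Longrightarrow> n t \<le> r t"
proof -
  assume *: "1 \<le> q (c t)"
  have "0 \<le> F (c t) * (m t)\<^sup>2 / (q (c t))\<^sup>2" using F_pos[OF *] by simp
  with energy[OF *] have "(n t)\<^sup>2 / q (c t) \<le> 1" by linarith
  then have "(n t)\<^sup>2 \<le> (r t)\<^sup>2" using * by (simp add: r_square)
  then show ?thesis using r_nonneg by (rule power2_le_imp_le)
qed

text \<open>
  A continuity argument with \<open>excursion_bounds\<close> gives \<open>r' > 1/2\<close> up to the time \<open>b\<close> at which
  \<open>r = Q/2\<close>, \<open>Q = 1/|p a|\<close>. On this way \<open>|\<phi>'| = |p|/F \<ge> r\<^sup>2/(144 (Q + 1))\<close> and \<open>r' \<le> 1\<close>, so the angle changes by at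
  least \<open>((Q/2)\<^sup>3 - 8)/(432 (Q + 1))\<close>, which exceeds \<open>2\<pi>\<close> for \<open>Q \<ge> 1000\<close>.
\<close>

lemma excursion_meets_every_direction:
  assumes start: "r a = 2" "1 < n a" "p a \<noteq> 0" and Q: "1000 \<le> 1 / \<bar>p a\<bar>" and N: "N \<bullet> N = 1"
  obtains t x where "a \<le> t" "2 \<le> x" "c t = x *\<^sub>R N"
proof -
  define Q where "Q = 1 / \<bar>p a\<bar>"
  have Q1000: "1000 \<le> Q" using Q by (simp add: Q_def)
  obtain T where T: "\<And>t. T \<le> \<bar>t\<bar> \<Longrightarrow> Q / 2 \<le> r t"
    using escape[of "Q / 2"] by blast
  obtain b where b: "a < b" "r b = Q / 2" "\<And>t. a \<le> t \<Longrightarrow> t < b \<Longrightarrow> r t < Q / 2"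
  proof (rule first_hit[of a "max a \<bar>T\<bar>" r "Q / 2"])
    show "Q / 2 \<le> r (max a \<bar>T\<bar>)" by (rule T) auto
  qed (use start Q1000 continuous_r in auto)
  have rb: "r t \<le> Q / 2" if "a \<le> t" "t \<le> b" for t
    using b(2) b(3)[of t] that by (cases "t = b") auto
  have n_gt: "r t / 2 < n t" if t: "a \<le> t" "t \<le> b" for t
  proof (rule ccontr)
    assume "\<not> r t / 2 < n t"
    moreover have "continuous_on {a..t} (\<lambda>t. r t / 2 - n t)"
      by (intro continuous_intros continuous_r continuous_n) auto
    ultimately obtain d where d: "a < d" "d \<le> t" "r d / 2 - n d = 0" "\<And>x. a \<le> x \<Longrightarrow> x < d \<Longrightarrow> r x / 2 - n x < 0"
      using first_hit[of a t "\<lambda>t. r t / 2 - n t" 0] start t by auto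
    have "r d / 2 < n d"
    proof (rule excursion_bounds(4)[OF start(1,3) Q_def Q1000])
      fix x assume "a \<le> x" "x \<le> d"
      then show "r x / 2 \<le> n x \<and> r x \<le> Q / 2"
        using d(3) d(4)[of x] rb[of x] t d(2) by (cases "x = d") auto
    qed (use d in auto)
    with d(3) show False by simp
  qed
  note bnd = excursion_bounds[OF start(1,3) Q_def Q1000, of b]
  have r2: "2 \<le> r t" and p0: "p t \<noteq> 0" and diff: "\<bar>1 / p t - 1 / p a\<bar> \<le> 1" if "a \<le> t" "t \<le> b" for t
    using bnd(1-3)[of t] n_gt rb that by (auto intro: less_imp_le)
  have q4: "4 \<le> q (c t)" if "a \<le> t" "t \<le> b" for t
    using r2[OF that] by (rule q_ge_of_r)
  \<comment> \<open>The angular velocity; the maximum makes it continuous beyond the interval, so that its antiderivative is differentiable at the end points.\<close>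
  define k where "k t = m t / max 1 (q (c t))" for t
  have k: "k t = m t / q (c t)" if "a \<le> t" "t \<le> b" for t
    using q4[OF that] by (simp add: k_def max_def)
  have "continuous_on {a - 1..b + 1} k"
    unfolding k_def by (intro continuous_intros continuous_m continuous_q) (auto simp: max_def split: if_splits)
  then obtain \<theta>0 where "\<And>t. t \<in> {a - 1..b + 1} \<Longrightarrow> (\<theta>0 has_vector_derivative k t) (at t within {a - 1..b + 1})"
    using antiderivative_continuous by blast
  then have D\<theta>0: "(\<theta>0 has_real_derivative k t) (at t)" if "a \<le> t" "t \<le> b" for t
    using that at_within_Icc_at[of "a - 1" t "b + 1"]
    by (metis (no_types, opaque_lifting) add_increasing2 atLeastAtMost_iff diff_less_eq has_real_derivative_iff_has_vector_derivative
        le_less_trans less_add_one less_eq_real_def less_le_trans)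
  define y where "y t = (1 / r t) *\<^sub>R c t" for t
  have y1: "y t \<bullet> y t = 1" if "a \<le> t" "t \<le> b" for t
  proof -
    have "c t \<bullet> c t = r t * r t" using r_square[of t] by (simp add: q_inner power2_eq_square)
    then show ?thesis using r2[OF that] by (simp add: y_def)
  qed
  have "(y a $ 1)\<^sup>2 + (y a $ 2)\<^sup>2 = 1" using y1[of a] b by (simp add: inner_real2 power2_eq_square)
  then obtain \<alpha>0 where \<alpha>0: "y a $ 1 = cos \<alpha>0" "y a $ 2 = sin \<alpha>0"
    by (rule sincos_total_2pi)
  define \<theta> where "\<theta> t = \<theta>0 t - \<theta>0 a + \<alpha>0" for t
  have D\<theta>: "(\<theta> has_real_derivative k t) (at t)" if "a \<le> t" "t \<le> b" for t
    unfolding \<theta>_def using D\<theta>0[OF that] by (auto intro!: derivative_eq_intros)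
  have Dy: "((\<lambda>t. y t $ 1) has_real_derivative - (k t * y t $ 2)) (at t)"
    "((\<lambda>t. y t $ 2) has_real_derivative k t * y t $ 1) (at t)" if t: "a \<le> t" "t \<le> b" for t
  proof -
    have Dc: "((\<lambda>t. c t $ i) has_real_derivative v t $ i) (at t)" for i
      using bounded_linear.has_vector_derivative[OF bounded_linear_vec_nth deriv_c, of i]
      by (simp add: has_real_derivative_iff_has_vector_derivative)
    have rq: "r t > 0" "q (c t) = r t * r t" using r2[OF t] r_square[of t] by (auto simp: power2_eq_square)
    have i: "((\<lambda>t. inverse (r t)) has_real_derivative - (inverse (r t) * (n t / r t) * inverse (r t))) (at t)"
      using q4[OF t] rq by (intro DERIV_inverse' deriv_r) auto
    have V: "(r t * r t) * v t $ 1 = n t * c t $ 1 - m t * c t $ 2"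
      "(r t * r t) * v t $ 2 = n t * c t $ 2 + m t * c t $ 1"
      using polar_decomposition[of "c t" "v t"]
      unfolding q_inner[symmetric] n_def[symmetric] m_def[symmetric] rq vec_eq_iff forall_2 by simp_all
    have V': "v t $ 1 = (n t * c t $ 1 - m t * c t $ 2) / (r t * r t)"
      "v t $ 2 = (n t * c t $ 2 + m t * c t $ 1) / (r t * r t)"
      using V rq by (simp_all add: field_simps)
    have yc: "(\<lambda>t. y t $ i) = (\<lambda>t. inverse (r t) * c t $ i)" for i
      by (simp add: y_def inverse_eq_divide)
    have "((\<lambda>t. y t $ 1) has_real_derivative - (inverse (r t) * (n t / r t) * inverse (r t)) * c t $ 1 + v t $ 1 * inverse (r t)) (at t)"
      unfolding yc by (rule DERIV_mult[OF i Dc])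
    moreover have "- (inverse (r t) * (n t / r t) * inverse (r t)) * c t $ 1 + v t $ 1 * inverse (r t) = - (k t * y t $ 2)"
      unfolding V' k[OF t] rq yc[THEN fun_cong] using rq(1) by (simp add: field_simps)
    ultimately show "((\<lambda>t. y t $ 1) has_real_derivative - (k t * y t $ 2)) (at t)" by simp
    have "((\<lambda>t. y t $ 2) has_real_derivative - (inverse (r t) * (n t / r t) * inverse (r t)) * c t $ 2 + v t $ 2 * inverse (r t)) (at t)"
      unfolding yc by (rule DERIV_mult[OF i Dc])
    moreover have "- (inverse (r t) * (n t / r t) * inverse (r t)) * c t $ 2 + v t $ 2 * inverse (r t) = k t * y t $ 1"
      unfolding V' k[OF t] rq yc[THEN fun_cong] using rq(1) by (simp add: field_simps)
    ultimately show "((\<lambda>t. y t $ 2) has_real_derivative k t * y t $ 1) (at t)" by simp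
  qed
  \<comment> \<open>The unit vectors \<open>y\<close> and \<open>(cos \<theta>, sin \<theta>)\<close> rotate with the same speed, so their inner product is constant.\<close>
  define G where "G t = y t $ 1 * cos (\<theta> t) + y t $ 2 * sin (\<theta> t)" for t
  have "(G has_vector_derivative 0) (at t within {a..b})" if "t \<in> {a..b}" for t
  proof -
    have t: "a \<le> t" "t \<le> b" using that by auto
    have "(G has_real_derivative
       (- (k t * y t $ 2) * cos (\<theta> t) + (- sin (\<theta> t) * k t) * y t $ 1) + (k t * y t $ 1 * sin (\<theta> t) + (cos (\<theta> t) * k t) * y t $ 2)) (at t)"
      unfolding G_def by (intro DERIV_add DERIV_mult Dy[OF t] DERIV_chain2[OF DERIV_cos D\<theta>[OF t]] DERIV_chain2[OF DERIV_sin D\<theta>[OF t]])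
    moreover have "(- (k t * y t $ 2) * cos (\<theta> t) + (- sin (\<theta> t) * k t) * y t $ 1) + (k t * y t $ 1 * sin (\<theta> t) + (cos (\<theta> t) * k t) * y t $ 2) = 0"
      by (simp add: algebra_simps)
    ultimately show ?thesis
      by (simp add: has_real_derivative_iff_has_vector_derivative has_vector_derivative_at_within)
  qed
  then obtain G0 where G0: "\<And>t. t \<in> {a..b} \<Longrightarrow> G t = G0"
    using has_vector_derivative_zero_constant[of "{a..b}" G] by auto
  have "G a = 1" using \<alpha>0 by (simp add: G_def \<theta>_def flip: power2_eq_square)
  with G0[of a] b have "G0 = 1" by simp
  have yt: "y t = vector [cos (\<theta> t), sin (\<theta> t)]" if t: "a \<le> t" "t \<le> b" for t
  proof -
    have "(y t $ 1 - cos (\<theta> t))\<^sup>2 + (y t $ 2 - sin (\<theta> t))\<^sup>2 = y t \<bullet> y t + ((sin (\<theta> t))\<^sup>2 + (cos (\<theta> t))\<^sup>2) - 2 * G t"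
      unfolding inner_real2 G_def by (simp add: power2_eq_square algebra_simps)
    also have "\<dots> = 0" using y1[OF t] G0[of t] \<open>G0 = 1\<close> t by simp
    finally show ?thesis
      by (simp add: vec_eq_iff forall_2 sum_power2_eq_zero_iff)
  qed
  define \<sigma> where "\<sigma> = sgn (p a)"
  have \<sigma>: "\<sigma> = 1 \<or> \<sigma> = -1" using start(3) by (auto simp: \<sigma>_def sgn_real_def)
  have \<sigma>p: "1 / (Q + 1) \<le> \<sigma> * p t" if t: "a \<le> t" "t \<le> b" for t
  proof -
    have "\<sigma> * (1 / p a) = Q" using start(3) by (auto simp: \<sigma>_def sgn_real_def Q_def)
    moreover have "\<bar>\<sigma> * (1 / p t) - \<sigma> * (1 / p a)\<bar> \<le> 1"
      using diff[OF t] \<sigma> by (auto simp: abs_if split: if_splits)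
    ultimately have *: "\<sigma> * (1 / p t) \<le> Q + 1" "0 < \<sigma> * (1 / p t)" using Q1000 by (auto simp: abs_le_iff)
    have "1 / (Q + 1) \<le> 1 / (\<sigma> * (1 / p t))" by (rule frac_le[OF _ order_refl *(2,1)]) simp
    also have "\<dots> = \<sigma> * p t" using \<sigma> by auto
    finally show ?thesis .
  qed
  have sweep: "\<sigma> * \<theta> a - (r a) ^ 3 / (432 * (Q + 1)) \<le> \<sigma> * \<theta> b - (r b) ^ 3 / (432 * (Q + 1))"
  proof (rule DERIV_nonneg_imp_nondecreasing[of a b "\<lambda>t. \<sigma> * \<theta> t - (r t) ^ 3 / (432 * (Q + 1))"])
    fix t assume t: "a \<le> t" "t \<le> b"
    have qt: "4 \<le> q (c t)" "1 \<le> q (c t)" "0 < F (c t)" using q4[OF t] F_pos[of "c t"] by auto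
    have "((\<lambda>t. \<sigma> * \<theta> t - (r t) ^ 3 / (432 * (Q + 1))) has_real_derivative
      \<sigma> * k t - real 3 * ((r t) ^ (3 - Suc 0) * (n t / r t)) / (432 * (Q + 1))) (at t)"
      by (intro DERIV_diff DERIV_cmult D\<theta>[OF t] DERIV_cdivide DERIV_power[THEN DERIV_cong, OF deriv_r[OF qt(2)]]) simp
    moreover have "0 \<le> \<sigma> * k t - real 3 * ((r t) ^ (3 - Suc 0) * (n t / r t)) / (432 * (Q + 1))"
    proof -
      have "n t / r t \<le> 1" using n_le_r[OF qt(2)] r2[OF t] by simp
      then have "3 * ((r t)\<^sup>2 * (n t / r t)) \<le> 3 * ((r t)\<^sup>2 * 1)"
        by (intro mult_left_mono) auto
      moreover have "3 - Suc 0 = 2" by simp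
      ultimately have "real 3 * ((r t) ^ (3 - Suc 0) * (n t / r t)) \<le> 3 * ((r t)\<^sup>2 * 1)"
        by (metis of_nat_numeral)
      then have "real 3 * ((r t) ^ (3 - Suc 0) * (n t / r t)) / (432 * (Q + 1)) \<le> 3 * ((r t)\<^sup>2 * 1) / (432 * (Q + 1))"
        using Q1000 by (intro divide_right_mono) auto
      also have "\<dots> = 1 / (Q + 1) * (q (c t) / 144)"
        using Q1000 by (simp add: r_square field_simps)
      also have "\<dots> \<le> \<sigma> * p t * (1 / F (c t))"
      proof (rule mult_mono[OF \<sigma>p[OF t]])
        show "q (c t) / 144 \<le> 1 / F (c t)"
          using F_bounds(2)[OF qt(1)] qt by (simp add: field_simps)
        show "0 \<le> \<sigma> * p t"
          by (rule order_trans[OF _ \<sigma>p[OF t]]) (use Q1000 in auto)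
      qed (use qt in auto)
      also have "\<dots> = \<sigma> * k t"
        unfolding k[OF t] using qt by (subst p_outer) auto
      finally show ?thesis by simp
    qed
    ultimately show "\<exists>y. ((\<lambda>t. \<sigma> * \<theta> t - (r t) ^ 3 / (432 * (Q + 1))) has_real_derivative y) (at t) \<and> 0 \<le> y"
      by blast
  qed (use b in auto)
  have "8 * (432 * (Q + 1)) \<le> (r b) ^ 3 - (r a) ^ 3"
  proof -
    have "500 * 500 \<le> (Q / 2) * (Q / 2)" using Q1000 by (intro mult_mono) auto
    then have "(500 * 500) * (Q / 2) \<le> ((Q / 2) * (Q / 2)) * (Q / 2)" using Q1000 by (intro mult_right_mono) auto
    then have "125000 * Q \<le> (Q / 2) ^ 3" by (simp add: power3_eq_cube)
    then show ?thesis using Q1000 unfolding b(2) start(1) by simp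
  qed
  then have "8 \<le> ((r b) ^ 3 - (r a) ^ 3) / (432 * (Q + 1))"
    using Q1000 by (simp add: le_divide_eq)
  with sweep have big: "8 \<le> \<sigma> * (\<theta> b - \<theta> a)"
    by (simp add: diff_divide_distrib right_diff_distrib)
  have "(N $ 1)\<^sup>2 + (N $ 2)\<^sup>2 = 1" using N by (simp add: inner_real2 power2_eq_square)
  then obtain \<alpha> where \<alpha>: "N $ 1 = cos \<alpha>" "N $ 2 = sin \<alpha>"
    by (rule sincos_total_2pi)
  define lo where "lo = min (\<theta> a) (\<theta> b)"
  define j where "j = \<lceil>(lo - \<alpha>) / (2 * pi)\<rceil>"
  have j: "lo \<le> \<alpha> + 2 * pi * j" "\<alpha> + 2 * pi * j \<le> lo + 8"
  proof -
    have "(lo - \<alpha>) / (2 * pi) \<le> j" by (simp add: j_def)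
    then show "lo \<le> \<alpha> + 2 * pi * j" by (simp add: divide_le_eq mult.commute)
    have "j \<le> (lo - \<alpha>) / (2 * pi) + 1" unfolding j_def by linarith
    then have "2 * pi * j \<le> 2 * pi * ((lo - \<alpha>) / (2 * pi) + 1)" by (intro mult_left_mono) auto
    also have "\<dots> = lo - \<alpha> + 2 * pi" by (simp add: distrib_left)
    finally show "\<alpha> + 2 * pi * j \<le> lo + 8" using pi_less_4 by simp
  qed
  have cont: "continuous_on {a..b} \<theta>"
    using D\<theta> by (intro continuous_at_imp_continuous_on ballI) (metis DERIV_isCont atLeastAtMost_iff)
  have "\<exists>t\<ge>a. t \<le> b \<and> \<theta> t = \<alpha> + 2 * pi * j"
  proof (cases "\<sigma> = 1")
    case True
    then show ?thesis using big j b cont by (intro IVT') (auto simp: lo_def)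
  next
    case False
    then have "\<sigma> = -1" using \<sigma> by simp
    then show ?thesis using big j b cont by (intro IVT2') (auto simp: lo_def)
  qed
  then obtain t where t: "a \<le> t" "t \<le> b" "\<theta> t = \<alpha> + 2 * pi * j" by auto
  have "cos (\<theta> t) = cos \<alpha>" "sin (\<theta> t) = sin \<alpha>"
    unfolding t(3) by (simp_all add: cos_add sin_add)
  then have "y t = N" unfolding yt[OF t(1,2)] using \<alpha> by (simp add: vec_eq_iff forall_2)
  then have "c t = r t *\<^sub>R N" using r2[OF t(1,2)] by (auto simp: y_def)
  with t r2[OF t(1,2)] show ?thesis using that by blast
qed

lemma straight_in_flat_zone:
  assumes flat: "\<And>t. t \<in> {a..b} \<Longrightarrow> q (c t) < 5" and t: "t \<in> {a..b}"
  shows "D\<Phi> (c t) (v t) = D\<Phi> (c a) (v a)" "\<Phi> (c t) = \<Phi> (c a) + (t - a) *\<^sub>R D\<Phi> (c a) (v a)"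
proof -
  have "((\<lambda>t. D\<Phi> (c t) (v t)) has_vector_derivative 0) (at s within {a..b})" if "s \<in> {a..b}" for s
    by (rule has_vector_derivative_at_within[OF flat_velocity_constant[OF flat[OF that]]])
  then obtain W where W: "\<And>s. s \<in> {a..b} \<Longrightarrow> D\<Phi> (c s) (v s) = W"
    using has_vector_derivative_zero_constant[of "{a..b}" "\<lambda>t. D\<Phi> (c t) (v t)"] by auto
  have a: "a \<in> {a..b}" using t by simp
  show "D\<Phi> (c t) (v t) = D\<Phi> (c a) (v a)" using W[OF t] W[OF a] by simp
  have "((\<lambda>t. \<Phi> (c t) - (t - a) *\<^sub>R W) has_vector_derivative 0) (at s within {a..b})" if s: "s \<in> {a..b}" for s
  proof -
    have "((\<lambda>t. \<Phi> (c t)) has_vector_derivative W) (at s)"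
      using vector_derivative_diff_chain_within[of c "v s" s UNIV \<Phi> "D\<Phi> (c s)"] deriv_c[of s]
        has_derivative_at_withinI[OF has_derivative_\<Phi>[of "c s"]] W[OF s] by (simp add: o_def)
    moreover have "((\<lambda>t. (t - a) *\<^sub>R W) has_vector_derivative W) (at s)"
      by (auto intro!: derivative_eq_intros)
    ultimately have "((\<lambda>t. \<Phi> (c t) - (t - a) *\<^sub>R W) has_vector_derivative W - W) (at s)"
      by (rule has_vector_derivative_diff)
    then show ?thesis by (simp add: has_vector_derivative_at_within)
  qed
  then obtain K where K: "\<And>s. s \<in> {a..b} \<Longrightarrow> \<Phi> (c s) - (s - a) *\<^sub>R W = K"
    using has_vector_derivative_zero_constant[of "{a..b}" "\<lambda>t. \<Phi> (c t) - (t - a) *\<^sub>R W"] by auto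
  show "\<Phi> (c t) = \<Phi> (c a) + (t - a) *\<^sub>R D\<Phi> (c a) (v a)"
    using K[OF t] K[OF a] W[OF a] by (simp add: algebra_simps)
qed

lemma support'_scaleR: "support' (a *\<^sub>R z) = support' z" if "a \<noteq> 0"
proof -
  have "q (a *\<^sub>R z) = a\<^sup>2 * q z"
    by (simp add: q_def power_mult_distrib distrib_left)
  moreover have "- (4 * e * ((a *\<^sub>R z) $ 1 * (a *\<^sub>R z) $ 2)) = a\<^sup>2 * - (4 * e * (z $ 1 * z $ 2))"
    by (simp add: power2_eq_square)
  ultimately show ?thesis
    unfolding support'_def using that by (metis mult_divide_mult_cancel_left power_not_zero)
qed

text \<open>
  The geodesic enters the flat zone along the ray of direction \<open>N\<close>, and \<open>T2\<close> is the first time at which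
  \<open>r = 2\<close> afterwards. Between these times \<open>\<Phi> \<circ> c\<close> runs on a line of direction \<open>- N\<close>. Equating the moments
  of this line at both ends, by \<open>moment_outer\<close>, gives the fact \<open>mom\<close> in the proof. In the radial case it
  forces \<open>h' = 0\<close>, that is \<open>sin 2\<phi> = 0\<close>; otherwise it shows that \<open>m\<close> and \<open>p\<close> are of the order of \<open>e\<close>.
\<close>

lemma crossing_of_flat_zone:
  obtains N T T2 where "N \<bullet> N = 1" "\<And>t. t \<le> T - 3 / 2 \<Longrightarrow> c t = (T - t) *\<^sub>R N"
    "T - 3 / 2 < T2" "r T2 = 2"
    "\<And>t. t \<in> {T - 3 / 2..T2} \<Longrightarrow> \<Phi> (c t) = \<Phi> ((3 / 2) *\<^sub>R N) - (t - (T - 3 / 2)) *\<^sub>R N"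
    "m T2 = 0 \<Longrightarrow> N $ 1 * N $ 2 = 0 \<and> (\<forall>t\<ge>T2. c t = - ((2 + t - T2) *\<^sub>R N))"
    "m T2 \<noteq> 0 \<Longrightarrow> p T2 \<noteq> 0 \<and> 1000 \<le> 1 / \<bar>p T2\<bar> \<and> 1 < n T2"
proof -
  obtain N T where N: "N \<bullet> N = 1" and "\<And>t. t \<le> T - 3 / 2 \<Longrightarrow> c t = (T - t) *\<^sub>R N \<and> v t = - N"
    by (rule incoming_ray) blast
  then have ray_in: "c t = (T - t) *\<^sub>R N" "v t = - N" if "t \<le> T - 3 / 2" for t using that by auto
  define T1 where "T1 = T - 3 / 2"
  have c1: "c T1 = (3 / 2) *\<^sub>R N" "v T1 = - N" using ray_in[of T1] by (auto simp: T1_def)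
  have q1: "q (c T1) = 9 / 4" using N by (simp add: q_inner c1)
  then have "(r T1)\<^sup>2 = (3 / 2)\<^sup>2" by (simp only: r_square) (simp add: power_divide)
  then have r1: "r T1 = 3 / 2" using r_nonneg[of T1] by (simp add: power2_eq_iff_nonneg)
  obtain T' where T': "\<And>t. T' \<le> \<bar>t\<bar> \<Longrightarrow> 2 \<le> r t" using escape[of 2] by blast
  obtain T2 where T2: "T1 < T2" "r T2 = 2" "\<And>t. T1 \<le> t \<Longrightarrow> t < T2 \<Longrightarrow> r t < 2"
  proof (rule first_hit[of T1 "max T1 \<bar>T'\<bar>" r 2])
    show "2 \<le> r (max T1 \<bar>T'\<bar>)" by (rule T') auto
  qed (use r1 continuous_r in auto)
  have q2: "q (c T2) = 4" using T2(2) r_square[of T2] by simp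
  have flat: "q (c t) < 5" if "t \<in> {T1..T2}" for t
  proof -
    have "r t \<le> 2" using T2(2) T2(3)[of t] that by (cases "t = T2") auto
    then have "(r t)\<^sup>2 \<le> 2\<^sup>2" using r_nonneg by (rule power_mono)
    then show ?thesis by (simp add: r_square)
  qed
  have m1: "m T1 = 0" by (simp add: m_def c1 cross2_def)
  have W1: "D\<Phi> (c T1) (v T1) = - N"
  proof -
    have "cross2 (c T1) (v T1) = 0" using m1 by (simp add: m_def)
    with D\<Phi>_outer[of "c T1" "v T1"] q1 have "D\<Phi> (c T1) (v T1) = v T1" by simp
    then show ?thesis by (simp add: c1)
  qed
  have straight: "D\<Phi> (c t) (v t) = - N" "\<Phi> (c t) = \<Phi> (c T1) + (t - T1) *\<^sub>R - N" if "t \<in> {T1..T2}" for t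
    using straight_in_flat_zone[of T1 T2 t] flat that W1 by auto
  have T2I: "T2 \<in> {T1..T2}" "T1 \<in> {T1..T2}" using T2(1) by auto
  have W2: "D\<Phi> (c T2) (v T2) = - N" by (rule straight(1)[OF T2I(1)])
  have n2: "0 \<le> n T2"
  proof (rule ccontr)
    assume "\<not> 0 \<le> n T2"
    then have "2 * n T2 < 0" by simp
    from DERIV_neg_dec_left[OF deriv_q this]
    obtain d where d: "0 < d" "\<And>h. 0 < h \<Longrightarrow> h < d \<Longrightarrow> q (c T2) < q (c (T2 - h))" by auto
    define h where "h = min (d / 2) (T2 - T1)"
    have "0 < h" "h < d" "T1 \<le> T2 - h" "T2 - h < T2" using d T2 by (auto simp: h_def)
    with d(2)[of h] T2(3)[of "T2 - h"] have "4 < q (c (T2 - h))" "r (T2 - h) < 2" using q2 by auto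
    moreover from this have "(r (T2 - h))\<^sup>2 < 2\<^sup>2" using r_nonneg[of "T2 - h"] by (intro power_strict_mono) auto
    ultimately show False by (simp add: r_square)
  qed
  have n2_le: "n T2 \<le> 2" using n_le_r[of T2] q2 T2(2) by simp
  have mom1: "cross2 (\<Phi> (c T1)) (- N) = support' N"
  proof -
    have "c T1 \<bullet> v T1 = - (3 / 2)" using N by (simp add: c1)
    moreover have "sqrt (q (c T1)) = 3 / 2" using r1 by (simp add: r_def)
    ultimately show ?thesis
      using moment_outer[of "c T1" "v T1"] q1 m1 support'_scaleR[of "3 / 2" N]
      by (simp add: W1 m_def[symmetric]) (simp add: c1)
  qed
  have mom: "(1 + support (c T2) / 2) * (\<rho> (c T2) * m T2 / 2) - support' (c T2) / 2 * n T2 = support' N"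
  proof -
    have "cross2 (\<Phi> (c T2)) (- N) = cross2 (\<Phi> (c T1)) (- N)"
      unfolding straight(2)[OF T2I(1)] by (simp add: cross2_def algebra_simps)
    moreover have "sqrt (q (c T2)) = 2" using T2(2) by (simp add: r_def)
    ultimately show ?thesis
      using moment_outer[of "c T2" "v T2"] q2 unfolding W2 mom1 m_def[symmetric] n_def[symmetric] by simp
  qed
  show ?thesis
  proof (rule that[OF N ray_in(1), of T2])
    show "T - 3 / 2 < T2" "r T2 = 2" using T2 by (simp_all add: T1_def)
    fix t assume "t \<in> {T - 3 / 2..T2}"
    then show "\<Phi> (c t) = \<Phi> ((3 / 2) *\<^sub>R N) - (t - (T - 3 / 2)) *\<^sub>R N"
      using straight(2)[of t] by (simp add: T1_def[symmetric] c1)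
  next
    assume m0: "m T2 = 0"
    have rad: "(n T2)\<^sup>2 = 4" "v T2 = (n T2 / 4) *\<^sub>R c T2"
      using radial_velocity[of T2] q2 m0 by auto
    have "(n T2)\<^sup>2 = 2\<^sup>2" using rad(1) by simp
    then have nT2: "n T2 = 2" using n2 by (rule power2_eq_imp_eq) simp
    have "v T2 = - N"
      using W2 q2 m0 D\<Phi>_outer[of "c T2" "v T2"] by (simp add: m_def[symmetric])
    with rad(2) nT2 have "(1 / 2) *\<^sub>R c T2 = - N" by simp
    then have c2: "c T2 = - (2 *\<^sub>R N)"
      by (metis (no_types, lifting) divide_self_if mult.commute scaleR_minus_right scaleR_one scaleR_scaleR times_divide_eq_left zero_neq_numeral)
    then have "support' (c T2) = support' N" using support'_scaleR[of "-2" N] by simp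
    with mom m0 nT2 have "support' N = 0" by simp
    moreover have "q N = 1" using N by (simp add: q_inner)
    ultimately have "N $ 1 * N $ 2 = 0" using e by (simp add: support'_def)
    moreover have "c t = - ((2 + t - T2) *\<^sub>R N)" if "T2 \<le> t" for t
    proof -
      have "c t = ((r T2 + 1 * (t - T2)) / r T2) *\<^sub>R c T2"
        by (rule radial_ray) (use T2(2) m0 nT2 that in auto)
      also have "\<dots> = - ((((r T2 + 1 * (t - T2)) / r T2) * 2) *\<^sub>R N)"
        unfolding c2 by simp
      also have "((r T2 + 1 * (t - T2)) / r T2) * 2 = 2 + t - T2"
        unfolding T2(2) by simp
      finally show ?thesis .
    qed
    ultimately show "N $ 1 * N $ 2 = 0 \<and> (\<forall>t\<ge>T2. c t = - ((2 + t - T2) *\<^sub>R N))" by blast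
  next
    assume m0: "m T2 \<noteq> 0"
    define A where "A = \<rho> (c T2) * m T2"
    have \<rho>2: "\<bar>\<rho> (c T2) - 2\<bar> \<le> 3 * e" "0 < \<rho> (c T2)" "\<rho> (c T2) \<le> 3"
      using \<rho>_bounds[of "c T2"] q2 T2(2) e unfolding r_def abs_le_iff by auto
    have "\<bar>support' (c T2) / 2 * n T2\<bar> \<le> (2 * e / 2) * 2"
      unfolding abs_mult using abs_support'[of "c T2"] q2 n2 n2_le e by (intro mult_mono) auto
    moreover have "\<bar>support' N\<bar> \<le> 2 * e" using abs_support'[of N] N by (simp add: q_inner)
    ultimately have "\<bar>(1 + support (c T2) / 2) * (A / 2)\<bar> \<le> 4 * e"
      using mom unfolding A_def abs_le_iff by linarith
    moreover have "1 / 2 \<le> 1 + support (c T2) / 2"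
      using abs_support[of "c T2"] q2 e unfolding abs_le_iff by auto
    then have "1 / 2 * \<bar>A / 2\<bar> \<le> \<bar>1 + support (c T2) / 2\<bar> * \<bar>A / 2\<bar>"
      by (intro mult_right_mono) auto
    ultimately have A: "\<bar>A\<bar> \<le> 16 * e" by (simp add: abs_mult)
    have F2: "F (c T2) = (\<rho> (c T2))\<^sup>2" using q2 by (intro F_flat) simp
    have pA: "p T2 = \<rho> (c T2) * A / 4"
      using q2 by (subst p_outer) (auto simp: F2 A_def power2_eq_square)
    have "\<bar>\<rho> (c T2) * A\<bar> \<le> 3 * (16 * e)"
      unfolding abs_mult using A \<rho>2 by (intro mult_mono) auto
    then have p_le: "\<bar>p T2\<bar> \<le> 1 / 1000" unfolding pA using e by simp
    have "\<rho> (c T2) * A / 4 \<noteq> 0" using m0 \<rho>2(2) by (simp add: A_def)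
    then have "p T2 \<noteq> 0" by (simp only: pA) simp
    moreover from this p_le have "1000 \<le> 1 / \<bar>p T2\<bar>" by (simp add: le_divide_eq)
    moreover have "1 < n T2"
    proof -
      have "F (c T2) * (m T2)\<^sup>2 = A\<^sup>2" by (simp add: F2 A_def power_mult_distrib)
      moreover have "\<bar>A\<bar> \<le> 1" using A e by simp
      then have "A\<^sup>2 \<le> 1" by (simp add: abs_square_le_1)
      ultimately have "(n T2)\<^sup>2 > 1\<^sup>2" using energy[of T2] q2 by simp
      then show ?thesis using n2 by (rule power_less_imp_less_base)
    qed
    ultimately show "p T2 \<noteq> 0 \<and> 1000 \<le> 1 / \<bar>p T2\<bar> \<and> 1 < n T2" by blast
  qed (simp add: T1_def)
qed

end

section \<open>The axes\<close>

definition axis_line :: "2 \<Rightarrow> (real^2) set" where "axis_line i = range (\<lambda>x. x *\<^sub>R axis i 1)"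

lemma axis2_nth [simp]: "axis (1::2) (1::real) $ 1 = 1" "axis (1::2) (1::real) $ 2 = 0"
  "axis (2::2) (1::real) $ 1 = 0" "axis (2::2) (1::real) $ 2 = 1"
  by (simp_all add: axis_def)

context two_line_metric
begin

text \<open>
  The sign of \<open>u\<close> on the two axes.
\<close>

definition orient :: "2 \<Rightarrow> real" where "orient i = (if i = 1 then 1 else -1)"

text \<open>
  On each axis \<open>\<Phi>\<close> is this function of the coordinate. It is an arclength parameter even in the cusp,
  where the metric is no longer flat but radial distances are still the Euclidean ones.
\<close>

definition arclen :: "2 \<Rightarrow> real \<Rightarrow> real" where
  "arclen i x = x + orient i * e * (2 * x * s (x\<^sup>2) + 2 * x ^ 3 * s1 (x\<^sup>2))"

definition axis_speed :: "2 \<Rightarrow> real \<Rightarrow> real" where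
  "axis_speed i x = (if i = 1 then a11 (x *\<^sub>R axis i 1) else a22 (x *\<^sub>R axis i 1))"

lemma \<Phi>_axis: "\<Phi> (x *\<^sub>R axis i 1) = arclen i x *\<^sub>R axis i 1"
  using exhaust_2[of i]
  by (auto simp: vec_eq_iff forall_2 \<Phi>_nth arclen_def orient_def q_def u_def power2_eq_square power3_eq_cube algebra_simps)

lemma a12_axis: "a12 (x *\<^sub>R axis i 1) = 0"
  using exhaust_2[of i] by (auto simp: a12_def)

lemma D\<Phi>_axis: "D\<Phi> (x *\<^sub>R axis i 1) (axis i 1) = axis_speed i x *\<^sub>R axis i 1"
  using exhaust_2[of i] a12_axis[of x i] by (auto simp: vec_eq_iff forall_2 axis_speed_def)

lemma axis_speed_ge: "1 / 2 \<le> axis_speed i x"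
  using D\<Phi>_coercive[of "axis i 1" "x *\<^sub>R axis i 1"] unfolding D\<Phi>_axis
  by (simp add: inner_axis_axis)

lemma deriv_arclen: "(arclen i has_real_derivative axis_speed i x) (at x)"
proof -
  have "((\<lambda>x. x *\<^sub>R axis i 1 :: real^2) has_vector_derivative axis i 1) (at x)"
    by (auto intro!: derivative_eq_intros)
  from has_real_derivative_along[OF has_derivative_inner_left[OF has_derivative_\<Phi>] this, of "axis i 1"]
  show ?thesis unfolding \<Phi>_axis D\<Phi>_axis by (simp add: inner_axis_axis)
qed

lemma deriv_axis_speed: obtains B where "(axis_speed i has_real_derivative B) (at x)"
proof -
  have "((\<lambda>x. x *\<^sub>R axis i 1 :: real^2) has_vector_derivative axis i 1) (at x)"
    by (auto intro!: derivative_eq_intros)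
  note D = has_real_derivative_along[OF has_derivative_a(1) this] has_real_derivative_along[OF has_derivative_a(3) this]
  show ?thesis
  proof (cases "i = 1")
    case True
    then have "axis_speed i = (\<lambda>x. a11 (x *\<^sub>R axis i 1))" by (simp add: fun_eq_iff axis_speed_def)
    with D(1) show ?thesis using that by metis
  next
    case False
    then have "axis_speed i = (\<lambda>x. a22 (x *\<^sub>R axis i 1))" by (simp add: fun_eq_iff axis_speed_def)
    with D(2) show ?thesis using that by metis
  qed
qed

lemma arclen_strict_mono: "x < y \<Longrightarrow> arclen i x < arclen i y"
  by (rule DERIV_pos_imp_increasing[of x y "arclen i"])
    (assumption, metis deriv_arclen axis_speed_ge half_gt_zero less_le_trans zero_less_one)

lemma arclen_outer:
  assumes "1 \<le> \<bar>x\<bar>"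
  shows "arclen i x = x + orient i * e * sgn x"
proof -
  have "1 \<le> x\<^sup>2" using assms by (metis one_power2 abs_le_square_iff abs_one)
  then have "1 / 2 < x\<^sup>2" by simp
  from s_outer(1,2)[OF this] have S: "s (x\<^sup>2) = 1 / \<bar>x\<bar>" "s1 (x\<^sup>2) = - (1 / (2 * \<bar>x\<bar> ^ 3))" by simp_all
  have "2 * x * s (x\<^sup>2) + 2 * x ^ 3 * s1 (x\<^sup>2) = sgn x"
    unfolding S using assms by (cases "x > 0") (auto simp: power_numeral_reduce field_simps)
  then show ?thesis by (simp add: arclen_def)
qed

lemma arclen_surj: "\<exists>x. arclen i x = y"
proof -
  define b where "b = \<bar>y\<bar> + 2"
  have b: "b > 0" "1 \<le> \<bar>b\<bar>" "1 \<le> \<bar>- b\<bar>" by (auto simp: b_def)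
  have "\<bar>orient i * e * 1\<bar> \<le> 1" using e by (simp add: orient_def)
  then have "arclen i (- b) \<le> y" "y \<le> arclen i b"
    unfolding arclen_outer[OF b(2)] arclen_outer[OF b(3)] using b(1)
    by (auto simp: b_def abs_le_iff abs_if split: if_splits)
  moreover have "continuous_on {- b..b} (arclen i)"
    using deriv_arclen by (intro continuous_at_imp_continuous_on ballI) (metis DERIV_isCont)
  ultimately show ?thesis using IVT'[of "arclen i" "- b" y b] b(1) by auto
qed

definition axis_param :: "2 \<Rightarrow> real \<Rightarrow> real" where "axis_param i y = (SOME x. arclen i x = y)"

lemma arclen_axis_param [simp]: "arclen i (axis_param i y) = y"
  unfolding axis_param_def using someI_ex[OF arclen_surj] .

lemma axis_param_arclen [simp]: "axis_param i (arclen i x) = x"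
  using arclen_strict_mono arclen_axis_param by (metis less_irrefl linorder_neqE_linordered_idom)

lemma deriv_axis_param: "(axis_param i has_real_derivative inverse (axis_speed i (axis_param i t))) (at t)"
proof (rule DERIV_inverse_function[of "arclen i" _ "axis_param i" t "t - 1" "t + 1"])
  show "(arclen i has_real_derivative axis_speed i (axis_param i t)) (at (axis_param i t))"
    by (rule deriv_arclen)
  show "axis_speed i (axis_param i t) \<noteq> 0"
    using axis_speed_ge[of i "axis_param i t"] by auto
  have "isCont (axis_param i) (arclen i (axis_param i t))"
    by (rule isCont_inverse_function[of 1]) (auto intro: DERIV_isCont[OF deriv_arclen])
  then show "isCont (axis_param i) t" by simp
qed auto

text \<open>
  Where \<open>\<psi> \<noteq> 0\<close>, both metrics in the convex combination measure the radial direction by 1.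
\<close>

lemma g_axis:
  shows "g (x *\<^sub>R axis i 1) $ i $ i = (axis_speed i x)\<^sup>2"
    and "j \<noteq> i \<Longrightarrow> g (x *\<^sub>R axis i 1) $ i $ j = 0"
proof -
  have outer: "\<psi> (x\<^sup>2) * ((s (x\<^sup>2))\<^sup>2 * x\<^sup>2) = \<psi> (x\<^sup>2) * (axis_speed i x)\<^sup>2"
  proof (cases "x\<^sup>2 \<le> 5")
    case False
    then have x: "1 / 2 < x\<^sup>2" "1 / 2 < q (x *\<^sub>R axis i 1)" using exhaust_2[of i] by (auto simp: q_def)
    have "axis_speed i x = 1"
      using exhaust_2[of i] a_outer(1,3)[OF x(2)] by (auto simp: axis_speed_def)
    moreover have "(s (x\<^sup>2))\<^sup>2 * x\<^sup>2 = 1"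
      unfolding s_outer(1)[OF x(1)] using x(1) by (cases "x = 0") (simp_all add: power_divide)
    ultimately show ?thesis by simp
  qed (simp add: \<psi>_0)
  have a: "(1 - \<psi> (x\<^sup>2)) * (axis_speed i x)\<^sup>2 + \<psi> (x\<^sup>2) * ((s (x\<^sup>2))\<^sup>2 * x\<^sup>2) = (axis_speed i x)\<^sup>2"
    unfolding outer by (simp add: algebra_simps)
  show "g (x *\<^sub>R axis i 1) $ i $ i = (axis_speed i x)\<^sup>2"
    using exhaust_2[of i] a a12_axis[of x i] by (auto simp: g_nth G11_def G22_def q_def axis_speed_def)
  show "g (x *\<^sub>R axis i 1) $ i $ j = 0" if "j \<noteq> i"
    using exhaust_2[of i] exhaust_2[of j] that a12_axis[of x i] by (auto simp: g_nth G12_def)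
qed

lemma g_even:
  assumes "j \<noteq> i"
  shows "g (x *\<^sub>R axis i 1 + (- h) *\<^sub>R axis j 1) $ i $ i = g (x *\<^sub>R axis i 1 + h *\<^sub>R axis j 1) $ i $ i"
  using exhaust_2[of i] exhaust_2[of j] assms
  by (auto simp: g_nth G11_def G22_def q_def a11_def a12_def a22_def u_def power_mult_distrib)

text \<open>
  On the axis the metric is diagonal, and by the reflection in the axis the normal derivative of its
  tangential coefficient vanishes.
\<close>

lemma christoffel_axis:
  assumes B: "(axis_speed i has_real_derivative B) (at x)"
  shows "christoffel g (x *\<^sub>R axis i 1) k i i = (if k = i then B / axis_speed i x else 0)"
proof -
  define z :: "real^2" where "z = x *\<^sub>R axis i 1"
  note dg = metric_coeff_differentiable[OF riemannian_g]
  have "((\<lambda>x. g (x *\<^sub>R axis i 1) $ i $ i) has_real_derivative 2 * axis_speed i x * B) (at x)"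
    unfolding g_axis using DERIV_power[OF B, of 2] by (simp add: mult_ac)
  then have 1: "partial_deriv i (\<lambda>y. g y $ i $ i) z = 2 * axis_speed i x * B"
    using partial_deriv_on_axis[OF dg] DERIV_unique unfolding z_def by blast
  have 2: "partial_deriv i (\<lambda>y. g y $ i $ j) z = 0" if "j \<noteq> i" for j
  proof -
    have "((\<lambda>x. g (x *\<^sub>R axis i 1) $ i $ j) has_real_derivative partial_deriv i (\<lambda>y. g y $ i $ j) z) (at x)"
      unfolding z_def by (rule partial_deriv_on_axis[OF dg])
    then show ?thesis unfolding g_axis(2)[OF that] by (rule DERIV_unique[OF _ DERIV_const])
  qed
  have 3: "partial_deriv j (\<lambda>y. g y $ i $ i) z = 0" if "j \<noteq> i" for j
    unfolding z_def by (rule partial_deriv_eq_0_of_even[OF dg g_even[OF that]])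
  have diag: "g z $ j $ l = 0" if "j \<noteq> l" for j l
  proof -
    have "j = i \<or> l = i" using that exhaust_2[of i] exhaust_2[of j] exhaust_2[of l] by metis
    then show ?thesis
      using g_axis(2)[of l i x] g_axis(2)[of j i x] that metric_coeff_symmetric[OF riemannian_g, of z j l]
      unfolding z_def by metis
  qed
  have "(\<Sum>j\<in>UNIV. g z $ k $ j * christoffel g z j i i) = g z $ k $ k * christoffel g z k i i"
    using exhaust_2[of k] diag[of 1 2] diag[of 2 1] by (auto simp: sum_2)
  then have eq: "g z $ k $ k * christoffel g z k i i =
     (partial_deriv i (\<lambda>y. g y $ i $ k) z + partial_deriv i (\<lambda>y. g y $ i $ k) z - partial_deriv k (\<lambda>y. g y $ i $ i) z) / 2"
    using christoffel_lowered[OF riemannian_g, of z k i i] by simp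
  have pos: "0 < g z $ k $ k"
  proof -
    have "axis k 1 \<noteq> (0::real^2)" by (simp add: axis_eq_0_iff)
    then have "0 < axis k 1 \<bullet> (g z *v axis k 1)"
      using riemannian_g unfolding riemannian_metric_def by blast
    also have "\<dots> = g z $ k $ k"
      using exhaust_2[of k] by (auto simp: quadratic_form_sum sum_2)
    finally show ?thesis .
  qed
  show ?thesis
  proof (cases "k = i")
    case True
    then have "(axis_speed i x)\<^sup>2 * christoffel g z k i i = axis_speed i x * B"
      using eq 1 g_axis(1)[of x i] by (simp add: z_def)
    then show ?thesis
      using True axis_speed_ge[of i x] by (simp add: z_def[symmetric] power2_eq_square field_simps)
  next
    case False
    then have "g z $ k $ k * christoffel g z k i i = 0" using eq 2 3 by simp
    then show ?thesis using False pos by (simp add: z_def)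
  qed
qed

lemma axis_geodesic: "unit_speed_geodesic g (\<lambda>t. axis_param i t *\<^sub>R axis i 1)"
proof -
  define w where "w t = inverse (axis_speed i (axis_param i t))" for t
  have "geodesic_flow g (\<lambda>t. axis_param i t *\<^sub>R axis i 1) (\<lambda>t. w t *\<^sub>R axis i 1)"
    unfolding geodesic_flow_def
  proof (intro allI conjI)
    fix t
    define x A where "x = axis_param i t" and "A = axis_speed i x"
    have A: "A \<noteq> 0" "0 < A" using axis_speed_ge[of i x] by (auto simp: A_def)
    obtain B where B: "(axis_speed i has_real_derivative B) (at x)" using deriv_axis_speed .
    show "((\<lambda>t. axis_param i t *\<^sub>R axis i 1) has_vector_derivative w t *\<^sub>R axis i 1) (at t)"
      unfolding w_def by (rule has_vector_derivative_scaleR[OF deriv_axis_param has_vector_derivative_const, THEN has_vector_derivative_eq_rhs]) simp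
    have "(w has_real_derivative - (inverse A * (B * inverse A) * inverse A)) (at t)"
      unfolding w_def A_def x_def
      by (rule DERIV_inverse'[OF DERIV_chain2[OF B[unfolded x_def] deriv_axis_param]]) (use A in \<open>simp add: A_def x_def\<close>)
    then have "((\<lambda>t. w t *\<^sub>R axis i 1) has_vector_derivative (- (inverse A * (B * inverse A) * inverse A)) *\<^sub>R axis i 1) (at t)"
      by (rule has_vector_derivative_scaleR[OF _ has_vector_derivative_const, THEN has_vector_derivative_eq_rhs]) simp
    moreover have "(- (inverse A * (B * inverse A) * inverse A)) *\<^sub>R axis i 1 =
      (\<chi> k. - (\<Sum>i'\<in>UNIV. \<Sum>j\<in>UNIV. christoffel g (axis_param i t *\<^sub>R axis i 1) k i' j * (w t *\<^sub>R axis i 1) $ i' * (w t *\<^sub>R axis i 1) $ j))"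
    proof -
      have sum: "(\<Sum>i'\<in>UNIV. \<Sum>j\<in>UNIV. christoffel g (x *\<^sub>R axis i 1) k i' j * (w t *\<^sub>R axis i 1) $ i' * (w t *\<^sub>R axis i 1) $ j)
        = christoffel g (x *\<^sub>R axis i 1) k i i * (w t * w t)" for k
        using exhaust_2[of i] by (auto simp: sum_2)
      have w: "w t = inverse A" by (simp add: w_def A_def x_def)
      show ?thesis
        unfolding x_def[symmetric] sum
        unfolding christoffel_axis[OF B] A_def[symmetric] w
        using A(1) by (simp add: vec_eq_iff axis_def divide_inverse)
    qed
    ultimately show "((\<lambda>t. w t *\<^sub>R axis i 1) has_vector_derivative
      (\<chi> k. - (\<Sum>i'\<in>UNIV. \<Sum>j\<in>UNIV. christoffel g (axis_param i t *\<^sub>R axis i 1) k i' j * (w t *\<^sub>R axis i 1) $ i' * (w t *\<^sub>R axis i 1) $ j))) (at t)"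
      by (rule has_vector_derivative_eq_rhs)
    have "axis i 1 \<bullet> (g (x *\<^sub>R axis i 1) *v axis i 1) = A\<^sup>2"
      using exhaust_2[of i] g_axis(1)[of x i] by (auto simp: quadratic_form_sum sum_2 A_def)
    then have "riem_norm g (x *\<^sub>R axis i 1) (axis i 1) = A"
      using A by (simp add: riem_norm_def)
    then show "riem_norm g (axis_param i t *\<^sub>R axis i 1) (w t *\<^sub>R axis i 1) = 1"
      using A riem_norm_scaleR[OF riemannian_g, of "x *\<^sub>R axis i 1" "w t" "axis i 1"] by (simp add: x_def w_def A_def)
  qed
  then show ?thesis unfolding unit_speed_geodesic_iff by blast
qed

lemma axis_line_embedded: "axis_line i \<in> embedded_geodesic_lines g"
proof -
  define c :: "real \<Rightarrow> real^2" where "c t = axis_param i t *\<^sub>R axis i 1" for t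
  have lin: "linear (\<lambda>x. x *\<^sub>R axis i 1 :: real^2)" "inj (\<lambda>x. x *\<^sub>R axis i 1 :: real^2)"
    by (auto intro!: linearI injI simp: scaleR_add_left axis_eq_0_iff)
  have param: "range (axis_param i) = UNIV"
    by (metis axis_param_arclen surj_def)
  have "inj (axis_param i)" by (metis arclen_axis_param injI)
  then have "inj c" using lin(2) unfolding c_def inj_def by blast
  moreover have "closed_map euclidean euclidean c"
    unfolding closed_map_def
  proof (intro allI impI)
    fix S :: "real set" assume "closedin euclidean S"
    then have S: "closed S" by simp
    have "axis_param i ` S = arclen i -` S"
      by (auto simp: image_iff) (metis axis_param_arclen)
    moreover have "closed (arclen i -` S)"
      by (rule closed_vimage[OF S]) (metis deriv_arclen DERIV_isCont continuous_at_imp_continuous_on)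
    ultimately have "closed (axis_param i ` S)" by simp
    then have "closed ((\<lambda>x. x *\<^sub>R axis i 1 :: real^2) ` (axis_param i ` S))"
      using lin by (rule closed_injective_linear_image)
    then show "closedin euclidean (c ` S)" by (simp add: c_def[abs_def] image_image)
  qed
  ultimately have "proper_map euclidean euclidean c"
    by (intro closed_injective_imp_proper_map) auto
  moreover have "range c = (\<lambda>x. x *\<^sub>R axis i 1) ` range (axis_param i)"
    by (simp add: c_def[abs_def] image_image)
  then have "range c = axis_line i"
    unfolding param axis_line_def .
  moreover have "unit_speed_geodesic g c"
    unfolding c_def by (rule axis_geodesic)
  ultimately show ?thesis using \<open>inj c\<close> unfolding embedded_geodesic_lines_def by blast
qed

end

section \<open>Exactly two embedded geodesic lines\<close>

context escaping_geodesic
begin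

text \<open>
  If the geodesic left the flat zone with \<open>m \<noteq> 0\<close>, then it would meet its incoming ray. Hence it is
  radial at both ends along one axis, and in between it stays on the axis, since \<open>\<Phi>\<close> is injective and
  maps the axis onto the line of the same direction.
\<close>

lemma range_is_axis_line:
  assumes "inj c"
  shows "\<exists>i. range c = axis_line i"
proof -
  obtain N T T2 where N: "N \<bullet> N = 1" and ray_in: "\<And>t. t \<le> T - 3 / 2 \<Longrightarrow> c t = (T - t) *\<^sub>R N"
    and T2: "T - 3 / 2 < T2" "r T2 = 2"
    and mid: "\<And>t. t \<in> {T - 3 / 2..T2} \<Longrightarrow> \<Phi> (c t) = \<Phi> ((3 / 2) *\<^sub>R N) - (t - (T - 3 / 2)) *\<^sub>R N"
    and zero: "m T2 = 0 \<Longrightarrow> N $ 1 * N $ 2 = 0 \<and> (\<forall>t\<ge>T2. c t = - ((2 + t - T2) *\<^sub>R N))"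
    and nonzero: "m T2 \<noteq> 0 \<Longrightarrow> p T2 \<noteq> 0 \<and> 1000 \<le> 1 / \<bar>p T2\<bar> \<and> 1 < n T2"
    using crossing_of_flat_zone by blast
  have "m T2 = 0"
  proof (rule ccontr)
    assume "m T2 \<noteq> 0"
    then obtain t x where t: "T2 \<le> t" "2 \<le> x" "c t = x *\<^sub>R N"
      using excursion_meets_every_direction[OF T2(2) _ _ _ N] nonzero by blast
    have "c (T - x) = x *\<^sub>R N" using ray_in[of "T - x"] t(2) by simp
    with t(3) \<open>inj c\<close> have "t = T - x" by (metis injD)
    with t T2 show False by simp
  qed
  with zero have N0: "N $ 1 * N $ 2 = 0" and ray_out: "\<And>t. T2 \<le> t \<Longrightarrow> c t = - ((2 + t - T2) *\<^sub>R N)" by auto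
  obtain i k where Ni: "N = k *\<^sub>R axis i 1" and k: "k = 1 \<or> k = -1"
  proof (cases "N $ 1 = 0")
    case True
    then have "(N $ 2)\<^sup>2 = 1" using N by (simp add: inner_real2 power2_eq_square)
    then show ?thesis using that[of "N $ 2" 2] True by (auto simp: vec_eq_iff forall_2 power2_eq_1_iff)
  next
    case False
    then have "N $ 2 = 0" using N0 by simp
    then have "(N $ 1)\<^sup>2 = 1" using N by (simp add: inner_real2 power2_eq_square)
    then show ?thesis using that[of "N $ 1" 1] \<open>N $ 2 = 0\<close> by (auto simp: vec_eq_iff forall_2 power2_eq_1_iff)
  qed
  have on_axis: "c t \<in> axis_line i" for t
  proof -
    consider "t \<le> T - 3 / 2" | "t \<in> {T - 3 / 2..T2}" | "T2 \<le> t" by fastforce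
    then show ?thesis
    proof cases
      case 1
      then show ?thesis using ray_in by (auto simp: axis_line_def Ni)
    next
      case 2
      have "\<Phi> (c t) = (arclen i (3 / 2 * k) - (t - (T - 3 / 2)) * k) *\<^sub>R axis i 1"
        using mid[OF 2] unfolding Ni by (simp add: \<Phi>_axis algebra_simps)
      also have "\<dots> = \<Phi> (axis_param i (arclen i (3 / 2 * k) - (t - (T - 3 / 2)) * k) *\<^sub>R axis i 1)"
        by (simp add: \<Phi>_axis)
      finally show ?thesis using \<Phi>_inj unfolding axis_line_def by blast
    next
      case 3
      then show ?thesis using ray_out[OF 3] unfolding axis_line_def Ni
        by (metis (no_types, lifting) rangeI scaleR_minus_left scaleR_scaleR)
    qed
  qed
  have "x *\<^sub>R axis i 1 \<in> range c" for x
  proof -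
    define X where "X = \<bar>x\<bar> + 2"
    define t1 t2 where "t1 = T - X" and "t2 = T2 - 2 + X"
    have t: "t1 \<le> t2" "t1 \<le> T - 3 / 2" "T2 \<le> t2" using T2 by (auto simp: t1_def t2_def X_def)
    have "c t1 = X *\<^sub>R N" "c t2 = - (X *\<^sub>R N)"
      using ray_in[OF t(2)] ray_out[OF t(3)] by (auto simp: t1_def t2_def)
    then have ends: "c t1 \<bullet> N = X" "c t2 \<bullet> N = - X" using N by auto
    have "continuous_on {t1..t2} (\<lambda>t. c t \<bullet> N)"
      by (intro continuous_on_inner continuous_c continuous_on_const)
    moreover have "- X \<le> x * k" "x * k \<le> X" using k by (auto simp: X_def)
    ultimately obtain t where "c t \<bullet> N = x * k"
      using IVT2'[of "\<lambda>t. c t \<bullet> N" t2 "x * k" t1] ends t(1) by auto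
    moreover obtain y where y: "c t = y *\<^sub>R axis i 1" using on_axis[of t] by (auto simp: axis_line_def)
    ultimately have "y = x" using k by (auto simp: Ni inner_axis_axis)
    with y show ?thesis by (metis rangeI)
  qed
  with on_axis have "range c = axis_line i" by (auto simp: axis_line_def)
  then show ?thesis ..
qed

end

context two_line_metric
begin

lemma embedded_geodesic_lines_eq: "embedded_geodesic_lines g = range axis_line"
proof
  show "range axis_line \<subseteq> embedded_geodesic_lines g"
    using axis_line_embedded by auto
  show "embedded_geodesic_lines g \<subseteq> range axis_line"
  proof
    fix L assume "L \<in> embedded_geodesic_lines g"
    then obtain c v where L: "L = range c" and flow: "geodesic_flow g c v" and inj: "inj c"
      and proper: "proper_map euclidean euclidean c"
      by (auto simp: embedded_geodesic_lines_def unit_speed_geodesic_iff)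
    interpret two_line_geodesic s s1 s2 s3 \<psi> e c v
      by unfold_locales (rule flow)
    interpret escaping_geodesic s s1 s2 s3 \<psi> e c v
    proof
      fix R
      have "compactin euclidean {t \<in> topspace euclidean. c t \<in> cball 0 R}"
        by (rule compactin_proper_map_preimage[OF proper]) simp
      then have "bounded {t. c t \<in> cball 0 R}" by (simp add: compact_imp_bounded)
      then obtain B where B: "\<And>t. norm (c t) \<le> R \<Longrightarrow> \<bar>t\<bar> \<le> B" by (auto simp: bounded_iff)
      have "R \<le> r t" if "B + 1 \<le> \<bar>t\<bar>" for t
        using B[of t] that by (force simp: r_def q_norm)
      then show "\<exists>T. \<forall>t. T \<le> \<bar>t\<bar> \<longrightarrow> R \<le> r t" by blast
    qed
    show "L \<in> range axis_line" using range_is_axis_line[OF inj] L by blast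
  qed
qed

end

lemma card_axis_lines: "card (range axis_line) = 2"
proof -
  have "axis_line 1 \<noteq> axis_line 2"
  proof
    assume eq: "axis_line 1 = axis_line 2"
    have "1 *\<^sub>R axis 1 1 \<in> axis_line 1" unfolding axis_line_def by (rule rangeI)
    then obtain x where "axis 1 1 = x *\<^sub>R (axis 2 1 :: real^2)" unfolding eq by (auto simp: axis_line_def)
    then have "(axis 1 1 :: real^2) $ 1 = (x *\<^sub>R axis 2 1 :: real^2) $ 1" by simp
    then show False by simp
  qed
  moreover have "range axis_line = {axis_line 1, axis_line 2}"
  proof -
    have "(UNIV :: 2 set) = {1, 2}" using exhaust_2 by auto
    then show ?thesis by (metis image_empty image_insert)
  qed
  ultimately show ?thesis by simp
qed

text \<open>
  The constant \<open>e\<close> has to be chosen after \<open>s\<close>, because it must be small compared with the derivatives of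
  \<open>s\<close> on the unit interval.
\<close>

lemma two_line_metric_exists: "\<exists>s s1 s2 s3 \<psi> e. two_line_metric s s1 s2 s3 \<psi> e"
proof -
  obtain s :: "real \<Rightarrow> real" where s: "C_infinity s" "\<And>q. q \<ge> 1 / 2 \<Longrightarrow> s q = 1 / sqrt q"
    using smooth_inverse_sqrt_exists by blast
  obtain f :: "real \<Rightarrow> real" where f: "C_infinity f" "\<And>x. 0 \<le> f x" "\<And>x. f x \<le> 1"
    "\<And>x. x \<le> 0 \<Longrightarrow> f x = 0" "\<And>x. x \<ge> 1 \<Longrightarrow> f x = 1"
    using smooth_step_exists by blast
  define s1 s2 s3 where "s1 = deriv s" and "s2 = deriv s1" and "s3 = deriv s2"
  have smooth: "C_infinity s1" "C_infinity s2"
    unfolding s1_def s2_def using s(1) by (simp_all add: C_infinity_real_deriv)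
  define \<psi> where "\<psi> q = f (q * (1 / 4) - 5 / 4)" for q
  have "C_infinity (\<lambda>q::real. q * (1 / 4) - 5 / 4)"
    by (intro C_infinity_diff C_infinity_mult C_infinity_const C_infinity_bounded_linear bounded_linear_ident)
  then have \<psi>: "C_infinity \<psi>"
    unfolding \<psi>_def by (rule C_infinity_compose_real[OF f(1)])
  have "\<exists>K. \<forall>q\<in>{0..1}. \<bar>h q\<bar> \<le> K" if "C_infinity h" for h :: "real \<Rightarrow> real"
  proof -
    have "bounded (h ` {0..1})"
      by (intro compact_imp_bounded compact_continuous_image C_infinity_imp_continuous_on that compact_Icc)
    then show ?thesis by (auto simp: bounded_iff)
  qed
  then obtain K0 K1 K2 where K: "\<And>q. q \<in> {0..1} \<Longrightarrow> \<bar>s q\<bar> \<le> K0" "\<And>q. q \<in> {0..1} \<Longrightarrow> \<bar>s1 q\<bar> \<le> K1"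
    "\<And>q. q \<in> {0..1} \<Longrightarrow> \<bar>s2 q\<bar> \<le> K2"
    using s(1) smooth by metis
  define K where "K = 100000 + \<bar>K0\<bar> + \<bar>K1\<bar> + \<bar>K2\<bar>"
  define e where "e = 1 / (1000 * K)"
  have K_pos: "K \<ge> 100000" by (simp add: K_def)
  have e: "0 < e" "e \<le> 1 / 100000" using K_pos by (auto simp: e_def field_simps)
  have small: "e * y \<le> 1 / 1000" if "y \<le> K" for y
    using that K_pos by (simp add: e_def field_simps)
  have "two_line_metric s s1 s2 s3 \<psi> e"
  proof
    fix q :: real
    show "(s has_real_derivative s1 q) (at q)" "(s1 has_real_derivative s2 q) (at q)" "(s2 has_real_derivative s3 q) (at q)"
      unfolding s1_def s2_def s3_def using s(1) by (simp_all add: C_infinity_real_deriv)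
    show "0 \<le> \<psi> q" "\<psi> q \<le> 1" unfolding \<psi>_def by (rule f)+
    show "q \<le> 5 \<Longrightarrow> \<psi> q = 0" "9 \<le> q \<Longrightarrow> \<psi> q = 1" unfolding \<psi>_def by (simp_all add: f)
    assume q: "0 \<le> q" "q \<le> 1"
    show "e * \<bar>s q\<bar> \<le> 1 / 1000" using K(1)[of q] q by (intro small) (auto simp: K_def)
    show "e * \<bar>s1 q\<bar> \<le> 1 / 1000" using K(2)[of q] q by (intro small) (auto simp: K_def)
    show "e * \<bar>s2 q\<bar> \<le> 1 / 1000" using K(3)[of q] q by (intro small) (auto simp: K_def)
  qed (use s smooth \<psi> e in auto)
  then show ?thesis by blast
qed

theorem theorem1p4:
  shows "\<exists>g :: real^2 \<Rightarrow> real^2^2.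
           complete_riemannian_metric g \<and> card (embedded_geodesic_lines g) = 2"
proof -
  obtain s s1 s2 s3 \<psi> e where "two_line_metric s s1 s2 s3 \<psi> e"
    using two_line_metric_exists by blast
  then interpret two_line_metric s s1 s2 s3 \<psi> e .
  show ?thesis
    using complete_g embedded_geodesic_lines_eq card_axis_lines by metis
qed

end
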